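(* When $\mathcal{P}$ is $1|prec|\max w_jT_j$, the problems $\textsc{Min-Exp}~\mathcal{P}$, $\textsc{Min-VaR}_\alpha~\mathcal{P}$ and $\textsc{Min-CVaR}_\alpha~\mathcal{P}$ are solvable in $O(f_{\max}^K\,(Kn^2))$ time.
   Context: Single machine scheduling: a set $J$ of $n$ jobs with precedence constraints; a schedule $\pi$ is a permutation of $J$ respecting them, processed without idle time from time 0. Each job has a deterministic positive integer weight $w_j$. A scenario set $\mathcal{U}=\{\xi_1,\dots,\xi_K\}$ with probabilities ${\rm Pr}[\xi_i]>0$ summing to 1 specifies nonnegative integer processing times $p_j(\xi)$ and nonnegative integer due dates $d_j(\xi)$. $C_j(\pi,\xi)$ is the completion time of $j$ under $\xi$, $T_j(\pi,\xi)=\max\{0,C_j(\pi,\xi)-d_j(\xi)\}$ and $f(\pi,\xi)=\max_jw_jT_j(\pi,\xi)$. $f_{\max}$ is an upper bound on $f(\pi,\xi)$ over all schedules and scenarios. ${\rm F}(\pi)$ is the random variable equal to $f(\pi,\xi_i)$ with probability ${\rm Pr}[\xi_i]$. $\textsc{Min-Exp}$ minimizes $\mathbf{E}[{\rm F}(\pi)]$; $\textsc{Min-VaR}_\alpha$ ($\alpha\in(0,1]$) minimizes $\mathbf{VaR}_\alpha[{\rm F}(\pi)]=\inf\{t:{\rm Pr}[{\rm F}(\pi)\le t]\ge\alpha\}$; $\textsc{Min-CVaR}_\alpha$ ($\alpha\in[0,1)$) minimizes $\mathbf{CVaR}_\alpha[{\rm F}(\pi)]=\inf_{\gamma}\{\gamma+\frac{1}{1-\alpha}\mathbf{E}[({\rm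 F}(\pi)-\gamma)^+]\}$.
   Formalization: The bound is proved with a constant depending on K when f_max ≥ 1, and with an absolute constant when f_max^K is replaced by (f_max+1)^K; the printed bound is 0 for f_max = 0, and a K-independent constant at f_max = 1 would solve an NP-hard problem in O(Kn²) time. *)

theory Defs
  imports "HOL-Probability.Probability" "HOL-Combinatorics.Multiset_Permutations"
begin

section \<open>Scheduling under a discrete scenario set\<close>

text \<open>
  The jobs are \<open>0, \<dots>, njobs - 1\<close> and the scenarios \<open>0, \<dots>, nscens - 1\<close>.
  \<open>(i, j) \<in> prec\<close> means that job \<open>i\<close> must precede job \<open>j\<close>; \<open>ptime \<xi> j\<close> and \<open>due \<xi> j\<close> are
  the processing time and the due date of \<open>j\<close> under \<open>\<xi>\<close>.
\<close>

record sched_instance =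
  njobs :: nat
  nscens :: nat
  prec :: "(nat \<times> nat) set"
  weight :: "nat \<Rightarrow> nat"
  ptime :: "nat \<Rightarrow> nat \<Rightarrow> nat"
  due :: "nat \<Rightarrow> nat \<Rightarrow> nat"
  scen_pmf :: "nat pmf"

text \<open>Arbitrary acyclic arc sets are allowed; \<open>prec\<close> need not be transitively closed.\<close>

definition valid_instance :: "sched_instance \<Rightarrow> bool" where
  "valid_instance I \<longleftrightarrow>
     njobs I \<ge> 1 \<and>
     prec I \<subseteq> {..<njobs I} \<times> {..<njobs I} \<and> acyclic (prec I) \<and>
     (\<forall>j<njobs I. weight I j > 0) \<and>
     set_pmf (scen_pmf I) = {..<nscens I}"

definition schedule :: "sched_instance \<Rightarrow> nat list \<Rightarrow> bool" where
  "schedule I \<pi> \<longleftrightarrow>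
     \<pi> \<in> permutations_of_set {..<njobs I} \<and>
     (\<forall>a<njobs I. \<forall>b<njobs I. (\<pi> ! a, \<pi> ! b) \<in> prec I \<longrightarrow> a < b)"

definition completion :: "sched_instance \<Rightarrow> nat list \<Rightarrow> nat \<Rightarrow> nat \<Rightarrow> nat" where
  "completion I \<pi> \<xi> j = sum_list (map (ptime I \<xi>) (takeWhile (\<lambda>i. i \<noteq> j) \<pi>)) + ptime I \<xi> j"

definition tardiness :: "sched_instance \<Rightarrow> nat list \<Rightarrow> nat \<Rightarrow> nat \<Rightarrow> int" where
  "tardiness I \<pi> \<xi> j = max 0 (int (completion I \<pi> \<xi> j) - int (due I \<xi> j))"

definition max_weighted_tardiness :: "sched_instance \<Rightarrow> nat list \<Rightarrow> nat \<Rightarrow> int" where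
  "max_weighted_tardiness I \<pi> \<xi> = (MAX j\<in>{..<njobs I}. int (weight I j) * tardiness I \<pi> \<xi> j)"

definition cost_bound :: "sched_instance \<Rightarrow> nat \<Rightarrow> bool" where
  "cost_bound I fmax \<longleftrightarrow>
     (\<forall>\<pi> \<xi>. schedule I \<pi> \<longrightarrow> \<xi> < nscens I \<longrightarrow> max_weighted_tardiness I \<pi> \<xi> \<le> int fmax)"

definition cost_pmf :: "sched_instance \<Rightarrow> nat list \<Rightarrow> real pmf" where
  "cost_pmf I \<pi> = map_pmf (\<lambda>\<xi>. real_of_int (max_weighted_tardiness I \<pi> \<xi>)) (scen_pmf I)"

definition Exp_cost :: "sched_instance \<Rightarrow> nat list \<Rightarrow> real" where
  "Exp_cost I \<pi> = measure_pmf.expectation (cost_pmf I \<pi>) (\<lambda>x. x)"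

definition VaR_cost :: "real \<Rightarrow> sched_instance \<Rightarrow> nat list \<Rightarrow> real" where
  "VaR_cost \<alpha> I \<pi> = Inf {t. measure_pmf.prob (cost_pmf I \<pi>) {..t} \<ge> \<alpha>}"

definition CVaR_cost :: "real \<Rightarrow> sched_instance \<Rightarrow> nat list \<Rightarrow> real" where
  "CVaR_cost \<alpha> I \<pi> =
     (INF \<gamma>. \<gamma> + 1 / (1 - \<alpha>) * measure_pmf.expectation (cost_pmf I \<pi>) (\<lambda>x. max 0 (x - \<gamma>)))"


section \<open>A unit-cost random access machine\<close>

text \<open>
  A structured real RAM: a store consists of registers and an addressable memory, both holding
  real numbers.  Every arithmetic operation, memory access and comparison costs one step.  There
  is neither division nor rounding, program constants are natural numbers, and a memory access
  whose address is not a natural number gets stuck.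
\<close>

datatype ram =
    Skip
  | Const nat nat
  | Add nat nat nat
  | Sub nat nat nat
  | Mul nat nat nat
  | Load nat nat
  | Store nat nat
  | Seq ram ram
  | IfLe nat nat ram ram
  | WhileLe nat nat ram

type_synonym store = "(nat \<Rightarrow> real) \<times> (nat \<Rightarrow> real)"

text \<open>\<open>exec P s t s'\<close>: started in store \<open>s\<close>, program \<open>P\<close> halts in store \<open>s'\<close> after exactly \<open>t\<close> steps.\<close>

inductive exec :: "ram \<Rightarrow> store \<Rightarrow> nat \<Rightarrow> store \<Rightarrow> bool" where
  Skip: "exec Skip s 1 s"
| Const: "exec (Const r c) (R, M) 1 (R(r := real c), M)"
| Add: "exec (Add r a b) (R, M) 1 (R(r := R a + R b), M)"
| Sub: "exec (Sub r a b) (R, M) 1 (R(r := R a - R b), M)"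
| Mul: "exec (Mul r a b) (R, M) 1 (R(r := R a * R b), M)"
| Load: "R a = real k \<Longrightarrow> exec (Load r a) (R, M) 1 (R(r := M k), M)"
| Store: "R a = real k \<Longrightarrow> exec (Store a b) (R, M) 1 (R, M(k := R b))"
| Seq: "exec P s t s' \<Longrightarrow> exec Q s' t' s'' \<Longrightarrow> exec (Seq P Q) s (t + t') s''"
| IfTrue: "fst s a \<le> fst s b \<Longrightarrow> exec P s t s' \<Longrightarrow> exec (IfLe a b P Q) s (Suc t) s'"
| IfFalse: "\<not> fst s a \<le> fst s b \<Longrightarrow> exec Q s t s' \<Longrightarrow> exec (IfLe a b P Q) s (Suc t) s'"
| WhileFalse: "\<not> fst s a \<le> fst s b \<Longrightarrow> exec (WhileLe a b P) s 1 s"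
| WhileTrue: "fst s a \<le> fst s b \<Longrightarrow> exec P s t s' \<Longrightarrow> exec (WhileLe a b P) s' t' s'' \<Longrightarrow>
    exec (WhileLe a b P) s (Suc (t + t')) s''"

lemma exec_deterministic:
  "exec P s t s' \<Longrightarrow> exec P s u s'' \<Longrightarrow> u = t \<and> s'' = s'"
proof (induction arbitrary: u s'' rule: exec.induct)
  case (Seq P s t s' Q t' s'')
  from Seq.prems show ?case by cases (use Seq.IH in blast)
next
  case (IfTrue s a b P t s' Q)
  from IfTrue.prems show ?case by cases (use IfTrue in blast)+
next
  case (IfFalse s a b Q t s' P)
  from IfFalse.prems show ?case by cases (use IfFalse in blast)+
next
  case (WhileTrue s a b P t s' t' s'')
  from WhileTrue.prems show ?case by cases (use WhileTrue in blast)+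
qed (erule exec.cases; simp)+


section \<open>Solvability in bounded time\<close>

text \<open>
  Input format: the parameters of the objective, the numbers of jobs and scenarios, the cost
  bound, the weights, the processing times and the due dates (both scenario by scenario), the
  scenario probabilities, and the adjacency matrix of the precedence relation.
\<close>

definition encode :: "real list \<Rightarrow> sched_instance \<Rightarrow> nat \<Rightarrow> real list" where
  "encode par I fmax =
     (let n = njobs I; K = nscens I in
        par @ [real n, real K, real fmax]
        @ map (\<lambda>j. real (weight I j)) [0..<n]
        @ concat (map (\<lambda>\<xi>. map (\<lambda>j. real (ptime I \<xi> j)) [0..<n]) [0..<K])
        @ concat (map (\<lambda>\<xi>. map (\<lambda>j. real (due I \<xi> j)) [0..<n]) [0..<K])
        @ map (\<lambda>\<xi>. pmf (scen_pmf I) \<xi>) [0..<K]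
        @ concat (map (\<lambda>i. map (\<lambda>j. if (i, j) \<in> prec I then 1 else 0) [0..<n]) [0..<n]))"

definition init_store :: "real list \<Rightarrow> store" where
  "init_store xs = (\<lambda>_. 0, \<lambda>a. if a < length xs then xs ! a else 0)"

text \<open>The program has to leave an optimal schedule in the first memory cells.\<close>

definition solves_within ::
  "(sched_instance \<Rightarrow> nat list \<Rightarrow> real) \<Rightarrow> real list \<Rightarrow> ram \<Rightarrow> sched_instance \<Rightarrow> nat \<Rightarrow> real \<Rightarrow> bool"
where
  "solves_within obj par P I fmax B \<longleftrightarrow>
     (\<exists>t R M \<pi>. exec P (init_store (encode par I fmax)) t (R, M) \<and> real t \<le> B \<and>
        is_arg_min (obj I) (schedule I) \<pi> \<and> (\<forall>k<njobs I. M k = real (\<pi> ! k)))"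

text \<open>
  The costs range over the \<open>fmax + 1\<close> values \<open>0, \<dots>, fmax\<close>, and \<open>(fmax + 1) ^ K\<close> is
  \<open>O(fmax ^ K)\<close> only for \<open>fmax \<ge> 1\<close> and with a constant that depends on \<open>K\<close>.  (A constant
  independent of \<open>K\<close> would, for \<open>fmax = 1\<close>, give a polynomial algorithm for minimum feedback
  arc set: take one scenario per arc \<open>(i, j)\<close>, with \<open>ptime j = 1\<close>, \<open>due i = 0\<close>, all other
  processing times \<open>0\<close> and all other due dates \<open>1\<close>.)  Hence the bound \<open>T n K fmax\<close> is required of
  one program with a constant for each \<open>K\<close> and, in addition, with a single constant for all
  inputs once \<open>fmax\<close> is replaced by the number of cost values.
\<close>

definition solvable_in_O ::
  "(sched_instance \<Rightarrow> nat list \<Rightarrow> real) \<Rightarrow> real list \<Rightarrow> (nat \<Rightarrow> nat \<Rightarrow> nat \<Rightarrow> real) \<Rightarrow> bool"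
where
  "solvable_in_O obj par T \<longleftrightarrow>
     (\<exists>P.
        (\<forall>K. \<exists>c. \<forall>I fmax. valid_instance I \<and> nscens I = K \<and> cost_bound I fmax \<and> fmax \<ge> 1 \<longrightarrow>
           solves_within obj par P I fmax (c * T (njobs I) K fmax)) \<and>
        (\<exists>c. \<forall>I fmax. valid_instance I \<and> cost_bound I fmax \<longrightarrow>
           solves_within obj par P I fmax (c * T (njobs I) (nscens I) (fmax + 1))))"

end

theory Submission
  imports Defs
begin

text \<open>
  An optimal schedule is found by enumerating threshold vectors \<open>t \<in> {0..fmax}^K\<close>.  For a fixed
  \<open>t\<close>, Lawler's rule decides in \<open>O(K n\<^sup>2)\<close> steps whether some schedule has cost at most \<open>t i\<close> in
  every scenario \<open>i\<close>: fill the positions from the last to the first, each time with any job that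
  has no unscheduled successor and tolerates completion at the total processing time of the
  unscheduled jobs.  If no such job exists for the unscheduled set \<open>V\<close>, then in every schedule the
  job of \<open>V\<close> that comes last violates \<open>t\<close>.

  A vector must be evaluated in \<open>O(K)\<close> steps, so quantiles cannot be computed by sorting.  Instead
  the minimum of \<open>t\<close> takes the role of the quantile: raising every threshold below \<open>\<gamma>\<close> to \<open>\<gamma>\<close> only
  weakens the constraints, so \<open>(1 - \<alpha>) CVaR\<close> is the least value of \<open>\<Sum> q i * t i - \<alpha> * min t\<close>
  over the attainable \<open>t\<close> (the expectation is the case \<open>\<alpha> = 0\<close>), and VaR is the least \<open>min t\<close> over
  the attainable \<open>t\<close> that take their minimum with probability at least \<open>\<alpha>\<close>.
\<close>

section \<open>Time-bounded Hoare rules for the machine\<close>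

text \<open>The budget \<open>K * n^2\<close> per vector shapes the greedy program. Counting the
  successors of every candidate afresh would take order n^3 steps per vector, too many when
  \<open>K\<close> is small compared with \<open>n\<close>. So successor counts and scenario loads
  are kept up to date, at order \<open>n + K\<close> steps for each job that enters or leaves the
  unscheduled set. The vectors are the numerals with \<open>K\<close> digits in base
  \<open>fmax + 1\<close>; they are stored digit by digit, because the machine cannot divide, and
  advanced by a carry.

  The schedule found for \<open>t\<close> may have costs strictly below \<open>t\<close>, so the
  value of \<open>t\<close> need not be its objective. Two inequalities suffice for optimality: the
  value of \<open>t\<close> bounds the (scaled) objective of every schedule that meets
  \<open>t\<close>, and every schedule meets some enumerated vector whose value is at most its own
  objective. Hence it does not matter which of the schedules meeting \<open>t\<close> the greedy
  rule returns.

  The time bound is first proved for \<open>(fmax + 1) ^ K\<close> with one constant for all inputs;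
  \<open>fmax + 1 \<le> 2 * fmax\<close> then costs a factor \<open>2 ^ K\<close>, constant for
  fixed \<open>K\<close>.\<close>

text \<open>
  Expressions range over the registers below 30, the program variables; the registers from 30 on
  are the evaluation stack.
\<close>

datatype expr =
    ENum nat
  | EVar nat
  | EAdd expr expr
  | ESub expr expr
  | EMul expr expr
  | EMem expr

text \<open>Rounding the address only makes evaluation total; \<open>safe\<close> rules out the
  addresses on which the machine would get stuck.\<close>

primrec ev :: "expr \<Rightarrow> (nat \<Rightarrow> real) \<Rightarrow> (nat \<Rightarrow> real) \<Rightarrow> real" where
  "ev (ENum c) v M = real c"
| "ev (EVar x) v M = v x"
| "ev (EAdd a b) v M = ev a v M + ev b v M"
| "ev (ESub a b) v M = ev a v M - ev b v M"
| "ev (EMul a b) v M = ev a v M * ev b v M"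
| "ev (EMem a) v M = M (nat \<lfloor>ev a v M\<rfloor>)"

primrec safe :: "expr \<Rightarrow> (nat \<Rightarrow> real) \<Rightarrow> (nat \<Rightarrow> real) \<Rightarrow> bool" where
  "safe (ENum c) v M \<longleftrightarrow> True"
| "safe (EVar x) v M \<longleftrightarrow> x < 30"
| "safe (EAdd a b) v M \<longleftrightarrow> safe a v M \<and> safe b v M"
| "safe (ESub a b) v M \<longleftrightarrow> safe a v M \<and> safe b v M"
| "safe (EMul a b) v M \<longleftrightarrow> safe a v M \<and> safe b v M"
| "safe (EMem a) v M \<longleftrightarrow> safe a v M \<and> ev a v M \<in> \<nat>"

text \<open>The machine has no register copy, hence a variable is read by adding it to a
  zero.\<close>

primrec code :: "expr \<Rightarrow> nat \<Rightarrow> ram" where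
  "code (ENum c) d = Const d c"
| "code (EVar x) d = Seq (Const d 0) (Add d d x)"
| "code (EAdd a b) d = Seq (code a d) (Seq (code b (Suc d)) (Add d d (Suc d)))"
| "code (ESub a b) d = Seq (code a d) (Seq (code b (Suc d)) (Sub d d (Suc d)))"
| "code (EMul a b) d = Seq (code a d) (Seq (code b (Suc d)) (Mul d d (Suc d)))"
| "code (EMem a) d = Seq (code a d) (Load d d)"

primrec esteps :: "expr \<Rightarrow> nat" where
  "esteps (ENum c) = 1"
| "esteps (EVar x) = 2"
| "esteps (EAdd a b) = esteps a + esteps b + 1"
| "esteps (ESub a b) = esteps a + esteps b + 1"
| "esteps (EMul a b) = esteps a + esteps b + 1"
| "esteps (EMem a) = esteps a + 1"

definition frame :: "nat \<Rightarrow> (nat \<Rightarrow> real) \<Rightarrow> (nat \<Rightarrow> real) \<Rightarrow> bool" where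
  "frame d v v' \<longleftrightarrow> (\<forall>r<d. v' r = v r)"

lemma frame_refl [simp]: "frame d v v"
  by (simp add: frame_def)

lemma frame_trans: "frame d v v' \<Longrightarrow> frame d v' v'' \<Longrightarrow> frame d v v''"
  by (simp add: frame_def)

lemma frame_mono: "frame d v v' \<Longrightarrow> d' \<le> d \<Longrightarrow> frame d' v v'"
  by (simp add: frame_def)

lemma frame_upd [simp]: "d \<le> x \<Longrightarrow> frame d v (v'(x := c)) \<longleftrightarrow> frame d v v'"
  by (auto simp: frame_def)

lemma frameD: "frame d v v' \<Longrightarrow> r < d \<Longrightarrow> v' r = v r"
  by (simp add: frame_def)

text \<open>Code compiled at depth \<open>d\<close> may clobber every register from \<open>d\<close>
  on. The second operand is therefore compiled at \<open>Suc d\<close>, so that the first survives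
  in \<open>d\<close>; the program variables lie below \<open>30 \<le> d\<close> and still agree
  with \<open>v\<close> when the second operand is evaluated.\<close>

lemma exec_code:
  assumes "safe e v M" "30 \<le> d" "frame 30 v R"
  shows "\<exists>R'. exec (code e d) (R, M) (esteps e) (R', M) \<and> R' d = ev e v M \<and> frame d R R'"
  using assms
proof (induction e arbitrary: d R)
  case (ENum c)
  have "exec (code (ENum c) d) (R, M) (esteps (ENum c)) (R(d := real c), M)"
    unfolding code.simps esteps.simps by (rule exec.Const)
  moreover have "frame d R (R(d := real c))" by simp
  ultimately show ?case by (metis ev.simps(1) fun_upd_same)
next
  case (EVar x)
  have x: "x < d" "R x = v x" using EVar by (auto simp: frame_def)
  have "exec (code (EVar x) d) (R, M) (1 + 1)
          ((R(d := real 0))(d := (R(d := real 0)) d + (R(d := real 0)) x), M)"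
    unfolding code.simps by (rule exec.Seq[OF exec.Const exec.Add])
  thus ?case using x by (auto intro!: exI simp: numeral_2_eq_2 frame_def)
next
  case (EMem a)
  obtain R1 where R1: "exec (code a d) (R, M) (esteps a) (R1, M)" "R1 d = ev a v M" "frame d R R1"
    using EMem by auto
  have "R1 d = real (nat \<lfloor>ev a v M\<rfloor>)" using EMem.prems R1 by (auto elim: Nats_cases)
  from exec.Seq[OF R1(1) exec.Load[of R1 d, OF this, of d]]
  have "exec (code (EMem a) d) (R, M) (esteps (EMem a)) (R1(d := M (nat \<lfloor>ev a v M\<rfloor>)), M)" by simp
  moreover have "frame d R (R1(d := M (nat \<lfloor>ev a v M\<rfloor>)))" using R1(3) by simp
  ultimately show ?case by (metis ev.simps(6) fun_upd_same)
next
  case (EAdd a b)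
  obtain R1 where R1: "exec (code a d) (R, M) (esteps a) (R1, M)" "R1 d = ev a v M" "frame d R R1"
    using EAdd.IH(1)[of d R] EAdd.prems by auto
  have fr: "frame 30 v R1" using R1 EAdd.prems by (auto intro: frame_trans frame_mono)
  obtain R2 where R2: "exec (code b (Suc d)) (R1, M) (esteps b) (R2, M)"
     "R2 (Suc d) = ev b v M" "frame (Suc d) R1 R2"
    using EAdd.IH(2)[of "Suc d" R1] EAdd.prems fr by auto
  have "R2 d = ev a v M" using R1(2) R2(3) by (simp add: frame_def)
  moreover have "frame d R R2" using R1(3) R2(3) by (simp add: frame_def)
  ultimately have "frame d R (R2(d := R2 d + R2 (Suc d)))"
    "(R2(d := R2 d + R2 (Suc d))) d = ev (EAdd a b) v M" using R2(2) by simp_all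
  moreover have "exec (code (EAdd a b) d) (R, M) (esteps (EAdd a b)) (R2(d := R2 d + R2 (Suc d)), M)"
    using exec.Seq[OF R1(1) exec.Seq[OF R2(1) exec.Add[of d d "Suc d"]]] by simp
  ultimately show ?case by blast
next
  case (ESub a b)
  obtain R1 where R1: "exec (code a d) (R, M) (esteps a) (R1, M)" "R1 d = ev a v M" "frame d R R1"
    using ESub.IH(1)[of d R] ESub.prems by auto
  have fr: "frame 30 v R1" using R1 ESub.prems by (auto intro: frame_trans frame_mono)
  obtain R2 where R2: "exec (code b (Suc d)) (R1, M) (esteps b) (R2, M)"
     "R2 (Suc d) = ev b v M" "frame (Suc d) R1 R2"
    using ESub.IH(2)[of "Suc d" R1] ESub.prems fr by auto
  have "R2 d = ev a v M" using R1(2) R2(3) by (simp add: frame_def)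
  moreover have "frame d R R2" using R1(3) R2(3) by (simp add: frame_def)
  ultimately have "frame d R (R2(d := R2 d - R2 (Suc d)))"
    "(R2(d := R2 d - R2 (Suc d))) d = ev (ESub a b) v M" using R2(2) by simp_all
  moreover have "exec (code (ESub a b) d) (R, M) (esteps (ESub a b)) (R2(d := R2 d - R2 (Suc d)), M)"
    using exec.Seq[OF R1(1) exec.Seq[OF R2(1) exec.Sub[of d d "Suc d"]]] by simp
  ultimately show ?case by blast
next
  case (EMul a b)
  obtain R1 where R1: "exec (code a d) (R, M) (esteps a) (R1, M)" "R1 d = ev a v M" "frame d R R1"
    using EMul.IH(1)[of d R] EMul.prems by auto
  have fr: "frame 30 v R1" using R1 EMul.prems by (auto intro: frame_trans frame_mono)
  obtain R2 where R2: "exec (code b (Suc d)) (R1, M) (esteps b) (R2, M)"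
     "R2 (Suc d) = ev b v M" "frame (Suc d) R1 R2"
    using EMul.IH(2)[of "Suc d" R1] EMul.prems fr by auto
  have "R2 d = ev a v M" using R1(2) R2(3) by (simp add: frame_def)
  moreover have "frame d R R2" using R1(3) R2(3) by (simp add: frame_def)
  ultimately have "frame d R (R2(d := R2 d * R2 (Suc d)))"
    "(R2(d := R2 d * R2 (Suc d))) d = ev (EMul a b) v M" using R2(2) by simp_all
  moreover have "exec (code (EMul a b) d) (R, M) (esteps (EMul a b)) (R2(d := R2 d * R2 (Suc d)), M)"
    using exec.Seq[OF R1(1) exec.Seq[OF R2(1) exec.Mul[of d d "Suc d"]]] by simp
  ultimately show ?case by blast
qed

text \<open>
  The variable assignment \<open>v\<close> matters only on the registers below 30, so that postconditions need
  not mention the evaluation stack.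
\<close>

definition runs :: "ram \<Rightarrow> (nat \<Rightarrow> real) \<Rightarrow> (nat \<Rightarrow> real) \<Rightarrow> nat \<Rightarrow>
    ((nat \<Rightarrow> real) \<Rightarrow> (nat \<Rightarrow> real) \<Rightarrow> bool) \<Rightarrow> bool" where
  "runs P v M T Q \<longleftrightarrow> (\<forall>R. frame 30 v R \<longrightarrow>
     (\<exists>t R' M' v'. exec P (R, M) t (R', M') \<and> t \<le> T \<and> frame 30 v' R' \<and> Q v' M'))"

lemma runsE:
  assumes "runs P v M T Q" "frame 30 v R"
  obtains t R' M' v' where "exec P (R, M) t (R', M')" "t \<le> T" "frame 30 v' R'" "Q v' M'"
  using assms unfolding runs_def by blast

lemma runs_conseq:
  assumes "runs P v M T Q" "T \<le> T'" "\<And>v' M'. Q v' M' \<Longrightarrow> Q' v' M'"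
  shows "runs P v M T' Q'"
  unfolding runs_def
proof (intro allI impI)
  fix R assume "frame 30 v R"
  with assms(1) obtain t R' M' v' where "exec P (R, M) t (R', M')" "t \<le> T" "frame 30 v' R'" "Q v' M'"
    by (rule runsE)
  thus "\<exists>t R' M' v'. exec P (R, M) t (R', M') \<and> t \<le> T' \<and> frame 30 v' R' \<and> Q' v' M'"
    using assms(2,3) by (meson le_trans)
qed

lemma runs_Seq:
  assumes "runs P v M T Q'" "\<And>v' M'. Q' v' M' \<Longrightarrow> runs P' v' M' T' Q" "T + T' \<le> U"
  shows "runs (Seq P P') v M U Q"
  unfolding runs_def
proof (intro allI impI)
  fix R assume "frame 30 v R"
  with assms(1) obtain t R1 M1 v1 where
    1: "exec P (R, M) t (R1, M1)" "t \<le> T" "frame 30 v1 R1" "Q' v1 M1" by (rule runsE)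
  from assms(2)[OF 1(4)] 1(3) obtain t' R2 M2 v2 where
    2: "exec P' (R1, M1) t' (R2, M2)" "t' \<le> T'" "frame 30 v2 R2" "Q v2 M2" by (rule runsE)
  have "exec (Seq P P') (R, M) (t + t') (R2, M2)" using 1(1) 2(1) by (rule exec.Seq)
  moreover have "t + t' \<le> U" using 1(2) 2(2) assms(3) by linarith
  ultimately show "\<exists>t R' M' v'. exec (Seq P P') (R, M) t (R', M') \<and> t \<le> U \<and> frame 30 v' R' \<and> Q v' M'"
    using 2 by blast
qed

lemma runs_Skip: "1 \<le> T \<Longrightarrow> Q v M \<Longrightarrow> runs Skip v M T Q"
  unfolding runs_def by (meson exec.Skip)

text \<open>The value is complete in register 30 before \<open>x\<close> is cleared, so
  \<open>e\<close> may mention \<open>x\<close> itself.\<close>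

definition assign :: "nat \<Rightarrow> expr \<Rightarrow> ram" where
  "assign x e = Seq (code e 30) (Seq (Const x 0) (Add x x 30))"

lemma runs_assign:
  assumes "safe e v M" "x < 30" "esteps e + 2 \<le> T" "Q (v(x := ev e v M)) M"
  shows "runs (assign x e) v M T Q"
  unfolding runs_def
proof (intro allI impI)
  fix R assume fr: "frame 30 v R"
  obtain R1 where R1: "exec (code e 30) (R, M) (esteps e) (R1, M)" "R1 30 = ev e v M" "frame 30 R R1"
    using exec_code[OF assms(1) _ fr] by blast
  let ?R = "(R1(x := real 0))(x := (R1(x := real 0)) x + (R1(x := real 0)) 30)"
  have "exec (assign x e) (R, M) (esteps e + (1 + 1)) (?R, M)"
    unfolding assign_def by (rule exec.Seq[OF R1(1) exec.Seq[OF exec.Const exec.Add]])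
  moreover have "frame 30 (v(x := ev e v M)) ?R"
    using assms(2) R1 fr by (auto simp: frame_def)
  ultimately show "\<exists>t R' M' v'. exec (assign x e) (R, M) t (R', M') \<and> t \<le> T \<and> frame 30 v' R' \<and> Q v' M'"
    using assms(3,4) by (intro exI conjI) auto
qed

definition put :: "expr \<Rightarrow> expr \<Rightarrow> ram" where
  "put a e = Seq (Seq (code a 30) (code e 31)) (Store 30 31)"

lemma exec_code2:
  assumes "safe a v M" "safe e v M" "frame 30 v R"
  obtains R' where "exec (Seq (code a 30) (code e 31)) (R, M) (esteps a + esteps e) (R', M)"
    "R' 30 = ev a v M" "R' 31 = ev e v M" "frame 30 v R'"
proof -
  obtain R1 where R1: "exec (code a 30) (R, M) (esteps a) (R1, M)" "R1 30 = ev a v M" "frame 30 R R1"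
    using exec_code[OF assms(1) _ assms(3)] by blast
  have fr1: "frame 30 v R1" using R1 assms(3) by (auto intro: frame_trans)
  obtain R2 where R2: "exec (code e 31) (R1, M) (esteps e) (R2, M)" "R2 31 = ev e v M" "frame 31 R1 R2"
    using exec_code[OF assms(2) _ fr1, of 31] by auto
  have "R2 30 = R1 30" "frame 30 v R2" using R2(3) fr1 by (auto simp: frame_def)
  thus ?thesis using that exec.Seq[OF R1(1) R2(1)] R1(2) R2(2) by simp
qed

lemma runs_put:
  assumes "safe a v M" "safe e v M" "ev a v M \<in> \<nat>" "esteps a + esteps e + 1 \<le> T"
    "Q v (M(nat \<lfloor>ev a v M\<rfloor> := ev e v M))"
  shows "runs (put a e) v M T Q"
  unfolding runs_def
proof (intro allI impI)
  fix R assume fr: "frame 30 v R"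
  obtain R1 where R1: "exec (Seq (code a 30) (code e 31)) (R, M) (esteps a + esteps e) (R1, M)"
    "R1 30 = ev a v M" "R1 31 = ev e v M" "frame 30 v R1"
    using exec_code2[OF assms(1,2) fr] by blast
  have "R1 30 = real (nat \<lfloor>ev a v M\<rfloor>)" using assms(3) R1 by (auto elim: Nats_cases)
  note st = exec.Store[of R1 30, OF this, of 31 M]
  have "exec (put a e) (R, M) (esteps a + esteps e + 1) (R1, M(nat \<lfloor>ev a v M\<rfloor> := ev e v M))"
    using exec.Seq[OF R1(1) st] R1(3) unfolding put_def by simp
  thus "\<exists>t R' M' v'. exec (put a e) (R, M) t (R', M') \<and> t \<le> T \<and> frame 30 v' R' \<and> Q v' M'"
    using assms(4,5) R1(4) by blast
qed

definition ifle :: "expr \<Rightarrow> expr \<Rightarrow> ram \<Rightarrow> ram \<Rightarrow> ram" where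
  "ifle a b P P' = Seq (Seq (code a 30) (code b 31)) (IfLe 30 31 P P')"

lemma runs_ifle:
  assumes "safe a v M" "safe b v M"
    "ev a v M \<le> ev b v M \<Longrightarrow> runs P v M T Q" "\<not> ev a v M \<le> ev b v M \<Longrightarrow> runs P' v M T Q"
    "esteps a + esteps b + 1 + T \<le> U"
  shows "runs (ifle a b P P') v M U Q"
  unfolding runs_def
proof (intro allI impI)
  fix R assume fr: "frame 30 v R"
  obtain R1 where R1: "exec (Seq (code a 30) (code b 31)) (R, M) (esteps a + esteps b) (R1, M)"
    "R1 30 = ev a v M" "R1 31 = ev b v M" "frame 30 v R1"
    using exec_code2[OF assms(1,2) fr] by blast
  have "\<exists>t R' M' v'. exec (IfLe 30 31 P P') (R1, M) (Suc t) (R', M') \<and> t \<le> T \<and> frame 30 v' R' \<and> Q v' M'"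
  proof (cases "ev a v M \<le> ev b v M")
    case True
    from assms(3)[OF this] R1(4) obtain t R' M' v' where
      "exec P (R1, M) t (R', M')" "t \<le> T" "frame 30 v' R'" "Q v' M'" by (rule runsE)
    thus ?thesis using True R1 by (intro exI conjI exec.IfTrue) auto
  next
    case False
    from assms(4)[OF this] R1(4) obtain t R' M' v' where
      "exec P' (R1, M) t (R', M')" "t \<le> T" "frame 30 v' R'" "Q v' M'" by (rule runsE)
    thus ?thesis using False R1 by (intro exI conjI exec.IfFalse) auto
  qed
  then obtain t R' M' v' where *: "exec (IfLe 30 31 P P') (R1, M) (Suc t) (R', M')"
    "t \<le> T" "frame 30 v' R'" "Q v' M'" by blast
  have "exec (ifle a b P P') (R, M) (esteps a + esteps b + Suc t) (R', M')"
    unfolding ifle_def using R1(1) *(1) by (rule exec.Seq)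
  moreover have "esteps a + esteps b + Suc t \<le> U" using *(2) assms(5) by linarith
  ultimately show "\<exists>t R' M' v'. exec (ifle a b P P') (R, M) t (R', M') \<and> t \<le> U \<and> frame 30 v' R' \<and> Q v' M'"
    using * by blast
qed

text \<open>Only \<open>\<le>\<close> is available; on natural counters the strict test is
  \<open>x + 1 \<le> y\<close>. The two sides have to sit in registers when the loop compares them,
  so the test code runs before the loop and again at the end of each round.\<close>

definition loop_test :: "nat \<Rightarrow> nat \<Rightarrow> ram" where
  "loop_test x y = Seq (code (EAdd (EVar x) (ENum 1)) 30) (code (EVar y) 31)"

definition for_loop :: "nat \<Rightarrow> nat \<Rightarrow> ram \<Rightarrow> ram" where
  "for_loop x y P = Seq (assign x (ENum 0)) (Seq (loop_test x y)
     (WhileLe 30 31 (Seq P (Seq (assign x (EAdd (EVar x) (ENum 1))) (loop_test x y)))))"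

text \<open>
  Registers are allocated like a stack: the loop leaves everything below \<open>d\<close> untouched, and the
  registers from \<open>d\<close> up to the counter \<open>x\<close> hold its accumulators.
\<close>

lemma runs_for:
  assumes "v y = real N" "y < d" "d \<le> x" "x < 30"
    and J0: "J 0 v M"
    and Jx: "\<And>i v M c. J i v M \<Longrightarrow> J i (v(x := c)) M"
    and step: "\<And>i v' M'. i < N \<Longrightarrow> frame d v v' \<Longrightarrow> v' x = real i \<Longrightarrow> J i v' M' \<Longrightarrow>
      runs P v' M' T (\<lambda>v'' M''. v'' x = real i \<and> frame d v' v'' \<and> J (Suc i) v'' M'')"
    and fin: "\<And>v' M'. frame d v v' \<Longrightarrow> J N v' M' \<Longrightarrow> Q v' M'"
    and U: "N * (T + 13) + 10 \<le> U"
  shows "runs (for_loop x y P) v M U Q"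
proof -
  let ?W = "WhileLe 30 31 (Seq P (Seq (assign x (EAdd (EVar x) (ENum 1))) (loop_test x y)))"
  have test: "\<exists>R1. exec (loop_test x y) (R, M') 6 (R1, M') \<and> R1 30 = v' x + 1 \<and> R1 31 = v' y \<and> frame 30 v' R1"
    if "frame 30 v' R" for v' R M'
  proof -
    have s: "safe (EAdd (EVar x) (ENum 1)) v' M'" "safe (EVar y) v' M'" using assms by auto
    show ?thesis using exec_code2[OF s that] unfolding loop_test_def by (auto simp: numeral_eq_Suc)
  qed
  \<comment> \<open>A round costs one comparison, the body, 6 steps for the increment and 6 for the
    test code, which explains \<open>T + 13\<close>; the last summand is the failing comparison.
    With 3 steps to clear the counter and 6 for the first test, the overhead of the whole loop is
    10.\<close>
  have while: "\<exists>t R' M'' v''. exec ?W (R, M') t (R', M'') \<and> t \<le> (N - i) * (T + 13) + 1 \<and>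
      frame 30 v'' R' \<and> Q v'' M''"
    if "i \<le> N" "frame d v v'" "v' x = real i" "J i v' M'" "frame 30 v' R"
       "R 30 = v' x + 1" "R 31 = v' y" for i v' M' R
    using that
  proof (induction "N - i" arbitrary: i v' M' R)
    case 0
    hence i: "i = N" by simp
    have "v' y = real N" using 0 assms by (simp add: frame_def)
    hence "\<not> fst (R, M') 30 \<le> fst (R, M') 31" using 0 i by simp
    hence "exec ?W (R, M') 1 (R, M')" by (rule exec.WhileFalse)
    moreover have "Q v' M'" using fin 0 i by auto
    ultimately show ?case using 0 by (intro exI conjI) auto
  next
    case (Suc k)
    have iN: "i < N" using Suc by simp
    have vy: "v' y = real N" using Suc assms by (simp add: frame_def)
    have g: "fst (R, M') 30 \<le> fst (R, M') 31" using Suc.prems iN vy by simp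
    from step[OF iN Suc.prems(2-4)] Suc.prems(5) obtain t1 R1 M1 v1 where
      1: "exec P (R, M') t1 (R1, M1)" "t1 \<le> T" "frame 30 v1 R1"
         "v1 x = real i \<and> frame d v' v1 \<and> J (Suc i) v1 M1" by (rule runsE)
    have "runs (assign x (EAdd (EVar x) (ENum 1))) v1 M1 6 (\<lambda>v2 M2. v2 = v1(x := real (Suc i)) \<and> M2 = M1)"
      by (rule runs_assign) (use assms 1(4) Suc.prems in auto)
    from this 1(3) obtain t2 R2 M2 v2 where
      2: "exec (assign x (EAdd (EVar x) (ENum 1))) (R1, M1) t2 (R2, M2)" "t2 \<le> 6" "frame 30 v2 R2"
         "v2 = v1(x := real (Suc i)) \<and> M2 = M1" by (rule runsE)
    from test[OF 2(3)] obtain R3 where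
      3: "exec (loop_test x y) (R2, M2) 6 (R3, M2)" "R3 30 = v2 x + 1" "R3 31 = v2 y" "frame 30 v2 R3"
      by blast
    have fr: "frame d v v2" using 1(4) 2(4) Suc.prems assms by (auto intro: frame_trans)
    have "\<exists>t R' M'' v''. exec ?W (R3, M2) t (R', M'') \<and> t \<le> (N - Suc i) * (T + 13) + 1 \<and>
      frame 30 v'' R' \<and> Q v'' M''"
      using Suc.hyps(1)[of "Suc i" v2 M2 R3] Suc.hyps(2) iN fr 2(4) 1(4) Jx 3 by auto
    then obtain t4 R4 M4 v4 where
      4: "exec ?W (R3, M2) t4 (R4, M4)" "t4 \<le> (N - Suc i) * (T + 13) + 1" "frame 30 v4 R4" "Q v4 M4"
      by blast
    have "exec ?W (R, M') (Suc ((t1 + (t2 + 6)) + t4)) (R4, M4)"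
      using g 1(1) 2(1) 3(1) 4(1) by (intro exec.WhileTrue[OF g] exec.Seq)
    moreover have "Suc ((t1 + (t2 + 6)) + t4) \<le> (N - i) * (T + 13) + 1"
    proof -
      have "(N - i) * (T + 13) = (N - Suc i) * (T + 13) + (T + 13)"
        using iN by (metis Suc_diff_Suc mult_Suc add.commute)
      thus ?thesis using 1(2) 2(2) 4(2) by linarith
    qed
    ultimately show ?case using 4 by blast
  qed
  show ?thesis
    unfolding runs_def
  proof (intro allI impI)
    fix R assume fr: "frame 30 v R"
    have "runs (assign x (ENum 0)) v M 3 (\<lambda>v2 M2. v2 = v(x := 0) \<and> M2 = M)"
      by (rule runs_assign) (use assms in auto)
    from this fr obtain t2 R2 M2 v2 where
      2: "exec (assign x (ENum 0)) (R, M) t2 (R2, M2)" "t2 \<le> 3" "frame 30 v2 R2"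
         "v2 = v(x := 0) \<and> M2 = M" by (rule runsE)
    from test[OF 2(3)] obtain R3 where
      3: "exec (loop_test x y) (R2, M2) 6 (R3, M2)" "R3 30 = v2 x + 1" "R3 31 = v2 y" "frame 30 v2 R3"
      by blast
    have "\<exists>t R' M'' v''. exec ?W (R3, M2) t (R', M'') \<and> t \<le> (N - 0) * (T + 13) + 1 \<and>
      frame 30 v'' R' \<and> Q v'' M''"
      by (rule while[of 0 v2]) (use 2 3 assms Jx[OF J0] in auto)
    then obtain t4 R4 M4 v4 where
      4: "exec ?W (R3, M2) t4 (R4, M4)" "t4 \<le> N * (T + 13) + 1" "frame 30 v4 R4" "Q v4 M4"
      by auto
    have "exec (for_loop x y P) (R, M) (t2 + (6 + t4)) (R4, M4)"
      unfolding for_loop_def using 2(1) 3(1) 4(1) by (intro exec.Seq)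
    moreover have "t2 + (6 + t4) \<le> U" using 2(2) 4(2) U by linarith
    ultimately show "\<exists>t R' M' v'. exec (for_loop x y P) (R, M) t (R', M') \<and> t \<le> U \<and> frame 30 v' R' \<and> Q v' M'"
      using 4 by blast
  qed
qed

section \<open>Objectives as functions of threshold vectors\<close>

definition meets :: "sched_instance \<Rightarrow> (nat \<Rightarrow> nat) \<Rightarrow> nat list \<Rightarrow> bool" where
  "meets I t \<pi> \<longleftrightarrow> schedule I \<pi> \<and> (\<forall>i<nscens I. max_weighted_tardiness I \<pi> i \<le> int (t i))"

definition min_thr :: "sched_instance \<Rightarrow> (nat \<Rightarrow> nat) \<Rightarrow> nat" where
  "min_thr I t = Min (t ` {..<nscens I})"

text \<open>The value is scaled by \<open>1 - \<alpha>\<close> because the machine cannot divide.\<close>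

definition cvar_value :: "real \<Rightarrow> sched_instance \<Rightarrow> (nat \<Rightarrow> nat) \<Rightarrow> real" where
  "cvar_value \<alpha> I t = (\<Sum>i<nscens I. pmf (scen_pmf I) i * real (t i)) - \<alpha> * real (min_thr I t)"

text \<open>
  Vectors whose minimum is not an upper bound of the quantile get the trivial bound \<open>fmax\<close>.
\<close>

definition var_value :: "real \<Rightarrow> nat \<Rightarrow> sched_instance \<Rightarrow> (nat \<Rightarrow> nat) \<Rightarrow> real" where
  "var_value \<alpha> fmax I t =
     (if \<alpha> \<le> (\<Sum>i<nscens I. if t i \<le> min_thr I t then pmf (scen_pmf I) i else 0)
      then real (min_thr I t) else real fmax)"

locale bounded_instance =
  fixes I :: sched_instance and fmax :: nat
  assumes valid: "valid_instance I" and bound: "cost_bound I fmax"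
begin

abbreviation "n \<equiv> njobs I"
abbreviation "K \<equiv> nscens I"
abbreviation "q i \<equiv> pmf (scen_pmf I) i"

lemma n_pos: "1 \<le> n"
  using valid by (simp add: valid_instance_def)

lemma set_scen: "set_pmf (scen_pmf I) = {..<K}"
  using valid by (simp add: valid_instance_def)

text \<open>The support of a pmf is nonempty, so validity forces at least one scenario. This keeps
  \<open>min_thr\<close> from being the minimum of an empty set and lets \<open>K\<close> absorb
  additive constants in the running times.\<close>

lemma K_pos: "1 \<le> K"
  using set_pmf_not_empty[of "scen_pmf I"] by (cases K) (auto simp: set_scen)

lemma sum_q: "(\<Sum>i<K. q i) = 1"
  by (rule sum_pmf_eq_1) (auto simp: set_scen)

definition cost :: "nat list \<Rightarrow> nat \<Rightarrow> nat" where
  "cost \<pi> i = nat (max_weighted_tardiness I \<pi> i)"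

lemma tardiness_nonneg: "0 \<le> tardiness I \<pi> i j"
  by (simp add: tardiness_def)

lemma max_weighted_tardiness_nonneg: "0 \<le> max_weighted_tardiness I \<pi> i"
proof -
  have "0 \<le> int (weight I 0) * tardiness I \<pi> i 0" by (simp add: tardiness_nonneg)
  also have "\<dots> \<le> max_weighted_tardiness I \<pi> i"
    unfolding max_weighted_tardiness_def using n_pos by (intro Max_ge) auto
  finally show ?thesis .
qed

lemma of_int_cost: "real_of_int (max_weighted_tardiness I \<pi> i) = real (cost \<pi> i)"
  using max_weighted_tardiness_nonneg by (simp add: cost_def)

lemma meets_iff: "meets I t \<pi> \<longleftrightarrow> schedule I \<pi> \<and> (\<forall>i<K. cost \<pi> i \<le> t i)"
  using max_weighted_tardiness_nonneg by (auto simp: meets_def cost_def nat_le_iff)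

lemma cost_le: "schedule I \<pi> \<Longrightarrow> i < K \<Longrightarrow> cost \<pi> i \<le> fmax"
  using bound by (auto simp: cost_bound_def cost_def nat_le_iff)

lemma expectation_cost:
  "measure_pmf.expectation (cost_pmf I \<pi>) g = (\<Sum>i<K. q i * g (real (cost \<pi> i)))"
proof -
  have "measure_pmf.expectation (cost_pmf I \<pi>) g =
      measure_pmf.expectation (scen_pmf I) (\<lambda>i. g (real (cost \<pi> i)))"
    by (simp add: cost_pmf_def of_int_cost)
  also have "\<dots> = (\<Sum>i<K. g (real (cost \<pi> i)) * q i)"
    by (rule integral_measure_pmf_real) (auto simp: set_scen)
  finally show ?thesis by (simp add: mult.commute)
qed

lemma prob_cost:
  "measure_pmf.prob (cost_pmf I \<pi>) {..x} = (\<Sum>i<K. if real (cost \<pi> i) \<le> x then q i else 0)"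
proof -
  have "measure_pmf.prob (cost_pmf I \<pi>) {..x} = measure_pmf.expectation (cost_pmf I \<pi>) (indicator {..x})"
    by simp
  also have "\<dots> = (\<Sum>i<K. q i * indicator {..x} (real (cost \<pi> i)))" by (rule expectation_cost)
  also have "\<dots> = (\<Sum>i<K. if real (cost \<pi> i) \<le> x then q i else 0)"
    by (intro sum.cong) (auto simp: indicator_def)
  finally show ?thesis .
qed

lemma min_thr_le: "i < K \<Longrightarrow> min_thr I t \<le> t i"
  by (auto simp: min_thr_def)

lemma min_thr_ge: "(\<And>i. i < K \<Longrightarrow> m \<le> t i) \<Longrightarrow> m \<le> min_thr I t"
  unfolding min_thr_def using K_pos by (subst Min_ge_iff) (auto simp: lessThan_empty_iff)

lemma min_thr_cong: "(\<And>i. i < K \<Longrightarrow> t i = t' i) \<Longrightarrow> min_thr I t = min_thr I t'"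
  unfolding min_thr_def by (metis (no_types, lifting) image_cong lessThan_iff)

lemma cvar_value_cong: "(\<And>i. i < K \<Longrightarrow> t i = t' i) \<Longrightarrow> cvar_value \<alpha> I t = cvar_value \<alpha> I t'"
  unfolding cvar_value_def using min_thr_cong[of t t'] by simp

lemma var_value_cong: "(\<And>i. i < K \<Longrightarrow> t i = t' i) \<Longrightarrow> var_value \<alpha> fmax I t = var_value \<alpha> fmax I t'"
  unfolding var_value_def using min_thr_cong[of t t'] by simp

lemma sum_q_le: "(\<And>i. i < K \<Longrightarrow> g i \<le> (c::real)) \<Longrightarrow> (\<Sum>i<K. q i * g i) \<le> c"
proof -
  assume "\<And>i. i < K \<Longrightarrow> g i \<le> c"
  hence "(\<Sum>i<K. q i * g i) \<le> (\<Sum>i<K. q i * c)" by (intro sum_mono mult_left_mono) auto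
  also have "\<dots> = c" by (simp add: sum_distrib_right[symmetric] sum_q)
  finally show ?thesis .
qed

lemma sum_q_add: "(\<Sum>i<K. q i * (g i + c)) = (\<Sum>i<K. q i * g i) + (c::real)"
  by (simp add: distrib_left sum.distrib sum_distrib_right[symmetric] sum_q)

lemma cvar_value_le:
  assumes "\<And>i. i < K \<Longrightarrow> t i \<le> fmax" "0 \<le> \<alpha>"
  shows "cvar_value \<alpha> I t \<le> real fmax"
proof -
  have "(\<Sum>i<K. q i * real (t i)) \<le> real fmax" using assms by (intro sum_q_le) auto
  moreover have "0 \<le> \<alpha> * real (min_thr I t)" using assms by simp
  ultimately show ?thesis unfolding cvar_value_def by linarith
qed

lemma var_value_le:
  assumes "\<And>i. i < K \<Longrightarrow> t i \<le> fmax"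
  shows "var_value \<alpha> fmax I t \<le> real fmax"
proof -
  have "min_thr I t \<le> fmax" using min_thr_le[of 0 t] assms[of 0] K_pos by auto
  thus ?thesis by (simp add: var_value_def)
qed

lemma Exp_le_value:
  assumes "meets I t \<pi>"
  shows "Exp_cost I \<pi> \<le> cvar_value 0 I t"
  using assms unfolding Exp_cost_def expectation_cost cvar_value_def meets_iff
  by (auto intro!: sum_mono mult_left_mono)

lemma value_le_Exp:
  assumes "schedule I \<pi>"
  shows "\<exists>t. (\<forall>i<K. t i \<le> fmax) \<and> meets I t \<pi> \<and> cvar_value 0 I t \<le> Exp_cost I \<pi>"
  using assms cost_le unfolding Exp_cost_def expectation_cost cvar_value_def meets_iff
  by (intro exI[of _ "cost \<pi>"]) auto

section \<open>Conditional value-at-risk by the Rockafellar-Uryasev function, scaled by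
  \<open>1 - \<alpha>\<close>\<close>

definition rockafellar :: "real \<Rightarrow> nat list \<Rightarrow> real \<Rightarrow> real" where
  "rockafellar \<alpha> \<pi> \<gamma> = (1 - \<alpha>) * \<gamma> + (\<Sum>i<K. q i * max 0 (real (cost \<pi> i) - \<gamma>))"

lemma CVaR_cost_eq:
  assumes "\<alpha> < 1"
  shows "CVaR_cost \<alpha> I \<pi> = (INF \<gamma>. rockafellar \<alpha> \<pi> \<gamma> / (1 - \<alpha>))"
  using assms unfolding CVaR_cost_def expectation_cost rockafellar_def
  by (simp add: add_divide_distrib)

text \<open>As the probabilities sum to 1, \<open>\<gamma>\<close> can be moved under the
  expectation, where the positive part of \<open>cost - \<gamma>\<close> plus
  \<open>\<gamma>\<close> is \<open>max cost \<gamma>\<close>. In this form the function looks like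
  \<open>cvar_value\<close> of the costs raised to \<open>\<gamma>\<close>.\<close>

lemma rockafellar_eq: "rockafellar \<alpha> \<pi> \<gamma> = (\<Sum>i<K. q i * max (real (cost \<pi> i)) \<gamma>) - \<alpha> * \<gamma>"
proof -
  have "(\<Sum>i<K. q i * max (real (cost \<pi> i)) \<gamma>) = (\<Sum>i<K. q i * (max 0 (real (cost \<pi> i) - \<gamma>) + \<gamma>))"
    by (intro sum.cong refl arg_cong2[of _ _ _ _ "(*)"]) (auto simp: max_def)
  thus ?thesis unfolding sum_q_add rockafellar_def by (simp add: algebra_simps)
qed

lemma value_le_rockafellar_nat:
  assumes "schedule I \<pi>" "0 \<le> \<alpha>" "m \<le> fmax"
  shows "\<exists>t. (\<forall>i<K. t i \<le> fmax) \<and> meets I t \<pi> \<and> cvar_value \<alpha> I t \<le> rockafellar \<alpha> \<pi> (real m)"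
proof (intro exI conjI)
  let ?t = "\<lambda>i. max (cost \<pi> i) m"
  show "\<forall>i<K. ?t i \<le> fmax" using assms cost_le by auto
  show "meets I ?t \<pi>" using assms by (simp add: meets_iff)
  \<comment> \<open>The minimum exceeds \<open>m\<close> if all costs do; because of
    \<open>0 \<le> \<alpha>\<close> this only lowers the value.\<close>
  have "m \<le> min_thr I ?t" by (rule min_thr_ge) auto
  hence "\<alpha> * real m \<le> \<alpha> * real (min_thr I ?t)" using assms by (intro mult_left_mono) auto
  thus "cvar_value \<alpha> I ?t \<le> rockafellar \<alpha> \<pi> (real m)"
    unfolding cvar_value_def rockafellar_eq by (simp add: of_nat_max)
qed

text \<open>Costs are integers, so the function is affine between consecutive integers.\<close>

lemma rockafellar_interpolate:
  assumes "0 \<le> \<theta>" "\<theta> \<le> 1"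
  shows "rockafellar \<alpha> \<pi> (real m + \<theta>) =
    (1 - \<theta>) * rockafellar \<alpha> \<pi> (real m) + \<theta> * rockafellar \<alpha> \<pi> (real (Suc m))"
proof -
  have *: "max 0 (real c - (real m + \<theta>)) =
      (1 - \<theta>) * max 0 (real c - real m) + \<theta> * max 0 (real c - real (Suc m))" for c
  proof (cases "c \<le> m")
    case True
    thus ?thesis using assms by simp
  next
    case False
    hence "real c \<ge> real m + 1" by linarith
    thus ?thesis using assms by (simp add: max_def algebra_simps)
  qed
  show ?thesis unfolding rockafellar_def *
    by (simp add: algebra_simps sum.distrib sum_distrib_left sum_subtractf)
qed

text \<open>Thresholds are natural numbers, so \<open>\<gamma>\<close> has to be replaced by an
  integer from 0 to \<open>fmax\<close> at which the function is no larger. Left of 0 its slope is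
  \<open>-\<alpha>\<close>, right of \<open>fmax\<close> it is \<open>1 - \<alpha>\<close>, and in
  between an affine piece lies above the smaller of its two end values.\<close>

lemma value_le_rockafellar:
  assumes "schedule I \<pi>" "0 \<le> \<alpha>" "\<alpha> < 1"
  shows "\<exists>t. (\<forall>i<K. t i \<le> fmax) \<and> meets I t \<pi> \<and> cvar_value \<alpha> I t \<le> rockafellar \<alpha> \<pi> \<gamma>"
proof -
  note nat = value_le_rockafellar_nat[OF assms(1,2)]
  consider "\<gamma> < 0" | "\<gamma> \<ge> real fmax" | "0 \<le> \<gamma>" "\<gamma> < real fmax" by linarith
  thus ?thesis
  proof cases
    case 1
    have "rockafellar \<alpha> \<pi> (real 0) \<le> rockafellar \<alpha> \<pi> \<gamma>"
    proof -
      have "(\<Sum>i<K. q i * max (real (cost \<pi> i)) (real 0)) = (\<Sum>i<K. q i * max (real (cost \<pi> i)) \<gamma>)"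
        using 1 by (intro sum.cong refl) (auto simp: max_def)
      moreover have "\<alpha> * \<gamma> \<le> 0" using 1 assms by (simp add: mult_nonneg_nonpos)
      ultimately show ?thesis unfolding rockafellar_eq by simp
    qed
    thus ?thesis using nat[of 0] by (meson le0 order_trans)
  next
    case 2
    have "rockafellar \<alpha> \<pi> x = (1 - \<alpha>) * x" if "x \<ge> real fmax" for x
    proof -
      have "(\<Sum>i<K. q i * max 0 (real (cost \<pi> i) - x)) = (\<Sum>i<K. 0)"
        using that cost_le[OF assms(1)] by (intro sum.cong refl) (force simp: max_def)
      thus ?thesis by (simp add: rockafellar_def)
    qed
    hence "rockafellar \<alpha> \<pi> (real fmax) \<le> rockafellar \<alpha> \<pi> \<gamma>"
      using 2 assms by (simp add: mult_left_mono)
    thus ?thesis using nat[of fmax] by (meson order_refl order_trans)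
  next
    case 3
    define m where "m = nat \<lfloor>\<gamma>\<rfloor>"
    define \<theta> where "\<theta> = \<gamma> - real m"
    have m: "real m \<le> \<gamma>" "\<gamma> < real m + 1" using 3 by (auto simp: m_def of_nat_nat)
    hence \<theta>: "0 \<le> \<theta>" "\<theta> \<le> 1" "\<gamma> = real m + \<theta>" by (auto simp: \<theta>_def)
    have mf: "Suc m \<le> fmax" using m 3 by linarith
    let ?a = "rockafellar \<alpha> \<pi> (real m)" and ?b = "rockafellar \<alpha> \<pi> (real (Suc m))"
    have eq: "rockafellar \<alpha> \<pi> \<gamma> = (1 - \<theta>) * ?a + \<theta> * ?b"
      unfolding \<theta>(3) by (rule rockafellar_interpolate[OF \<theta>(1,2)])
    have "min ?a ?b = (1 - \<theta>) * min ?a ?b + \<theta> * min ?a ?b" by (simp add: algebra_simps)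
    also have "\<dots> \<le> (1 - \<theta>) * ?a + \<theta> * ?b"
      using \<theta> by (intro add_mono mult_left_mono) auto
    finally have "?a \<le> rockafellar \<alpha> \<pi> \<gamma> \<or> ?b \<le> rockafellar \<alpha> \<pi> \<gamma>" unfolding eq by linarith
    thus ?thesis using nat[of m] nat[of "Suc m"] mf by (meson Suc_leD order_trans)
  qed
qed

text \<open>Vectors are functions on all natural numbers and are bounded only below
  \<open>K\<close>, so there are infinitely many of them; the value depends on the first
  \<open>K\<close> entries alone.\<close>

lemma finite_values: "finite {x. \<exists>t. (\<forall>i<K. t i \<le> fmax) \<and> P t \<and> x = cvar_value \<alpha> I t}"
proof (rule finite_subset)
  let ?B = "PiE_dflt {..<K} 0 (\<lambda>_. {..fmax})"
  show "finite (cvar_value \<alpha> I ` ?B)" by (intro finite_imageI finite_PiE_dflt) auto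
  show "{x. \<exists>t. (\<forall>i<K. t i \<le> fmax) \<and> P t \<and> x = cvar_value \<alpha> I t} \<subseteq> cvar_value \<alpha> I ` ?B"
  proof safe
    fix t :: "nat \<Rightarrow> nat" assume t: "\<forall>i<K. t i \<le> fmax"
    show "cvar_value \<alpha> I t \<in> cvar_value \<alpha> I ` ?B"
    proof (rule image_eqI)
      show "cvar_value \<alpha> I t = cvar_value \<alpha> I (\<lambda>i. if i < K then t i else 0)"
        by (rule cvar_value_cong) simp
      show "(\<lambda>i. if i < K then t i else 0) \<in> ?B" using t by (auto simp: PiE_dflt_def)
    qed
  qed
qed

text \<open>The vector obtained from \<open>value_le_rockafellar\<close> varies with
  \<open>\<gamma>\<close>, while the claim asks for one vector below the infimum over all
  \<open>\<gamma>\<close>. The least of the finitely many values is such a bound and is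
  attained.\<close>

lemma value_le_CVaR:
  assumes "schedule I \<pi>" "0 \<le> \<alpha>" "\<alpha> < 1"
  shows "\<exists>t. (\<forall>i<K. t i \<le> fmax) \<and> meets I t \<pi> \<and> cvar_value \<alpha> I t \<le> (1 - \<alpha>) * CVaR_cost \<alpha> I \<pi>"
proof -
  let ?V = "{x. \<exists>t. (\<forall>i<K. t i \<le> fmax) \<and> meets I t \<pi> \<and> x = cvar_value \<alpha> I t}"
  note ex = value_le_rockafellar[OF assms]
  have fin: "finite ?V" by (rule finite_values)
  have ne: "?V \<noteq> {}" using ex by auto
  have "Min ?V / (1 - \<alpha>) \<le> CVaR_cost \<alpha> I \<pi>"
    unfolding CVaR_cost_eq[OF assms(3)]
  proof (rule cINF_greatest)
    fix \<gamma> :: real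
    obtain t where t: "\<forall>i<K. t i \<le> fmax" "meets I t \<pi>" "cvar_value \<alpha> I t \<le> rockafellar \<alpha> \<pi> \<gamma>"
      using ex by blast
    hence "Min ?V \<le> cvar_value \<alpha> I t" by (intro Min_le fin) auto
    thus "Min ?V / (1 - \<alpha>) \<le> rockafellar \<alpha> \<pi> \<gamma> / (1 - \<alpha>)"
      using t assms by (intro divide_right_mono) auto
  qed simp
  hence "Min ?V \<le> (1 - \<alpha>) * CVaR_cost \<alpha> I \<pi>" using assms by (simp add: field_simps)
  thus ?thesis using Min_in[OF fin ne] by auto
qed

text \<open>Choose \<open>\<gamma>\<close> as the minimum of \<open>t\<close>: both this minimum and
  the cost are at most \<open>t i\<close>, hence so is their maximum.\<close>

lemma CVaR_le_value:
  assumes "meets I t \<pi>" "0 \<le> \<alpha>" "\<alpha> < 1"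
  shows "(1 - \<alpha>) * CVaR_cost \<alpha> I \<pi> \<le> cvar_value \<alpha> I t"
proof -
  let ?m = "real (min_thr I t)"
  have sch: "schedule I \<pi>" using assms by (simp add: meets_iff)
  \<comment> \<open>The infimum is below each member only for a set bounded below. For
    \<open>\<gamma> \<ge> 0\<close> the defining form is a sum of nonnegative terms; for
    \<open>\<gamma> < 0\<close> the form with \<open>max\<close> is.\<close>
  have "bdd_below (range (\<lambda>\<gamma>. rockafellar \<alpha> \<pi> \<gamma> / (1 - \<alpha>)))"
  proof (rule bdd_belowI2)
    fix \<gamma> :: real
    have "0 \<le> rockafellar \<alpha> \<pi> \<gamma>"
    proof (cases "\<gamma> \<ge> 0")
      case True
      thus ?thesis using assms by (auto simp: rockafellar_def intro!: add_nonneg_nonneg sum_nonneg)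
    next
      case False
      hence "\<alpha> * \<gamma> \<le> 0" using assms by (simp add: mult_nonneg_nonpos)
      moreover have "0 \<le> (\<Sum>i<K. q i * max (real (cost \<pi> i)) \<gamma>)" by (intro sum_nonneg) auto
      ultimately show ?thesis by (simp add: rockafellar_eq)
    qed
    thus "0 \<le> rockafellar \<alpha> \<pi> \<gamma> / (1 - \<alpha>)" using assms by simp
  qed
  hence "CVaR_cost \<alpha> I \<pi> \<le> rockafellar \<alpha> \<pi> ?m / (1 - \<alpha>)"
    unfolding CVaR_cost_eq[OF assms(3)] by (rule cINF_lower) simp
  hence "(1 - \<alpha>) * CVaR_cost \<alpha> I \<pi> \<le> rockafellar \<alpha> \<pi> ?m" using assms by (simp add: field_simps)
  also have "\<dots> \<le> cvar_value \<alpha> I t"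
    unfolding rockafellar_eq cvar_value_def
    using assms min_thr_le by (intro diff_right_mono sum_mono mult_left_mono) (auto simp: meets_iff)
  finally show ?thesis .
qed

section \<open>Value-at-risk\<close>

lemma VaR_set_ge:
  assumes "0 < \<alpha>" "\<alpha> \<le> measure_pmf.prob (cost_pmf I \<pi>) {..x}"
  obtains i where "i < K" "real (cost \<pi> i) \<le> x"
proof -
  have "\<exists>i<K. real (cost \<pi> i) \<le> x"
  proof (rule ccontr)
    assume "\<not> ?thesis"
    hence "(\<Sum>i<K. if real (cost \<pi> i) \<le> x then q i else 0) = (\<Sum>i<K. 0)" by (intro sum.cong refl) auto
    thus False using assms by (simp add: prob_cost)
  qed
  thus ?thesis using that by blast
qed

text \<open>Because of \<open>0 < \<alpha>\<close>, a level that is reached with probability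
  \<open>\<alpha>\<close> is at least one of the costs and so nonnegative. This bounds the set of
  levels from below, and its infimum is below each member.\<close>

lemma VaR_le:
  assumes "0 < \<alpha>" "\<alpha> \<le> measure_pmf.prob (cost_pmf I \<pi>) {..x}"
  shows "VaR_cost \<alpha> I \<pi> \<le> x"
  unfolding VaR_cost_def
proof (rule cInf_lower)
  show "bdd_below {t. \<alpha> \<le> measure_pmf.prob (cost_pmf I \<pi>) {..t}}"
  proof (rule bdd_belowI[of _ 0])
    fix t assume "t \<in> {t. \<alpha> \<le> measure_pmf.prob (cost_pmf I \<pi>) {..t}}"
    then obtain i where "i < K" "real (cost \<pi> i) \<le> t" using assms VaR_set_ge by blast
    thus "0 \<le> t" by (meson of_nat_0_le_iff order_trans)
  qed
qed (use assms in simp)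

lemma prob_fmax:
  assumes "schedule I \<pi>"
  shows "measure_pmf.prob (cost_pmf I \<pi>) {..real fmax} = 1"
proof -
  have "(\<Sum>i<K. if real (cost \<pi> i) \<le> real fmax then q i else 0) = (\<Sum>i<K. q i)"
    using cost_le[OF assms] by (intro sum.cong refl) auto
  thus ?thesis by (simp add: prob_cost sum_q)
qed

text \<open>Costs do not exceed thresholds, so wherever \<open>t\<close> takes its minimum the cost
  is at most that minimum. If this has too little probability, the value is \<open>fmax\<close>,
  which no cost exceeds.\<close>

lemma VaR_le_value:
  assumes "meets I t \<pi>" "0 < \<alpha>" "\<alpha> \<le> 1"
  shows "VaR_cost \<alpha> I \<pi> \<le> var_value \<alpha> fmax I t"
proof (cases "\<alpha> \<le> (\<Sum>i<K. if t i \<le> min_thr I t then q i else 0)")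
  case True
  have "(\<Sum>i<K. if t i \<le> min_thr I t then q i else 0) \<le>
      (\<Sum>i<K. if real (cost \<pi> i) \<le> real (min_thr I t) then q i else 0)"
    using assms by (intro sum_mono) (force simp: meets_iff)
  hence "VaR_cost \<alpha> I \<pi> \<le> real (min_thr I t)"
    using True assms by (intro VaR_le) (auto simp: prob_cost)
  thus ?thesis using True by (simp add: var_value_def)
next
  case False
  have "VaR_cost \<alpha> I \<pi> \<le> real fmax" using assms by (intro VaR_le) (auto simp: meets_iff prob_fmax)
  thus ?thesis using False by (simp add: var_value_def)
qed

text \<open>The levels are real but the costs are natural numbers: rounding a level down changes no
  comparison with a cost. So the quantile is the least natural number \<open>m\<close> that is
  reached with probability \<open>\<alpha>\<close>.\<close>

lemma value_le_VaR:
  assumes "schedule I \<pi>" "0 < \<alpha>" "\<alpha> \<le> 1"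
  shows "\<exists>t. (\<forall>i<K. t i \<le> fmax) \<and> meets I t \<pi> \<and> var_value \<alpha> fmax I t \<le> VaR_cost \<alpha> I \<pi>"
proof -
  let ?P = "\<lambda>m. \<alpha> \<le> measure_pmf.prob (cost_pmf I \<pi>) {..real m}"
  define m where "m = (LEAST m. ?P m)"
  have P_fmax: "?P fmax" using prob_fmax[OF assms(1)] assms by simp
  have Pm: "?P m" unfolding m_def using P_fmax by (rule LeastI)
  have m_le: "m \<le> fmax" unfolding m_def using P_fmax by (rule Least_le)
  \<comment> \<open>Thresholds are \<open>m\<close> where the cost is at most \<open>m\<close> and
    as loose as possible elsewhere. Such a scenario exists, so the minimum is \<open>m\<close>, and
    it is taken with at least the probability of a cost up to \<open>m\<close>.\<close>
  let ?t = "\<lambda>i. if cost \<pi> i \<le> m then m else fmax"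
  obtain i where i: "i < K" "cost \<pi> i \<le> m" using VaR_set_ge[OF assms(2) Pm] by auto
  have min: "min_thr I ?t = m"
    using min_thr_le[OF i(1), of ?t] min_thr_ge[of m ?t] i m_le by force
  have le: "(\<Sum>i<K. if real (cost \<pi> i) \<le> real m then q i else 0) \<le>
      (\<Sum>i<K. if ?t i \<le> min_thr I ?t then q i else 0)"
    unfolding min by (intro sum_mono) auto
  have val: "var_value \<alpha> fmax I ?t = real m"
    using Pm le min unfolding var_value_def prob_cost by simp
  have "real m \<le> VaR_cost \<alpha> I \<pi>"
    unfolding VaR_cost_def
  proof (rule cInf_greatest)
    show "{t. \<alpha> \<le> measure_pmf.prob (cost_pmf I \<pi>) {..t}} \<noteq> {}" using Pm by blast
    fix x assume "x \<in> {t. \<alpha> \<le> measure_pmf.prob (cost_pmf I \<pi>) {..t}}"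
    hence x: "\<alpha> \<le> measure_pmf.prob (cost_pmf I \<pi>) {..x}" by simp
    then obtain i where "real (cost \<pi> i) \<le> x" using VaR_set_ge[OF assms(2)] by blast
    hence x0: "0 \<le> x" by (meson of_nat_0_le_iff order_trans)
    have "(real c \<le> x) = (real c \<le> real (nat \<lfloor>x\<rfloor>))" for c
      using x0 by (metis floor_of_nat le_floor_iff nat_le_eq_zle of_int_of_nat_eq of_nat_le_iff zero_le_floor nat_int)
    hence "?P (nat \<lfloor>x\<rfloor>)" using x unfolding prob_cost by simp
    hence "m \<le> nat \<lfloor>x\<rfloor>" unfolding m_def by (rule Least_le)
    thus "real m \<le> x" using x0 by linarith
  qed
  thus ?thesis using val assms m_le cost_le by (intro exI[of _ ?t]) (auto simp: meets_iff)
qed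

end

section \<open>Lawler's rule\<close>

context bounded_instance begin

definition load :: "nat set \<Rightarrow> nat \<Rightarrow> nat" where
  "load V i = (\<Sum>j\<in>V. ptime I i j)"

text \<open>The second condition is \<open>weight * (load - due) \<le> t\<close> without subtraction
  on natural numbers. The maximum with 0 in the tardiness disappears because thresholds are
  nonnegative.\<close>

definition admissible :: "(nat \<Rightarrow> nat) \<Rightarrow> nat set \<Rightarrow> nat \<Rightarrow> bool" where
  "admissible t V x \<longleftrightarrow> (\<forall>s\<in>V. (x, s) \<notin> prec I) \<and>
     (\<forall>i<K. weight I x * load V i \<le> t i + weight I x * due I i x)"

lemma completion_nth:
  assumes "distinct \<pi>" "p < length \<pi>"
  shows "completion I \<pi> i (\<pi> ! p) = load (set (take (Suc p) \<pi>)) i"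
proof -
  have "takeWhile (\<lambda>x. x \<noteq> \<pi> ! p) \<pi> = take p \<pi>"
    using assms by (intro takeWhile_eq_take_P_nth) (auto simp: nth_eq_iff_index_eq)
  hence "completion I \<pi> i (\<pi> ! p) = sum_list (map (ptime I i) (take (Suc p) \<pi>))"
    using assms by (simp add: completion_def take_Suc_conv_app_nth)
  also have "\<dots> = load (set (take (Suc p) \<pi>)) i"
    unfolding load_def using assms by (intro sum_list_distinct_conv_sum_set) auto
  finally show ?thesis .
qed

lemma schedule_nth:
  assumes "schedule I \<pi>"
  shows "distinct \<pi>" "set \<pi> = {..<n}" "length \<pi> = n"
    "\<And>a b. a < n \<Longrightarrow> b < n \<Longrightarrow> (\<pi> ! a, \<pi> ! b) \<in> prec I \<Longrightarrow> a < b"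
  using assms unfolding schedule_def permutations_of_set_def
  by (auto dest: distinct_card)

lemma weighted_tardiness_le:
  "x < n \<Longrightarrow> int (weight I x) * tardiness I \<pi> i x \<le> max_weighted_tardiness I \<pi> i"
  unfolding max_weighted_tardiness_def by (intro Max_ge) auto

text \<open>Jobs outside \<open>V\<close> may be scheduled before the last job of \<open>V\<close>;
  they only delay it, so it completes no earlier than \<open>load V i\<close>. As \<open>V\<close>
  is arbitrary, a failed greedy step refutes all schedules at once, whatever tail has been chosen,
  and no exchange argument is required.\<close>

lemma not_meets_if_none_admissible:
  assumes V: "V \<subseteq> {..<n}" "V \<noteq> {}" and none: "\<And>x. x \<in> V \<Longrightarrow> \<not> admissible t V x"
  shows "\<not> meets I t \<pi>"
proof
  assume m: "meets I t \<pi>"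
  hence "schedule I \<pi>" by (simp add: meets_def)
  note \<pi> = schedule_nth[OF this]
  define p where "p = Max {p. p < n \<and> \<pi> ! p \<in> V}"
  have ne: "{p. p < n \<and> \<pi> ! p \<in> V} \<noteq> {}"
    using V \<pi>(2,3) by (auto simp: in_set_conv_nth subset_iff) (metis in_set_conv_nth lessThan_iff)
  have p: "p < n" "\<pi> ! p \<in> V"
    using Max_in[OF _ ne] by (auto simp: p_def)
  have last: "p' \<le> p" if "p' < n" "\<pi> ! p' \<in> V" for p'
    unfolding p_def using that by (intro Max_ge) auto
  have pos: "\<exists>p'\<le>p. s = \<pi> ! p'" if "s \<in> V" for s
  proof -
    have "s \<in> set \<pi>" using that V(1) \<pi>(2) by auto
    then obtain p' where "p' < n" "s = \<pi> ! p'" using \<pi>(3) by (auto simp: in_set_conv_nth)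
    thus ?thesis using last that by auto
  qed
  have nosucc: "(\<pi> ! p, s) \<notin> prec I" if "s \<in> V" for s
  proof
    assume "(\<pi> ! p, s) \<in> prec I"
    moreover obtain p' where "p' \<le> p" "s = \<pi> ! p'" using pos \<open>s \<in> V\<close> by blast
    ultimately show False using \<pi>(4)[of p p'] p by auto
  qed
  let ?x = "\<pi> ! p"
  obtain i where i: "i < K" "t i + weight I ?x * due I i ?x < weight I ?x * load V i"
    using none[OF p(2)] nosucc by (auto simp: admissible_def not_le)
  have "V \<subseteq> set (take (Suc p) \<pi>)"
  proof
    fix s assume "s \<in> V"
    then obtain p' where "p' \<le> p" "s = \<pi> ! p'" using pos by blast
    thus "s \<in> set (take (Suc p) \<pi>)" using p \<pi>(3) by (auto simp: in_set_conv_nth intro!: exI[of _ p'])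
  qed
  hence "load V i \<le> completion I \<pi> i ?x"
    unfolding completion_nth[OF \<pi>(1), of p, unfolded \<pi>(3), OF p(1)] load_def by (intro sum_mono2) auto
  hence "int (weight I ?x) * (int (load V i) - int (due I i ?x)) \<le> int (weight I ?x) * tardiness I \<pi> i ?x"
    by (intro mult_left_mono) (auto simp: tardiness_def)
  also have "\<dots> \<le> max_weighted_tardiness I \<pi> i"
    using p V by (intro weighted_tardiness_le) auto
  also have "\<dots> \<le> int (t i)" using m i by (simp add: meets_def)
  finally have "int (weight I ?x * load V i) \<le> int (t i + weight I ?x * due I i ?x)"
    by (simp add: algebra_simps)
  thus False using i(2) by linarith
qed

text \<open>\<open>xs\<close> is a tail chosen by the greedy rule, with \<open>V\<close> the jobs still unscheduled.\<close>

primrec built :: "(nat \<Rightarrow> nat) \<Rightarrow> nat set \<Rightarrow> nat list \<Rightarrow> bool" where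
  "built t V [] \<longleftrightarrow> True"
| "built t V (x # xs) \<longleftrightarrow> x \<notin> V \<and> admissible t (insert x V) x \<and> built t (insert x V) xs"

lemma built_distinct: "built t V xs \<Longrightarrow> distinct xs \<and> set xs \<inter> V = {}"
  by (induction xs arbitrary: V) auto

lemma built_admissible:
  "built t V xs \<Longrightarrow> p < length xs \<Longrightarrow> admissible t (V \<union> set (take (Suc p) xs)) (xs ! p)"
proof (induction xs arbitrary: V p)
  case (Cons x xs)
  show ?case
  proof (cases p)
    case 0
    thus ?thesis using Cons.prems by simp
  next
    case (Suc p')
    thus ?thesis using Cons.IH[of "insert x V" p'] Cons.prems by simp
  qed
qed simp

text \<open>With nothing left unscheduled, the set seen by the rule at position \<open>p\<close>
  consists of the jobs up to \<open>p\<close>. Its load is the completion time there, and an arc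
  into this set would be an arc to a job not scheduled later.\<close>

lemma meets_if_built:
  assumes "built t {} \<pi>" "set \<pi> = {..<n}"
  shows "meets I t \<pi>"
proof -
  have d: "distinct \<pi>" using built_distinct[OF assms(1)] by simp
  have len: "length \<pi> = n" using distinct_card[OF d] assms(2) by simp
  have adm: "admissible t (set (take (Suc p) \<pi>)) (\<pi> ! p)" if "p < n" for p
    using built_admissible[OF assms(1)] that len by simp
  have "a < b" if "a < n" "b < n" "(\<pi> ! a, \<pi> ! b) \<in> prec I" for a b
  proof (rule ccontr)
    assume "\<not> a < b"
    hence "\<pi> ! b \<in> set (take (Suc a) \<pi>)"
      using that len by (auto simp: in_set_conv_nth intro!: exI[of _ b])
    thus False using adm[OF that(1)] that(3) by (auto simp: admissible_def)
  qed
  hence sch: "schedule I \<pi>"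
    using d assms(2) by (auto simp: schedule_def permutations_of_set_def)
  have "max_weighted_tardiness I \<pi> i \<le> int (t i)" if i: "i < K" for i
    unfolding max_weighted_tardiness_def
  proof (subst Max_le_iff)
    show "(\<lambda>j. int (weight I j) * tardiness I \<pi> i j) ` {..<n} \<noteq> {}"
      using n_pos by (auto simp: lessThan_empty_iff)
    show "\<forall>a\<in>(\<lambda>j. int (weight I j) * tardiness I \<pi> i j) ` {..<n}. a \<le> int (t i)"
    proof safe
      fix j assume "j < n"
      then obtain p where p: "p < n" "j = \<pi> ! p" using assms(2) len by (metis in_set_conv_nth lessThan_iff)
      have "weight I j * completion I \<pi> i j \<le> t i + weight I j * due I i j"
        using adm[OF p(1)] i completion_nth[OF d, of p] len p by (simp add: admissible_def)
      hence "int (weight I j * completion I \<pi> i j) \<le> int (t i + weight I j * due I i j)" by linarith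
      thus "int (weight I j) * tardiness I \<pi> i j \<le> int (t i)"
        by (auto simp: tardiness_def max_def algebra_simps)
    qed
  qed simp
  thus ?thesis using sch by (simp add: meets_def)
qed

text \<open>Guarantees that the search has something to find. The converse of a finite acyclic
  relation is well-founded, so every nonempty set of jobs contains one without successors in the
  set; it goes last.\<close>

lemma ex_schedule: "\<exists>\<pi>. schedule I \<pi>"
proof -
  have fin: "finite (prec I)"
    using valid unfolding valid_instance_def by (meson finite_SigmaI finite_lessThan finite_subset)
  have wf: "wf ((prec I)\<inverse>)"
    using valid fin unfolding valid_instance_def by (intro finite_acyclic_wf_converse) auto
  have "\<exists>xs. distinct xs \<and> set xs = V \<and>
      (\<forall>a<length xs. \<forall>b<length xs. (xs ! a, xs ! b) \<in> prec I \<longrightarrow> a < b)" if "finite V" for V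
    using that
  proof (induction "card V" arbitrary: V)
    case 0
    thus ?case by (intro exI[of _ "[]"]) auto
  next
    case (Suc k)
    then obtain x where x: "x \<in> V" "\<And>y. (x, y) \<in> prec I \<Longrightarrow> y \<notin> V"
      using wfE_min[OF wf, of _ V] by (metis card.empty converse_iff equals0I nat.distinct(1))
    have "k = card (V - {x})" "finite (V - {x})" using Suc x by auto
    from Suc.hyps(1)[OF this] obtain xs where
      xs: "distinct xs" "set xs = V - {x}"
          "\<And>a b. a < length xs \<Longrightarrow> b < length xs \<Longrightarrow> (xs ! a, xs ! b) \<in> prec I \<Longrightarrow> a < b"
      by blast
    have mem: "xs ! b \<in> V" if "b < length xs" for b using that xs(2) nth_mem by blast
    show ?case
    proof (intro exI[of _ "xs @ [x]"] conjI allI impI)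
      fix a b assume "a < length (xs @ [x])" "b < length (xs @ [x])" "((xs @ [x]) ! a, (xs @ [x]) ! b) \<in> prec I"
      thus "a < b" using xs(3)[of a b] x mem by (auto simp: nth_append split: if_splits)
    qed (use xs x in auto)
  qed
  from this[of "{..<n}"] obtain xs where "distinct xs" "set xs = {..<n}"
    "\<forall>a<length xs. \<forall>b<length xs. (xs ! a, xs ! b) \<in> prec I \<longrightarrow> a < b" by auto
  moreover from this have "length xs = n" using distinct_card[of xs] by simp
  ultimately show ?thesis by (auto simp: schedule_def permutations_of_set_def)
qed

end

section \<open>Memory layout\<close>

lemma length_concat_matrix:
  "length (concat (map (\<lambda>i. map (h i) [0..<n]) [0..<m])) = m * n"
  by (induction m) auto

lemma matrix_index: "i < m \<Longrightarrow> j < n \<Longrightarrow> i * n + j < m * n" for i j m n :: nat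
proof -
  assume "i < m" "j < n"
  hence "i * n + j < Suc i * n" by simp
  also have "\<dots> \<le> m * n" using \<open>i < m\<close> by (intro mult_right_mono) auto
  finally show ?thesis .
qed

lemma nth_concat_matrix:
  assumes "i < m" "j < n"
  shows "concat (map (\<lambda>i. map (h i) [0..<n]) [0..<m]) ! (i * n + j) = h i j"
  using assms
proof (induction m)
  case (Suc m)
  show ?case
  proof (cases "i = m")
    case True
    thus ?thesis using Suc.prems by (simp add: nth_append length_concat_matrix)
  next
    case False
    hence "i < m" using Suc by simp
    moreover have "i * n + j < m * n" using \<open>i < m\<close> Suc.prems(2) by (rule matrix_index)
    ultimately show ?thesis using Suc by (simp add: nth_append length_concat_matrix)
  qed
qed simp

text \<open>\<open>al\<close> is the content of register 9: the level \<open>\<alpha>\<close> for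
  the two risk measures and 0 for the expectation, whose parameter list \<open>par\<close> is
  empty.\<close>

locale layout = bounded_instance I fmax for I fmax +
  fixes par :: "real list" and al :: real
begin

text \<open>Start addresses of the input blocks in the order of \<open>encode\<close>: weights,
  processing times, due dates, probabilities, adjacency matrix. The input ends at
  \<open>aE\<close>.\<close>

definition "aW = length par + 3"
definition "aP = aW + n"
definition "aD = aP + K * n"
definition "aQ = aD + K * n"
definition "aA = aQ + K"
definition "aE = aA + n * n"

definition inp :: "nat \<Rightarrow> real" where
  "inp a = encode par I fmax ! a"

definition adj :: "nat \<Rightarrow> nat \<Rightarrow> real" where
  "adj i j = (if (i, j) \<in> prec I then 1 else 0)"

lemma length_encode: "length (encode par I fmax) = aE"
  by (simp add: encode_def Let_def length_concat_matrix aE_def aA_def aQ_def aD_def aP_def aW_def)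

lemma inp_header:
  "inp (length par) = real n" "inp (length par + 1) = real K" "inp (length par + 2) = real fmax"
  by (simp_all add: inp_def encode_def Let_def nth_append)

lemma inp_weight: "j < n \<Longrightarrow> inp (aW + j) = real (weight I j)"
  by (simp add: inp_def encode_def Let_def nth_append aW_def)

lemma inp_ptime: "i < K \<Longrightarrow> j < n \<Longrightarrow> inp (aP + i * n + j) = real (ptime I i j)"
  using matrix_index[of i K j n]
  by (simp add: inp_def encode_def Let_def nth_append aW_def aP_def length_concat_matrix nth_concat_matrix)

lemma inp_due: "i < K \<Longrightarrow> j < n \<Longrightarrow> inp (aD + i * n + j) = real (due I i j)"
  using matrix_index[of i K j n]
  by (simp add: inp_def encode_def Let_def nth_append aW_def aP_def aD_def
      length_concat_matrix nth_concat_matrix)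

lemma inp_prob: "i < K \<Longrightarrow> inp (aQ + i) = q i"
  by (simp add: inp_def encode_def Let_def nth_append aW_def aP_def aD_def aQ_def length_concat_matrix)

lemma inp_adj: "i < n \<Longrightarrow> j < n \<Longrightarrow> inp (aA + i * n + j) = adj i j"
  by (simp add: inp_def encode_def Let_def nth_append aW_def aP_def aD_def aQ_def aA_def adj_def
      length_concat_matrix nth_concat_matrix)

text \<open>
  Six working arrays are interleaved behind the input, so that each of them is unbounded:
  \<open>T\<close> the threshold vector, \<open>U\<close> the indicator of the unscheduled jobs \<open>V\<close>, \<open>C\<close> the numbers of
  successors in \<open>V\<close>, \<open>L\<close> the total processing times of \<open>V\<close> per scenario, \<open>S\<close> the schedule under
  construction and \<open>B\<close> the best schedule so far.
\<close>

definition arrays :: "(nat \<Rightarrow> real) list \<Rightarrow> nat \<Rightarrow> real" where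
  "arrays fs a = (if a < aE then inp a else (fs ! ((a - aE) mod 6)) ((a - aE) div 6))"

lemma arrays_nth: "c < 6 \<Longrightarrow> arrays fs (aE + (6 * i + c)) = (fs ! c) i"
  by (simp add: arrays_def)

lemma arrays_upd:
  assumes "c < 6" "length fs = 6"
  shows "(arrays fs)(aE + (6 * i + c) := x) = arrays (fs[c := (fs ! c)(i := x)])"
proof
  fix a
  show "((arrays fs)(aE + (6 * i + c) := x)) a = arrays (fs[c := (fs ! c)(i := x)]) a"
  proof (cases "a = aE + (6 * i + c)")
    case True
    thus ?thesis using assms by (simp add: arrays_def)
  next
    case False
    hence "a < aE \<or> (a - aE) mod 6 \<noteq> c \<or> (a - aE) div 6 \<noteq> i"
      using div_mult_mod_eq[of "a - aE" 6] by linarith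
    thus ?thesis using False assms by (auto simp: arrays_def nth_list_update)
  qed
qed

definition mem :: "(nat \<Rightarrow> real) \<Rightarrow> (nat \<Rightarrow> real) \<Rightarrow> (nat \<Rightarrow> real) \<Rightarrow> (nat \<Rightarrow> real) \<Rightarrow>
    (nat \<Rightarrow> real) \<Rightarrow> (nat \<Rightarrow> real) \<Rightarrow> nat \<Rightarrow> real" where
  "mem T U C L S B = arrays [T, U, C, L, S, B]"

lemma mem_inp: "a < aE \<Longrightarrow> mem T U C L S B a = inp a"
  by (simp add: mem_def arrays_def)

lemma mem_arr:
  "mem T U C L S B (aE + (6 * i + 0)) = T i"
  "mem T U C L S B (aE + (6 * i + 1)) = U i"
  "mem T U C L S B (aE + (6 * i + 2)) = C i"
  "mem T U C L S B (aE + (6 * i + 3)) = L i"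
  "mem T U C L S B (aE + (6 * i + 4)) = S i"
  "mem T U C L S B (aE + (6 * i + 5)) = B i"
  unfolding mem_def by (subst arrays_nth; simp)+

lemma mem_upd:
  "(mem T U C L S B)(aE + (6 * i + 0) := x) = mem (T(i := x)) U C L S B"
  "(mem T U C L S B)(aE + (6 * i + 1) := x) = mem T (U(i := x)) C L S B"
  "(mem T U C L S B)(aE + (6 * i + 2) := x) = mem T U (C(i := x)) L S B"
  "(mem T U C L S B)(aE + (6 * i + 3) := x) = mem T U C (L(i := x)) S B"
  "(mem T U C L S B)(aE + (6 * i + 4) := x) = mem T U C L (S(i := x)) B"
  "(mem T U C L S B)(aE + (6 * i + 5) := x) = mem T U C L S (B(i := x))"
  unfolding mem_def by (subst arrays_upd; simp)+

text \<open>
  Further registers: 10 the number of threshold vectors, 11 the best value, 12 the counter of the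
  main loop, 13 the value of the current vector, 14 the success flag of the greedy rule.
\<close>

definition base :: "(nat \<Rightarrow> real) \<Rightarrow> bool" where
  "base v \<longleftrightarrow> v 0 = real n \<and> v 1 = real K \<and> v 2 = real fmax \<and> v 3 = real aW \<and> v 4 = real aP \<and>
     v 5 = real aD \<and> v 6 = real aQ \<and> v 7 = real aA \<and> v 8 = real aE \<and> v 9 = al"

lemma baseD: assumes "base v" shows "v 0 = real n" "v (Suc 0) = real K" "v 2 = real fmax"
    "v 3 = real aW" "v 4 = real aP" "v 5 = real aD" "v 6 = real aQ" "v 7 = real aA" "v 8 = real aE" "v 9 = al"
  using assms by (auto simp: base_def)

lemma base_frame: "base v \<Longrightarrow> frame d v v' \<Longrightarrow> 10 \<le> d \<Longrightarrow> base v'"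
  by (simp add: base_def frame_def)

lemma base_upd [simp]: "10 \<le> x \<Longrightarrow> base (v(x := c)) = base v"
  by (simp add: base_def)

end

text \<open>\<open>c\<close> selects one of the six interleaved arrays, and register 8 holds
  \<open>aE\<close>.\<close>

definition adr :: "nat \<Rightarrow> expr \<Rightarrow> expr" where
  "adr c e = EAdd (EVar 8) (EAdd (EMul (ENum 6) e) (ENum c))"

definition arr :: "nat \<Rightarrow> expr \<Rightarrow> expr" where
  "arr c e = EMem (adr c e)"

definition vec :: "nat \<Rightarrow> expr \<Rightarrow> expr" where
  "vec b e = EMem (EAdd (EVar b) e)"

definition mat :: "nat \<Rightarrow> expr \<Rightarrow> expr \<Rightarrow> expr" where
  "mat b e e' = EMem (EAdd (EVar b) (EAdd (EMul e (EVar 0)) e'))"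

lemma esteps_access [simp]:
  "esteps (adr c e) = esteps e + 7" "esteps (arr c e) = esteps e + 8"
  "esteps (vec b e) = esteps e + 4" "esteps (mat b e e') = esteps e + esteps e' + 8"
  by (simp_all add: adr_def arr_def vec_def mat_def)

context layout begin

lemma ev_adr:
  assumes "base v" "ev e v M = real i"
  shows "ev (adr c e) v M = real (aE + (6 * i + c))"
  using assms by (simp add: adr_def baseD)

lemma safe_adr: "safe e v M \<Longrightarrow> safe (adr c e) v M"
  by (simp add: adr_def)

lemma safe_arr: "base v \<Longrightarrow> safe e v M \<Longrightarrow> ev e v M = real i \<Longrightarrow> safe (arr c e) v M"
  by (simp add: arr_def safe_adr ev_adr del: of_nat_add)

lemma ev_arr:
  assumes "base v" "ev e v (mem T U C L S B) = real i"
  shows "ev (arr 0 e) v (mem T U C L S B) = T i"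
    "ev (arr (Suc 0) e) v (mem T U C L S B) = U i"
    "ev (arr 2 e) v (mem T U C L S B) = C i"
    "ev (arr 3 e) v (mem T U C L S B) = L i"
    "ev (arr 4 e) v (mem T U C L S B) = S i"
    "ev (arr 5 e) v (mem T U C L S B) = B i"
  unfolding arr_def ev.simps ev_adr[OF assms] floor_of_nat nat_int
  using mem_arr[of T U C L S B i] by simp_all

lemma runs_put_arr:
  assumes "base v" "safe e v M" "ev e v M = real i" "safe x v M"
    "esteps e + esteps x + 8 \<le> Z" "Q v (M(aE + (6 * i + c) := ev x v M))"
  shows "runs (put (adr c e) x) v M Z Q"
  by (rule runs_put) (use assms in \<open>simp_all add: safe_adr ev_adr del: of_nat_add\<close>)

lemma vec_access:
  assumes "v b = real a" "b < 30" "safe e v M" "ev e v M = real j"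
  shows "safe (vec b e) v M" "ev (vec b e) v M = M (a + j)"
proof -
  have "ev (EAdd (EVar b) e) v M = real (a + j)" using assms by simp
  thus "ev (vec b e) v M = M (a + j)" "safe (vec b e) v M"
    unfolding vec_def ev.simps(6) safe.simps(6) by (simp_all only: floor_of_nat nat_int of_nat_in_Nats)
      (use assms in simp)
qed

lemma mat_access:
  assumes "base v" "v b = real a" "b < 30" "safe e v M" "ev e v M = real i" "safe e' v M" "ev e' v M = real j"
  shows "safe (mat b e e') v M" "ev (mat b e e') v M = M (a + i * n + j)"
proof -
  have "ev (EAdd (EVar b) (EAdd (EMul e (EVar 0)) e')) v M = real (a + i * n + j)"
    using assms by (simp add: baseD)
  thus "ev (mat b e e') v M = M (a + i * n + j)" "safe (mat b e e') v M"
    unfolding mat_def ev.simps(6) safe.simps(6) by (simp_all only: floor_of_nat nat_int of_nat_in_Nats)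
      (use assms in simp)
qed

lemma weight_access:
  assumes "base v" "safe e v (mem T U C L S B)" "ev e v (mem T U C L S B) = real j" "j < n"
  shows "safe (vec 3 e) v (mem T U C L S B)" "ev (vec 3 e) v (mem T U C L S B) = real (weight I j)"
proof -
  have "aW + j < aE" using assms by (simp add: aE_def aA_def aQ_def aD_def aP_def)
  thus "safe (vec 3 e) v (mem T U C L S B)" "ev (vec 3 e) v (mem T U C L S B) = real (weight I j)"
    using vec_access[of v 3 aW e, OF _ _ assms(2,3)] assms by (simp_all add: baseD mem_inp inp_weight)
qed

lemma prob_access:
  assumes "base v" "safe e v (mem T U C L S B)" "ev e v (mem T U C L S B) = real j" "j < K"
  shows "safe (vec 6 e) v (mem T U C L S B)" "ev (vec 6 e) v (mem T U C L S B) = q j"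
proof -
  have "aQ + j < aE" using assms by (simp add: aE_def aA_def)
  thus "safe (vec 6 e) v (mem T U C L S B)" "ev (vec 6 e) v (mem T U C L S B) = q j"
    using vec_access[of v 6 aQ e, OF _ _ assms(2,3)] assms by (simp_all add: baseD mem_inp inp_prob)
qed

lemma ptime_access:
  assumes "base v" "safe e v (mem T U C L S B)" "ev e v (mem T U C L S B) = real i" "i < K"
    "safe e' v (mem T U C L S B)" "ev e' v (mem T U C L S B) = real j" "j < n"
  shows "safe (mat 4 e e') v (mem T U C L S B)" "ev (mat 4 e e') v (mem T U C L S B) = real (ptime I i j)"
proof -
  have "aP + i * n + j < aE" using matrix_index[of i K j n] assms by (simp add: aE_def aA_def aQ_def aD_def)
  thus "safe (mat 4 e e') v (mem T U C L S B)" "ev (mat 4 e e') v (mem T U C L S B) = real (ptime I i j)"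
    using mat_access[of v 4 aP e, OF _ _ _ assms(2,3,5,6)] assms by (simp_all add: baseD mem_inp inp_ptime)
qed

lemma due_access:
  assumes "base v" "safe e v (mem T U C L S B)" "ev e v (mem T U C L S B) = real i" "i < K"
    "safe e' v (mem T U C L S B)" "ev e' v (mem T U C L S B) = real j" "j < n"
  shows "safe (mat 5 e e') v (mem T U C L S B)" "ev (mat 5 e e') v (mem T U C L S B) = real (due I i j)"
proof -
  have "aD + i * n + j < aE" using matrix_index[of i K j n] assms by (simp add: aE_def aA_def aQ_def)
  thus "safe (mat 5 e e') v (mem T U C L S B)" "ev (mat 5 e e') v (mem T U C L S B) = real (due I i j)"
    using mat_access[of v 5 aD e, OF _ _ _ assms(2,3,5,6)] assms by (simp_all add: baseD mem_inp inp_due)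
qed

lemma adj_access:
  assumes "base v" "safe e v (mem T U C L S B)" "ev e v (mem T U C L S B) = real i" "i < n"
    "safe e' v (mem T U C L S B)" "ev e' v (mem T U C L S B) = real j" "j < n"
  shows "safe (mat 7 e e') v (mem T U C L S B)" "ev (mat 7 e e') v (mem T U C L S B) = adj i j"
proof -
  have "aA + i * n + j < aE" using matrix_index[of i n j n] assms by (simp add: aE_def)
  thus "safe (mat 7 e e') v (mem T U C L S B)" "ev (mat 7 e e') v (mem T U C L S B) = adj i j"
    using mat_access[of v 7 aA e, OF _ _ _ assms(2,3,5,6)] assms by (simp_all add: baseD mem_inp inp_adj)
qed

end

section \<open>The greedy program\<close>

text \<open>Adds job \<open>v 17\<close> to the unscheduled jobs if \<open>v 18 = 1\<close>, and removes it if \<open>v 18 = -1\<close>.\<close>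

definition toggle :: ram where
  "toggle = Seq (put (adr 1 (EVar 17)) (EAdd (arr 1 (EVar 17)) (EVar 18)))
    (Seq (for_loop 19 0 (put (adr 2 (EVar 19))
            (EAdd (arr 2 (EVar 19)) (EMul (EVar 18) (mat 7 (EVar 19) (EVar 17))))))
         (for_loop 19 1 (put (adr 3 (EVar 19))
            (EAdd (arr 3 (EVar 19)) (EMul (EVar 18) (mat 4 (EVar 19) (EVar 17)))))))"

context layout begin

lemmas runs_put_T = runs_put_arr[where M = "mem T U C L S B" and c = 0 for T U C L S B, unfolded mem_upd]
lemmas runs_put_U = runs_put_arr[where M = "mem T U C L S B" and c = 1 for T U C L S B, unfolded mem_upd]
lemmas runs_put_C = runs_put_arr[where M = "mem T U C L S B" and c = 2 for T U C L S B, unfolded mem_upd]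
lemmas runs_put_L = runs_put_arr[where M = "mem T U C L S B" and c = 3 for T U C L S B, unfolded mem_upd]
lemmas runs_put_S = runs_put_arr[where M = "mem T U C L S B" and c = 4 for T U C L S B, unfolded mem_upd]
lemmas runs_put_B = runs_put_arr[where M = "mem T U C L S B" and c = 5 for T U C L S B, unfolded mem_upd]

text \<open>Column \<open>j\<close> of the adjacency matrix marks the predecessors of
  \<open>j\<close>, and these are the jobs whose number of successors changes when \<open>j\<close>
  enters or leaves the unscheduled set.\<close>

lemma runs_toggle:
  assumes b: "base v" and j: "v 17 = real j" "j < n" and s: "v 18 = \<sigma>"
  shows "runs toggle v (mem T U C L S B) (100 * (n + K)) (\<lambda>v' M'. frame 19 v v' \<and>
    M' = mem T (U(j := U j + \<sigma>)) (\<lambda>i. if i < n then C i + \<sigma> * adj i j else C i)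
           (\<lambda>i. if i < K then L i + \<sigma> * real (ptime I i j) else L i) S B)"
proof -
  let ?U = "U(j := U j + \<sigma>)"
  let ?C = "\<lambda>k i. if i < k then C i + \<sigma> * adj i j else C i"
  let ?L = "\<lambda>k i. if i < k then L i + \<sigma> * real (ptime I i j) else L i"
  let ?put1 = "put (adr 1 (EVar 17)) (EAdd (arr 1 (EVar 17)) (EVar 18))"
  let ?put2 = "put (adr 2 (EVar 19)) (EAdd (arr 2 (EVar 19)) (EMul (EVar 18) (mat 7 (EVar 19) (EVar 17))))"
  let ?put3 = "put (adr 3 (EVar 19)) (EAdd (arr 3 (EVar 19)) (EMul (EVar 18) (mat 4 (EVar 19) (EVar 17))))"
  have 1: "runs ?put1 v (mem T U C L S B) 30 (\<lambda>v' M'. v' = v \<and> M' = mem T ?U C L S B)"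
    by (rule runs_put_U[where i = j]) (use assms in \<open>simp_all add: safe_arr ev_arr\<close>)
  have body2: "runs ?put2 v' (mem T ?U (?C k) L S B) 50
      (\<lambda>v'' M''. v'' 19 = real k \<and> frame 19 v' v'' \<and> M'' = mem T ?U (?C (Suc k)) L S B)"
    if "k < n" "frame 19 v v'" "v' 19 = real k" for k v'
  proof (rule runs_put_C[where i = k])
    have v': "base v'" "v' 17 = real j" "v' 18 = \<sigma>"
      using that base_frame[OF b that(2)] assms frameD[OF that(2)] by auto
    note acc = adj_access[OF v'(1), of "EVar 19" T ?U "?C k" L S B k "EVar 17" j] safe_arr[OF v'(1), of "EVar 19" _ k]
      ev_arr[OF v'(1), of "EVar 19" T ?U "?C k" L S B k]
    show "base v'" by fact
    show "safe (EAdd (arr 2 (EVar 19)) (EMul (EVar 18) (mat 7 (EVar 19) (EVar 17)))) v' (mem T ?U (?C k) L S B)"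
      using acc that v' j by simp
    have "(?C k)(k := ev (EAdd (arr 2 (EVar 19)) (EMul (EVar 18) (mat 7 (EVar 19) (EVar 17)))) v' (mem T ?U (?C k) L S B))
      = ?C (Suc k)"
      using acc that v' j by (auto simp: less_Suc_eq)
    thus "v' 19 = real k \<and> frame 19 v' v' \<and>
      mem T ?U ((?C k)(k := ev (EAdd (arr 2 (EVar 19)) (EMul (EVar 18) (mat 7 (EVar 19) (EVar 17)))) v' (mem T ?U (?C k) L S B))) L S B
      = mem T ?U (?C (Suc k)) L S B" using that by simp
  qed (use that in simp_all)
  have 2: "runs (for_loop 19 0 ?put2) v (mem T ?U C L S B) (n * (50 + 13) + 10)
      (\<lambda>v' M'. frame 19 v v' \<and> M' = mem T ?U (?C n) L S B)"
    by (rule runs_for[where d = 19 and N = n and T = 50 and J = "\<lambda>k v' M'. M' = mem T ?U (?C k) L S B"])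
       (use body2 b in \<open>auto simp: baseD\<close>)
  have body3: "runs ?put3 v' (mem T ?U (?C n) (?L k) S B) 50
      (\<lambda>v'' M''. v'' 19 = real k \<and> frame 19 v' v'' \<and> M'' = mem T ?U (?C n) (?L (Suc k)) S B)"
    if "k < K" "frame 19 v v'" "v' 19 = real k" for k v'
  proof (rule runs_put_L[where i = k])
    have v': "base v'" "v' 17 = real j" "v' 18 = \<sigma>"
      using that base_frame[OF b that(2)] assms frameD[OF that(2)] by auto
    note acc = ptime_access[OF v'(1), of "EVar 19" T ?U "?C n" "?L k" S B k "EVar 17" j] safe_arr[OF v'(1), of "EVar 19" _ k]
      ev_arr[OF v'(1), of "EVar 19" T ?U "?C n" "?L k" S B k]
    show "base v'" by fact
    show "safe (EAdd (arr 3 (EVar 19)) (EMul (EVar 18) (mat 4 (EVar 19) (EVar 17)))) v' (mem T ?U (?C n) (?L k) S B)"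
      using acc that v' j by simp
    have "(?L k)(k := ev (EAdd (arr 3 (EVar 19)) (EMul (EVar 18) (mat 4 (EVar 19) (EVar 17)))) v' (mem T ?U (?C n) (?L k) S B))
      = ?L (Suc k)"
      using acc that v' j by (auto simp: less_Suc_eq)
    thus "v' 19 = real k \<and> frame 19 v' v' \<and>
      mem T ?U (?C n) ((?L k)(k := ev (EAdd (arr 3 (EVar 19)) (EMul (EVar 18) (mat 4 (EVar 19) (EVar 17)))) v' (mem T ?U (?C n) (?L k) S B))) S B
      = mem T ?U (?C n) (?L (Suc k)) S B" using that by simp
  qed (use that in simp_all)
  have 3: "runs (for_loop 19 1 ?put3) v' (mem T ?U (?C n) L S B) (K * (50 + 13) + 10)
      (\<lambda>v'' M'. frame 19 v v'' \<and> M' = mem T ?U (?C n) (?L K) S B)" if fr: "frame 19 v v'" for v'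
    by (rule runs_for[where d = 19 and N = K and T = 50 and J = "\<lambda>k v' M'. M' = mem T ?U (?C n) (?L k) S B"])
       (use body3 base_frame[OF b fr] in \<open>auto simp: baseD intro: frame_trans[OF fr]\<close>)
  have 23: "runs (Seq (for_loop 19 0 ?put2) (for_loop 19 1 ?put3)) v (mem T ?U C L S B)
      (n * (50 + 13) + 10 + (K * (50 + 13) + 10)) (\<lambda>v' M'. frame 19 v v' \<and> M' = mem T ?U (?C n) (?L K) S B)"
    by (rule runs_Seq[OF 2 _ order_refl]) (use 3 in blast)
  show ?thesis
    unfolding toggle_def
    by (rule runs_Seq[OF 1, where T' = "n * (50 + 13) + 10 + (K * (50 + 13) + 10)"])
       (use 23 n_pos K_pos in auto)
qed

definition tracks :: "nat set \<Rightarrow> (nat \<Rightarrow> real) \<Rightarrow> (nat \<Rightarrow> real) \<Rightarrow> (nat \<Rightarrow> real) \<Rightarrow> bool" where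
  "tracks V U C L \<longleftrightarrow> V \<subseteq> {..<n} \<and> (\<forall>j<n. U j = (if j \<in> V then 1 else 0)) \<and>
     (\<forall>i<n. C i = (\<Sum>s\<in>V. adj i s)) \<and> (\<forall>i<K. L i = real (load V i))"

lemma tracks_finite: "tracks V U C L \<Longrightarrow> finite V"
  unfolding tracks_def using finite_subset by blast

text \<open>The factor 1 here, and -1 for removal, stays in place so that the arrays match the
  postcondition of \<open>runs_toggle\<close> literally.\<close>

lemma tracks_insert:
  assumes "tracks V U C L" "j < n" "j \<notin> V"
  shows "tracks (insert j V) (U(j := U j + 1)) (\<lambda>i. if i < n then C i + 1 * adj i j else C i)
    (\<lambda>i. if i < K then L i + 1 * real (ptime I i j) else L i)"
  using assms tracks_finite[OF assms(1)] by (auto simp: tracks_def load_def)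

lemma tracks_remove:
  assumes "tracks V U C L" "j \<in> V"
  shows "tracks (V - {j}) (U(j := U j + -1)) (\<lambda>i. if i < n then C i + -1 * adj i j else C i)
    (\<lambda>i. if i < K then L i + -1 * real (ptime I i j) else L i)"
proof -
  have fin: "finite V" by (rule tracks_finite[OF assms(1)])
  have "(\<Sum>s\<in>V - {j}. adj i s) = (\<Sum>s\<in>V. adj i s) - adj i j" for i
    using fin assms(2) by (simp add: sum_diff1)
  moreover have "real (load (V - {j}) i) = real (load V i) - real (ptime I i j)" for i
    unfolding load_def of_nat_sum using fin assms(2) by (simp add: sum_diff1)
  ultimately show ?thesis using assms by (auto simp: tracks_def)
qed

end

text \<open>
  A failed attempt leaves some jobs unscheduled; adding back only the missing ones avoids
  reinitialising the arrays.
\<close>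

definition fill :: ram where
  "fill = for_loop 17 0 (ifle (arr 1 (EVar 17)) (ENum 0) (Seq (assign 18 (ENum 1)) toggle) Skip)"

context layout begin

lemma runs_fill:
  assumes b: "base v" and tr: "tracks V U C L"
  shows "runs fill v (mem T U C L S B) (200 * (n * (n + K))) (\<lambda>v' M'. frame 17 v v' \<and>
    (\<exists>U C L. tracks {..<n} U C L \<and> M' = mem T U C L S B))"
  unfolding fill_def
proof (rule runs_for[where d = 17 and N = n and T = "100 * (n + K) + 20" and
      J = "\<lambda>k v' M'. \<exists>V U C L. tracks V U C L \<and> {..<k} \<subseteq> V \<and> M' = mem T U C L S B"])
  show "v 0 = real n" using b by (simp add: baseD)
  show "\<exists>V' U' C' L'. tracks V' U' C' L' \<and> {..<0} \<subseteq> V' \<and> mem T U C L S B = mem T U' C' L' S B"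
    using tr by auto
  fix i v' M'
  assume i: "i < n" and fr: "frame 17 v v'" and v'i: "v' 17 = real i"
    and "\<exists>V U C L. tracks V U C L \<and> {..<i} \<subseteq> V \<and> M' = mem T U C L S B"
  then obtain V U C L where V: "tracks V U C L" "{..<i} \<subseteq> V" and M': "M' = mem T U C L S B" by blast
  have b': "base v'" using base_frame[OF b fr] by simp
  let ?Q = "\<lambda>v'' M''. v'' 17 = real i \<and> frame 17 v' v'' \<and>
    (\<exists>V U C L. tracks V U C L \<and> {..<Suc i} \<subseteq> V \<and> M'' = mem T U C L S B)"
  note acc = safe_arr[OF b', of "EVar 17" _ i] ev_arr[OF b', of "EVar 17" T U C L S B i]
  show "runs (ifle (arr 1 (EVar 17)) (ENum 0) (Seq (assign 18 (ENum 1)) toggle) Skip) v' M' (100 * (n + K) + 20) ?Q"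
    unfolding M'
  proof (rule runs_ifle[where T = "100 * (n + K) + 5"])
    show "safe (arr 1 (EVar 17)) v' (mem T U C L S B)" using acc v'i by simp
    assume "ev (arr 1 (EVar 17)) v' (mem T U C L S B) \<le> ev (ENum 0) v' (mem T U C L S B)"
    hence "i \<notin> V" using acc v'i V i by (auto simp: tracks_def)
    show "runs (Seq (assign 18 (ENum 1)) toggle) v' (mem T U C L S B) (100 * (n + K) + 5) ?Q"
    proof (rule runs_Seq[where T = 5 and T' = "100 * (n + K)" and Q' = "\<lambda>v'' M''. v'' = v'(18 := 1) \<and> M'' = mem T U C L S B"])
      show "runs (assign 18 (ENum 1)) v' (mem T U C L S B) 5 (\<lambda>v'' M''. v'' = v'(18 := 1) \<and> M'' = mem T U C L S B)"
        by (rule runs_assign) auto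
      fix v'' M'' assume "v'' = v'(18 := 1) \<and> M'' = mem T U C L S B"
      hence v'': "v'' = v'(18 := 1)" "M'' = mem T U C L S B" by auto
      show "runs toggle v'' M'' (100 * (n + K)) ?Q"
        unfolding v''
      proof (rule runs_conseq[OF runs_toggle[of _ i 1] order_refl])
        fix w N
        assume "frame 19 (v'(18 := 1)) w \<and> N = mem T (U(i := U i + 1))
           (\<lambda>k. if k < n then C k + 1 * adj k i else C k) (\<lambda>k. if k < K then L k + 1 * real (ptime I k i) else L k) S B"
        moreover from this have "w 17 = real i" "frame 17 v' w"
          using v'i by (auto simp: frame_def)
        moreover have "{..<Suc i} \<subseteq> insert i V" using V(2) by (auto simp: less_Suc_eq)
        ultimately show "?Q w N" using tracks_insert[OF V(1) i \<open>i \<notin> V\<close>] by blast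
      qed (use b' v'i i in auto)
    qed auto
  next
    assume "\<not> ev (arr 1 (EVar 17)) v' (mem T U C L S B) \<le> ev (ENum 0) v' (mem T U C L S B)"
    hence "i \<in> V" using acc v'i V i by (auto simp: tracks_def split: if_splits)
    hence "{..<Suc i} \<subseteq> V" using V by (auto simp: less_Suc_eq)
    hence "?Q v' (mem T U C L S B)" using V v'i by (auto simp: exI)
    thus "runs Skip v' (mem T U C L S B) (100 * (n + K) + 5) ?Q"
      by (intro runs_Skip) auto
  qed auto
next
  fix v' M'
  assume "frame 17 v v'" and "\<exists>V U C L. tracks V U C L \<and> {..<n} \<subseteq> V \<and> M' = mem T U C L S B"
  moreover have "V = {..<n}" if "tracks V U C L" "{..<n} \<subseteq> V" for V U C L
    using that by (auto simp: tracks_def)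
  ultimately show "frame 17 v v' \<and> (\<exists>U C L. tracks {..<n} U C L \<and> M' = mem T U C L S B)" by metis
next
  have "n * (100 * (n + K) + 20 + 13) + 10 \<le> n * (100 * (n + K)) + 43 * n" using n_pos by (simp add: algebra_simps)
  also have "43 * n \<le> n * (100 * (n + K))" using n_pos by simp
  finally show "n * (100 * (n + K) + 20 + 13) + 10 \<le> 200 * (n * (n + K))" by (simp add: algebra_simps)
qed auto

end

text \<open>Returns the out-of-range job \<open>n\<close> in register 16 if no job is admissible.\<close>

definition find_job :: ram where
  "find_job = Seq (assign 16 (EVar 0)) (for_loop 20 0
     (ifle (ENum 1) (arr 1 (EVar 20)) (ifle (arr 2 (EVar 20)) (ENum 0)
        (Seq (assign 21 (ENum 0)) (Seq
          (for_loop 22 1 (ifle (EMul (vec 3 (EVar 20)) (arr 3 (EVar 22)))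
              (EAdd (arr 0 (EVar 22)) (EMul (vec 3 (EVar 20)) (mat 5 (EVar 22) (EVar 20))))
              Skip (assign 21 (ENum 1))))
          (ifle (EVar 21) (ENum 0) (assign 16 (EVar 20)) Skip)))
        Skip) Skip))"

context layout begin

text \<open>Loops have no early exit, so the scan goes on after a success and a later admissible job
  overwrites register 16. Any admissible job will do, hence the invariant claims only that the
  recorded one is admissible. Register 21 becomes 1 once a scenario is violated.\<close>

lemma runs_find_job:
  assumes b: "base v" and tr: "tracks V U C L" and T: "\<And>i. i < K \<Longrightarrow> T i = real (t i)"
  shows "runs find_job v (mem T U C L S B) (400 * (n * K)) (\<lambda>v' M'. frame 16 v v' \<and> M' = mem T U C L S B \<and>
    ((\<exists>x\<in>V. v' 16 = real x \<and> admissible t V x) \<or> (v' 16 = real n \<and> (\<forall>x\<in>V. \<not> admissible t V x))))"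
proof -
  let ?M = "mem T U C L S B"
  let ?cond = "\<lambda>j i. weight I j * load V i \<le> t i + weight I j * due I i j"
  let ?inner = "ifle (EMul (vec 3 (EVar 20)) (arr 3 (EVar 22)))
              (EAdd (arr 0 (EVar 22)) (EMul (vec 3 (EVar 20)) (mat 5 (EVar 22) (EVar 20))))
              Skip (assign 21 (ENum 1))"
  have inner: "runs ?inner v' ?M 70 (\<lambda>v'' M''. v'' 22 = real i \<and> frame 21 v' v'' \<and> M'' = ?M \<and>
      v'' 21 = (if ?cond j i then v' 21 else 1))"
    if b': "base v'" and j: "v' 20 = real j" "j < n" and i: "v' 22 = real i" "i < K" for v' i j
  proof (rule runs_ifle[where T = 5])
    note acc = safe_arr[OF b', of "EVar 22" _ i] ev_arr[OF b', of "EVar 22" T U C L S B i]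
       weight_access[OF b', of "EVar 20" T U C L S B j] due_access[OF b', of "EVar 22" T U C L S B i "EVar 20" j]
    let ?l = "EMul (vec 3 (EVar 20)) (arr 3 (EVar 22))"
    let ?r = "EAdd (arr 0 (EVar 22)) (EMul (vec 3 (EVar 20)) (mat 5 (EVar 22) (EVar 20)))"
    show "safe ?l v' ?M" "safe ?r v' ?M" using acc i j by simp_all
    have "ev ?l v' ?M = real (weight I j * load V i)" using acc i j tr by (simp add: tracks_def)
    moreover have "ev ?r v' ?M = real (t i + weight I j * due I i j)" using acc i j T by simp
    ultimately have iff: "ev ?l v' ?M \<le> ev ?r v' ?M \<longleftrightarrow> ?cond j i" by (simp only: of_nat_le_iff)
    let ?Q = "\<lambda>v'' M''. v'' 22 = real i \<and> frame 21 v' v'' \<and> M'' = ?M \<and> v'' 21 = (if ?cond j i then v' 21 else 1)"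
    show "runs Skip v' ?M 5 ?Q" if "ev ?l v' ?M \<le> ev ?r v' ?M"
      using that unfolding iff by (intro runs_Skip) (use i in auto)
    show "runs (assign 21 (ENum 1)) v' ?M 5 ?Q" if "\<not> ev ?l v' ?M \<le> ev ?r v' ?M"
      using that unfolding iff by (intro runs_assign) (use i in auto)
  qed simp
  have loop: "runs (for_loop 22 1 ?inner) v' ?M (K * (70 + 13) + 10) (\<lambda>v'' M''. frame 21 v' v'' \<and> M'' = ?M \<and>
      v'' 21 = (if \<forall>i<K. ?cond j i then 0 else 1))"
    if b': "base v'" and j: "v' 20 = real j" "j < n" and z: "v' 21 = 0" for v' j
  proof (rule runs_for[where d = 21 and N = K and T = 70 and
        J = "\<lambda>k v'' M''. M'' = ?M \<and> v'' 21 = (if \<forall>i<k. ?cond j i then 0 else 1)"])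
    show "v' 1 = real K" using b' by (simp add: baseD)
    fix i v'' M''
    assume i: "i < K" "frame 21 v' v''" "v'' 22 = real i"
      and J: "M'' = ?M \<and> v'' 21 = (if \<forall>i'<i. ?cond j i' then 0 else 1)"
    have b'': "base v''" using base_frame[OF b' i(2)] by simp
    have j'': "v'' 20 = real j" using frameD[OF i(2)] j by simp
    have "runs ?inner v'' ?M 70 (\<lambda>w N. w 22 = real i \<and> frame 21 v'' w \<and> N = ?M \<and>
        w 21 = (if \<forall>i'<Suc i. ?cond j i' then 0 else 1))"
      by (rule runs_conseq[OF inner[OF b'' j'' j(2) i(3,1)] order_refl]) (use J in \<open>auto simp: less_Suc_eq\<close>)
    thus "runs ?inner v'' M'' 70 (\<lambda>w N. w 22 = real i \<and> frame 21 v'' w \<and> N = ?M \<and>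
        w 21 = (if \<forall>i'<Suc i. ?cond j i' then 0 else 1))" using J by simp
  qed (use z in auto)
  let ?J = "\<lambda>k v' M'. M' = ?M \<and> ((\<exists>x\<in>V. v' 16 = real x \<and> admissible t V x) \<or>
      (v' 16 = real n \<and> (\<forall>x\<in>V. x < k \<longrightarrow> \<not> admissible t V x)))"
  let ?test = "ifle (EVar 21) (ENum 0) (assign 16 (EVar 20)) Skip"
  let ?body = "ifle (ENum 1) (arr 1 (EVar 20)) (ifle (arr 2 (EVar 20)) (ENum 0)
        (Seq (assign 21 (ENum 0)) (Seq (for_loop 22 1 ?inner) ?test)) Skip) Skip"
  have body: "runs ?body v' ?M (K * 83 + 90) (\<lambda>v'' M''. v'' 20 = real j \<and> frame 16 v' v'' \<and> ?J (Suc j) v'' M'')"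
    (is "runs _ _ _ _ ?Q")
    if b': "base v'" and j: "v' 20 = real j" "j < n" and J: "?J j v' ?M" for v' j
  proof -
    note acc = safe_arr[OF b', of "EVar 20" _ j] ev_arr[OF b', of "EVar 20" T U C L S B j]
    have skip: "runs Skip v' ?M Z ?Q" if "\<not> (j \<in> V \<and> admissible t V j)" "1 \<le> Z" for Z
      using J j that by (intro runs_Skip) (auto simp: less_Suc_eq)
    show ?thesis
    proof (rule runs_ifle[where T = "K * 83 + 70"])
      show "safe (arr 1 (EVar 20)) v' ?M" using acc j by simp
      show "runs Skip v' ?M (K * 83 + 70) ?Q" if "\<not> ev (ENum 1) v' ?M \<le> ev (arr 1 (EVar 20)) v' ?M"
        using that acc j tr by (intro skip) (auto simp: tracks_def)
      assume "ev (ENum 1) v' ?M \<le> ev (arr 1 (EVar 20)) v' ?M"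
      hence jV: "j \<in> V" using acc j tr by (auto simp: tracks_def split: if_splits)
      show "runs (ifle (arr 2 (EVar 20)) (ENum 0)
        (Seq (assign 21 (ENum 0)) (Seq (for_loop 22 1 ?inner) ?test)) Skip) v' ?M (K * 83 + 70) ?Q"
      proof (rule runs_ifle[where T = "K * 83 + 50"])
        show "safe (arr 2 (EVar 20)) v' ?M" using acc j by simp
        have C: "ev (arr 2 (EVar 20)) v' ?M = (\<Sum>s\<in>V. adj j s)" using acc j tr by (simp add: tracks_def)
        \<comment> \<open>The count is a sum of zeros and ones, so the test \<open>\<le> 0\<close>
          is a test for the absence of successors.\<close>
        have nosucc: "(\<Sum>s\<in>V. adj j s) \<le> 0 \<longleftrightarrow> (\<forall>s\<in>V. (j, s) \<notin> prec I)"
        proof -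
          have "0 \<le> (\<Sum>s\<in>V. adj j s)" by (intro sum_nonneg) (simp add: adj_def)
          hence "(\<Sum>s\<in>V. adj j s) \<le> 0 \<longleftrightarrow> (\<Sum>s\<in>V. adj j s) = 0" by linarith
          also have "\<dots> \<longleftrightarrow> (\<forall>s\<in>V. adj j s = 0)"
            using tracks_finite[OF tr] by (intro sum_nonneg_eq_0_iff) (auto simp: adj_def)
          finally show ?thesis by (auto simp: adj_def split: if_splits)
        qed
        show "runs Skip v' ?M (K * 83 + 50) ?Q" if "\<not> ev (arr 2 (EVar 20)) v' ?M \<le> ev (ENum 0) v' ?M"
          using that nosucc unfolding C by (intro skip) (auto simp: admissible_def)
        assume "ev (arr 2 (EVar 20)) v' ?M \<le> ev (ENum 0) v' ?M"
        hence ns: "\<forall>s\<in>V. (j, s) \<notin> prec I" using nosucc unfolding C by simp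
        have 1: "runs (assign 21 (ENum 0)) v' ?M 5 (\<lambda>w N. w = v'(21 := 0) \<and> N = ?M)"
          by (rule runs_assign) auto
        have 2: "runs (for_loop 22 1 ?inner) (v'(21 := 0)) ?M (K * (70 + 13) + 10)
           (\<lambda>w N. frame 21 v' w \<and> N = ?M \<and> w 21 = (if admissible t V j then 0 else 1))"
          by (rule runs_conseq[OF loop[of _ j] order_refl])
             (use b' j ns in \<open>auto simp: frame_def admissible_def\<close>)
        have 3: "runs ?test w ?M 20 ?Q"
          if w: "frame 21 v' w" "w 21 = (if admissible t V j then 0 else 1)" for w
        proof (rule runs_ifle[where T = 5])
          have w': "w 20 = real j" "frame 16 v' w" "w 16 = v' 16" using w(1) j by (auto simp: frame_def)
          show "runs (assign 16 (EVar 20)) w ?M 5 ?Q" if "ev (EVar 21) w ?M \<le> ev (ENum 0) w ?M"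
          proof -
            have "admissible t V j" using that w(2) by (auto split: if_splits)
            thus ?thesis using w' jV by (intro runs_assign) auto
          qed
          show "runs Skip w ?M 5 ?Q" if "\<not> ev (EVar 21) w ?M \<le> ev (ENum 0) w ?M"
          proof -
            have "\<not> admissible t V j" using that w(2) by auto
            thus ?thesis using w' J by (intro runs_Skip) (auto simp: less_Suc_eq)
          qed
        qed auto
        show "runs (Seq (assign 21 (ENum 0)) (Seq (for_loop 22 1 ?inner) ?test)) v' ?M (K * 83 + 50) ?Q"
        proof (rule runs_Seq[OF 1, where T' = "K * 83 + 35"])
          fix w N assume w: "w = v'(21 := 0) \<and> N = ?M"
          have "runs (Seq (for_loop 22 1 ?inner) ?test) (v'(21 := 0)) ?M (K * 83 + 35) ?Q"
            by (rule runs_Seq[OF 2, where T' = 20]) (use 3 in auto)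
          thus "runs (Seq (for_loop 22 1 ?inner) ?test) w N (K * 83 + 35) ?Q" using w by simp
        qed simp
      qed auto
    qed auto
  qed
  have 1: "runs (assign 16 (EVar 0)) v ?M 5 (\<lambda>w N. w = v(16 := real n) \<and> N = ?M)"
    by (rule runs_assign) (use b in \<open>auto simp: baseD\<close>)
  have 2: "runs (for_loop 20 0 ?body) (v(16 := real n)) ?M (n * (K * 83 + 90 + 13) + 10)
     (\<lambda>v' M'. frame 16 v v' \<and> M' = ?M \<and>
    ((\<exists>x\<in>V. v' 16 = real x \<and> admissible t V x) \<or> (v' 16 = real n \<and> (\<forall>x\<in>V. \<not> admissible t V x))))"
  proof (rule runs_for[where d = 16 and N = n and T = "K * 83 + 90" and J = ?J])
    fix i v' M'
    assume i: "i < n" "frame 16 (v(16 := real n)) v'" "v' 20 = real i" and J: "?J i v' M'"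
    have "base v'" using base_frame[OF _ i(2)] b by simp
    moreover have M': "M' = ?M" using J by blast
    moreover have "?J i v' ?M" using J by blast
    ultimately show "runs ?body v' M' (K * 83 + 90) (\<lambda>v'' M''. v'' 20 = real i \<and> frame 16 v' v'' \<and> ?J (Suc i) v'' M'')"
      using body[of v' i] i by blast
  next
    fix v' M' assume fr: "frame 16 (v(16 := real n)) v'" and J: "?J n v' M'"
    have "frame 16 v v'" using fr by (simp add: frame_def)
    moreover have "x < n" if "x \<in> V" for x using that tr by (auto simp: tracks_def)
    ultimately show "frame 16 v v' \<and> M' = ?M \<and>
      ((\<exists>x\<in>V. v' 16 = real x \<and> admissible t V x) \<or> (v' 16 = real n \<and> (\<forall>x\<in>V. \<not> admissible t V x)))"
      using J by blast
  qed (use b in \<open>auto simp: baseD\<close>)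
  show ?thesis
    unfolding find_job_def
  proof (rule runs_Seq[OF 1, where T' = "n * (K * 83 + 90 + 13) + 10"])
    have "n * (K * 83 + 90 + 13) = 83 * (n * K) + 103 * n" by (simp add: algebra_simps)
    moreover have "n \<le> n * K" "1 \<le> n * K" using n_pos K_pos by simp_all
    ultimately show "5 + (n * (K * 83 + 90 + 13) + 10) \<le> 400 * (n * K)" by linarith
  qed (use 2 in auto)
qed

end

text \<open>\<open>x + 1 \<le> n\<close> separates a found job from the out-of-range result
  \<open>n\<close>. The argument -1 of \<open>toggle\<close> is computed as a difference, since
  program constants are natural numbers.\<close>

definition place_job :: ram where
  "place_job = Seq find_job (ifle (EAdd (EVar 16) (ENum 1)) (EVar 0)
     (Seq (put (adr 4 (ESub (ESub (EVar 0) (ENum 1)) (EVar 15))) (EVar 16))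
       (Seq (assign 17 (EVar 16)) (Seq (assign 18 (ESub (ENum 0) (ENum 1))) toggle)))
     (assign 14 (ENum 0)))"

definition greedy :: ram where
  "greedy = Seq fill (Seq (assign 14 (ENum 1)) (for_loop 15 0 place_job))"

context layout begin

text \<open>The tail built so far occupies the last \<open>k\<close> cells of the schedule array.
  After a failure the loop still runs through its remaining rounds, so the second case keeps only
  the flag 0 and the infeasibility of \<open>t\<close>, which no later round can undo.\<close>

definition greedy_inv :: "(nat \<Rightarrow> nat) \<Rightarrow> nat \<Rightarrow> real \<Rightarrow> nat set \<Rightarrow> (nat \<Rightarrow> real) \<Rightarrow> bool" where
  "greedy_inv t k ok V S \<longleftrightarrow>
     ok = 1 \<and> card V = n - k \<and> (\<exists>xs. built t V xs \<and> length xs = k \<and> set xs = {..<n} - V \<and>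
       (\<forall>p<k. S (n - k + p) = real (xs ! p))) \<or>
     ok = 0 \<and> (\<forall>\<pi>. \<not> meets I t \<pi>)"

lemma greedy_inv_place:
  assumes "greedy_inv t k ok V S" "V \<subseteq> {..<n}" "x \<in> V" "admissible t V x" "k < n"
  shows "greedy_inv t (Suc k) ok (V - {x}) (S(n - 1 - k := real x))"
  using assms(1) unfolding greedy_inv_def
proof (elim disjE conjE exE)
  fix xs assume ok: "ok = 1" "card V = n - k" and xs: "built t V xs" "length xs = k" "set xs = {..<n} - V"
    and S: "\<forall>p<k. S (n - k + p) = real (xs ! p)"
  have "insert x (V - {x}) = V" using assms(3) by blast
  hence "built t (V - {x}) (x # xs)" using xs(1) assms(4) by simp
  moreover have "card (V - {x}) = n - Suc k" using ok assms(3) by simp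
  moreover have "set (x # xs) = {..<n} - (V - {x})" using xs(3) assms(2,3) by auto
  moreover have "(S(n - 1 - k := real x)) (n - Suc k + p) = real ((x # xs) ! p)" if "p < Suc k" for p
  proof (cases p)
    case 0
    thus ?thesis by simp
  next
    case (Suc p')
    hence eq: "n - Suc k + p = n - k + p'" and ne: "n - k + p' \<noteq> n - 1 - k" using assms(5) by auto
    have "S (n - k + p') = real (xs ! p')" using S Suc that by blast
    thus ?thesis unfolding eq using ne Suc by (simp only: fun_upd_apply if_False nth_Cons_Suc)
  qed
  moreover have "length (x # xs) = Suc k" using xs(2) by simp
  ultimately show "ok = 1 \<and> card (V - {x}) = n - Suc k \<and> (\<exists>xs. built t (V - {x}) xs \<and> length xs = Suc k \<and>
      set xs = {..<n} - (V - {x}) \<and> (\<forall>p<Suc k. (S(n - 1 - k := real x)) (n - Suc k + p) = real (xs ! p))) \<or>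
     ok = 0 \<and> (\<forall>\<pi>. \<not> meets I t \<pi>)" using ok by blast
qed simp

lemma greedy_inv_stuck:
  assumes "greedy_inv t k ok V S" "V \<subseteq> {..<n}" "\<forall>x\<in>V. \<not> admissible t V x" "k < n"
  shows "greedy_inv t (Suc k) 0 V S"
proof -
  have "\<not> meets I t \<pi>" for \<pi>
    using assms(1) unfolding greedy_inv_def
  proof (elim disjE conjE)
    assume "card V = n - k"
    hence "V \<noteq> {}" using assms(4) by auto
    thus ?thesis using not_meets_if_none_admissible[of V t \<pi>] assms by blast
  qed simp
  thus ?thesis by (simp add: greedy_inv_def)
qed

lemma greedy_inv_final:
  assumes "greedy_inv t n ok V S" "V \<subseteq> {..<n}"
  shows "ok = 1 \<and> (\<exists>\<pi>. meets I t \<pi> \<and> (\<forall>k<n. S k = real (\<pi> ! k))) \<or> ok = 0 \<and> (\<forall>\<pi>. \<not> meets I t \<pi>)"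
proof -
  have "V = {}" if "card V = 0" using that assms(2) finite_subset by fastforce
  thus ?thesis using assms(1) meets_if_built unfolding greedy_inv_def by fastforce
qed

lemma runs_place_job:
  assumes b: "base v" and tr: "tracks V U C L" and T: "\<And>i. i < K \<Longrightarrow> T i = real (t i)"
    and k: "v 15 = real k" "k < n" and inv: "greedy_inv t k (v 14) V S"
  shows "runs place_job v (mem T U C L S B) (400 * (n * K) + 100 * (n + K) + 60) (\<lambda>v' M'.
    v' 15 = real k \<and> frame 14 v v' \<and>
    (\<exists>V U C L S. tracks V U C L \<and> M' = mem T U C L S B \<and> greedy_inv t (Suc k) (v' 14) V S))"
    (is "runs _ _ _ _ ?Q")
proof -
  have V: "V \<subseteq> {..<n}" using tr by (simp add: tracks_def)
  let ?M = "mem T U C L S B" and ?idx = "ESub (ESub (EVar 0) (ENum 1)) (EVar 15)"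
  let ?place = "Seq (put (adr 4 ?idx) (EVar 16))
       (Seq (assign 17 (EVar 16)) (Seq (assign 18 (ESub (ENum 0) (ENum 1))) toggle))"
  have branch: "runs (ifle (EAdd (EVar 16) (ENum 1)) (EVar 0) ?place (assign 14 (ENum 0))) v' ?M (100 * (n + K) + 60) ?Q"
    if fr: "frame 16 v v'" and found: "(\<exists>x\<in>V. v' 16 = real x \<and> admissible t V x) \<or>
       (v' 16 = real n \<and> (\<forall>x\<in>V. \<not> admissible t V x))" for v'
  proof (rule runs_ifle[where T = "100 * (n + K) + 45"])
    have b': "base v'" using base_frame[OF b fr] by simp
    have v': "v' 15 = real k" "v' 14 = v 14" "frame 14 v v'" using fr k by (auto simp: frame_def)
    have v0: "v' 0 = real n" using b' by (simp add: baseD)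
    show "runs (assign 14 (ENum 0)) v' ?M (100 * (n + K) + 45) ?Q"
      if "\<not> ev (EAdd (EVar 16) (ENum 1)) v' ?M \<le> ev (EVar 0) v' ?M"
    proof -
      have "\<forall>x\<in>V. \<not> admissible t V x"
        using that found V v0 by auto
      hence g: "greedy_inv t (Suc k) 0 V S" using greedy_inv_stuck[OF inv V] k by blast
      have "?Q (v'(14 := 0)) ?M"
      proof (intro conjI)
        show "\<exists>V U' C' L' S'. tracks V U' C' L' \<and> ?M = mem T U' C' L' S' B \<and> greedy_inv t (Suc k) ((v'(14 := 0)) 14) V S'"
          using tr g by (intro exI[of _ V] exI[of _ U] exI[of _ C] exI[of _ L] exI[of _ S]) simp
      qed (use v' in simp_all)
      thus ?thesis by (intro runs_assign) simp_all
    qed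
    assume "ev (EAdd (EVar 16) (ENum 1)) v' ?M \<le> ev (EVar 0) v' ?M"
    then obtain x where x: "x \<in> V" "v' 16 = real x" "admissible t V x"
      using found v0 by auto
    have xn: "x < n" using x V by auto
    let ?S = "S(n - 1 - k := real x)"
    have idx: "ev ?idx v' ?M = real (n - 1 - k)" using v0 v' k by simp
    have 1: "runs (put (adr 4 ?idx) (EVar 16)) v' ?M 25 (\<lambda>w N. w = v' \<and> N = mem T U C L ?S B)"
      by (rule runs_put_S[OF b' _ idx]) (use x in auto)
    have 2: "runs (assign 17 (EVar 16)) v' (mem T U C L ?S B) 5 (\<lambda>w N. w = v'(17 := real x) \<and> N = mem T U C L ?S B)"
      by (rule runs_assign) (use x in auto)
    have 3: "runs (assign 18 (ESub (ENum 0) (ENum 1))) (v'(17 := real x)) (mem T U C L ?S B) 5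
        (\<lambda>w N. w = v'(17 := real x, 18 := -1) \<and> N = mem T U C L ?S B)"
      by (rule runs_assign) auto
    have 4: "runs toggle (v'(17 := real x, 18 := -1)) (mem T U C L ?S B) (100 * (n + K)) ?Q"
    proof (rule runs_conseq[OF runs_toggle[of _ x "-1"] order_refl])
      fix w N
      let ?U = "U(x := U x + - 1)" and ?C = "\<lambda>i. if i < n then C i + - 1 * adj i x else C i"
        and ?L = "\<lambda>i. if i < K then L i + - 1 * real (ptime I i x) else L i"
      assume w: "frame 19 (v'(17 := real x, 18 := - 1)) w \<and> N = mem T ?U ?C ?L ?S B"
      hence fw: "w 15 = real k" "frame 14 v w" "w 14 = v 14" using v' by (auto simp: frame_def)
      have "greedy_inv t (Suc k) (w 14) (V - {x}) ?S"
        using greedy_inv_place[OF inv V x(1,3) k(2)] fw by simp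
      thus "?Q w N" using w fw tracks_remove[OF tr x(1)] by blast
    qed (use b' xn in auto)
    have 34: "runs (Seq (assign 18 (ESub (ENum 0) (ENum 1))) toggle) (v'(17 := real x)) (mem T U C L ?S B) (100 * (n + K) + 5) ?Q"
      by (rule runs_Seq[OF 3, where T' = "100 * (n + K)"]) (use 4 in auto)
    have 234: "runs (Seq (assign 17 (EVar 16)) (Seq (assign 18 (ESub (ENum 0) (ENum 1))) toggle)) v'
        (mem T U C L ?S B) (100 * (n + K) + 10) ?Q"
      by (rule runs_Seq[OF 2, where T' = "100 * (n + K) + 5"]) (use 34 in auto)
    show "runs ?place v' ?M (100 * (n + K) + 45) ?Q"
      by (rule runs_Seq[OF 1, where T' = "100 * (n + K) + 10"]) (use 234 in auto)
  qed auto
  show ?thesis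
    unfolding place_job_def
    by (rule runs_Seq[OF runs_find_job[OF b tr T], where T' = "100 * (n + K) + 60"]) (use branch in auto)
qed

lemma runs_greedy:
  assumes b: "base v" and tr: "tracks V U C L" and T: "\<And>i. i < K \<Longrightarrow> T i = real (t i)"
  shows "runs greedy v (mem T U C L S B) (1200 * (n * n * K)) (\<lambda>v' M'. frame 14 v v' \<and>
    (\<exists>V U C L S. tracks V U C L \<and> M' = mem T U C L S B \<and>
      (v' 14 = 1 \<and> (\<exists>\<pi>. meets I t \<pi> \<and> (\<forall>k<n. S k = real (\<pi> ! k))) \<or>
       v' 14 = 0 \<and> (\<forall>\<pi>. \<not> meets I t \<pi>))))"
    (is "runs _ _ _ _ ?Q")
proof -
  let ?J = "\<lambda>k v' M'. \<exists>V U C L S. tracks V U C L \<and> M' = mem T U C L S B \<and> greedy_inv t k (v' 14) V S"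
  let ?t = "400 * (n * K) + 100 * (n + K) + 60"
  have 1: "runs (assign 14 (ENum 1)) v' M' 5 (\<lambda>w N. w = v'(14 := 1) \<and> N = M')" for v' M'
    by (rule runs_assign) auto
  have 2: "runs (for_loop 15 0 place_job) (v'(14 := 1)) M' (n * (?t + 13) + 10) ?Q"
    if fr: "frame 17 v v'" and M': "M' = mem T U C L S B" and tr': "tracks {..<n} U C L" for v' M' U C L
  proof (rule runs_for[where d = 14 and N = n and T = ?t and J = ?J])
    have b': "base v'" using base_frame[OF b fr] by simp
    show "(v'(14 := 1)) 0 = real n" using b' by (simp add: baseD)
    have "greedy_inv t 0 1 {..<n} S" by (simp add: greedy_inv_def)
    thus "?J 0 (v'(14 := 1)) M'" using M' tr' by (metis fun_upd_same)
    fix i w N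
    assume i: "i < n" "frame 14 (v'(14 := 1)) w" "w 15 = real i" and "?J i w N"
    then obtain V U C L S where V: "tracks V U C L" "N = mem T U C L S B" "greedy_inv t i (w 14) V S" by blast
    have "base w" using base_frame[OF _ i(2)] b' by simp
    from runs_place_job[OF this V(1) T i(3,1) V(3)]
    show "runs place_job w N ?t (\<lambda>v'' M''. v'' 15 = real i \<and> frame 14 w v'' \<and> ?J (Suc i) v'' M'')"
      unfolding V(2) .
  next
    fix w N assume w: "frame 14 (v'(14 := 1)) w" and "?J n w N"
    then obtain V U C L S where V: "tracks V U C L" "N = mem T U C L S B" "greedy_inv t n (w 14) V S" by blast
    have "frame 14 v w" using w fr by (auto simp: frame_def)
    moreover have "V \<subseteq> {..<n}" using V by (simp add: tracks_def)
    note greedy_inv_final[OF V(3) this]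
    ultimately show "?Q w N" using V by blast
  qed auto
  have 12: "runs (Seq (assign 14 (ENum 1)) (for_loop 15 0 place_job)) v' M' (n * (?t + 13) + 15) ?Q"
    if "frame 17 v v'" "\<exists>U C L. tracks {..<n} U C L \<and> M' = mem T U C L S B" for v' M'
    by (rule runs_Seq[OF 1, where T' = "n * (?t + 13) + 10"]) (use that 2 in auto)
  \<comment> \<open>As \<open>n\<close> and \<open>K\<close> are at least 1, each term is at most
    its coefficient times \<open>n * n * K\<close>; the coefficients sum to 1088.\<close>
  have "200 * (n * (n + K)) + (n * (?t + 13) + 15) \<le> 1200 * (n * n * K)"
  proof -
    have "n * (?t + 13) = 400 * (n * n * K) + 100 * (n * n) + 100 * (n * K) + 73 * n"
      by (simp add: algebra_simps)
    moreover have "200 * (n * (n + K)) = 200 * (n * n) + 200 * (n * K)" by (simp add: algebra_simps)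
    moreover have "n * n \<le> n * n * K" "n * K \<le> n * n * K" "n \<le> n * n * K" "1 \<le> n * n * K"
      using n_pos K_pos by simp_all
    ultimately show ?thesis by linarith
  qed
  thus ?thesis
    unfolding greedy_def
    by (rule runs_Seq[OF runs_fill[OF b tr], rotated]) (use 12 in auto)
qed

end

section \<open>Enumerating and evaluating threshold vectors\<close>

text \<open>Digit \<open>i\<close> of \<open>m\<close> in base \<open>F\<close>, the least
  significant digit having index 0.\<close>

definition digit :: "nat \<Rightarrow> nat \<Rightarrow> nat \<Rightarrow> nat" where
  "digit F m i = m div F ^ i mod F"

lemma digit_less: "0 < F \<Longrightarrow> digit F m i < F"
  by (simp add: digit_def)

text \<open>When \<open>m\<close> is incremented, a carry reaches position \<open>k\<close> iff all
  lower digits equal \<open>F - 1\<close>, that is, iff \<open>F ^ k\<close> divides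
  \<open>Suc m\<close>.\<close>

lemma digit_Suc:
  fixes m k F :: nat
  assumes "0 < F" and c: "c = (if F ^ k dvd Suc m then 1 else 0)"
  shows "digit F m k + c < F \<Longrightarrow> digit F (Suc m) k = digit F m k + c \<and> \<not> F ^ Suc k dvd Suc m"
    and "\<not> digit F m k + c < F \<Longrightarrow> digit F (Suc m) k = 0 \<and> F ^ Suc k dvd Suc m"
proof -
  have "(digit F m k + c < F \<longrightarrow> digit F (Suc m) k = digit F m k + c \<and> \<not> F ^ Suc k dvd Suc m) \<and>
        (\<not> digit F m k + c < F \<longrightarrow> digit F (Suc m) k = 0 \<and> F ^ Suc k dvd Suc m)"
  proof (cases "F ^ k dvd Suc m")
    case True
    have div: "Suc m div F ^ k = Suc (m div F ^ k)" using True by (simp add: div_Suc dvd_eq_mod_eq_0)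
    have "F ^ Suc k dvd Suc m \<longleftrightarrow> F dvd Suc m div F ^ k"
      using True assms(1) by (metis div_dvd_iff_mult dvd_mult_div_cancel dvd_times_left_cancel_iff power_Suc2 power_not_zero neq0_conv)
    also have "\<dots> \<longleftrightarrow> Suc (m div F ^ k) mod F = 0" unfolding div by (simp add: dvd_eq_mod_eq_0)
    finally have d: "F ^ Suc k dvd Suc m \<longleftrightarrow> Suc (m div F ^ k) mod F = 0" .
    have less: "m div F ^ k mod F < F" using assms(1) by simp
    show ?thesis using True less unfolding d digit_def div c by (auto simp: mod_Suc)
  next
    case False
    have "Suc m div F ^ k = m div F ^ k" using False by (simp add: div_Suc dvd_eq_mod_eq_0)
    moreover have "\<not> F ^ Suc k dvd Suc m" using False by (metis dvd_trans le_imp_power_dvd le_add2 plus_1_eq_Suc)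
    moreover have "digit F m k < F" using assms(1) by (rule digit_less)
    ultimately show ?thesis using False by (simp add: digit_def c)
  qed
  thus "digit F m k + c < F \<Longrightarrow> digit F (Suc m) k = digit F m k + c \<and> \<not> F ^ Suc k dvd Suc m"
    and "\<not> digit F m k + c < F \<Longrightarrow> digit F (Suc m) k = 0 \<and> F ^ Suc k dvd Suc m" by blast+
qed

lemma ex_digits:
  assumes "\<And>i. i < K \<Longrightarrow> t i < F"
  shows "\<exists>m<F ^ K. \<forall>i<K. digit F m i = t i"
  using assms
proof (induction K)
  case (Suc K)
  then obtain m where m: "m < F ^ K" "\<forall>i<K. digit F m i = t i" by (meson less_SucI)
  have tK: "t K < F" using Suc.prems by simp
  hence F: "0 < F" by simp
  let ?m = "m + t K * F ^ K"
  have "?m < F ^ K + t K * F ^ K" using m by simp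
  also have "\<dots> = Suc (t K) * F ^ K" by simp
  also have "\<dots> \<le> F * F ^ K" using tK by (intro mult_right_mono) auto
  finally have "?m < F ^ Suc K" by simp
  moreover have "digit F ?m i = t i" if "i < Suc K" for i
  proof (cases "i = K")
    case True
    thus ?thesis using m tK F by (simp add: digit_def)
  next
    case False
    \<comment> \<open>The new leading term is divisible by \<open>F ^ Suc i\<close> and therefore
      does not change digit \<open>i\<close>.\<close>
    then obtain e where e: "K = i + Suc e" using \<open>i < Suc K\<close> less_imp_Suc_add[of i K] by auto
    have "?m = m + F ^ i * (F * (t K * F ^ e))" unfolding e by (simp add: power_add algebra_simps)
    moreover have "(m + F ^ i * z) div F ^ i = z + m div F ^ i" for z using F by simp
    ultimately have "?m div F ^ i = F * (t K * F ^ e) + m div F ^ i" by (simp only:)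
    hence "digit F ?m i = digit F m i" by (simp add: digit_def)
    thus ?thesis using m e by simp
  qed
  ultimately show ?case by blast
qed simp

text \<open>Register 13 holds the carry. All \<open>K\<close> positions are visited even when the
  carry has died out, which still fits the budget; incrementing the last vector wraps around to
  zero.\<close>

definition odometer :: ram where
  "odometer = Seq (assign 13 (ENum 1)) (for_loop 14 1
     (Seq (assign 15 (EAdd (arr 0 (EVar 14)) (EVar 13)))
       (ifle (EVar 15) (EVar 2)
         (Seq (put (adr 0 (EVar 14)) (EVar 15)) (assign 13 (ENum 0)))
         (Seq (put (adr 0 (EVar 14)) (ENum 0)) (assign 13 (ENum 1))))))"

context layout begin

abbreviation dig :: "nat \<Rightarrow> nat \<Rightarrow> nat" where
  "dig \<equiv> digit (Suc fmax)"

lemma runs_odometer: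
  assumes b: "base v" and T: "\<And>i. i < K \<Longrightarrow> T i = real (dig m i)"
  shows "runs odometer v (mem T U C L S B) (100 * K) (\<lambda>v' M'. frame 13 v v' \<and>
    (\<exists>T. (\<forall>i<K. T i = real (dig (Suc m) i)) \<and> M' = mem T U C L S B))"
    (is "runs _ _ _ _ ?Q")
proof -
  let ?T = "\<lambda>k i. if i < k then real (dig (Suc m) i) else T i"
  \<comment> \<open>The initial carry 1, which performs the increment, is covered by the same
    formula because \<open>Suc fmax ^ 0\<close> divides everything.\<close>
  let ?c = "\<lambda>k. if Suc fmax ^ k dvd Suc m then 1 else 0 :: nat"
  let ?J = "\<lambda>k v' M'. M' = mem (?T k) U C L S B \<and> v' 13 = real (?c k)"
  let ?keep = "Seq (put (adr 0 (EVar 14)) (EVar 15)) (assign 13 (ENum 0))"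
  let ?wrap = "Seq (put (adr 0 (EVar 14)) (ENum 0)) (assign 13 (ENum 1))"
  let ?body = "Seq (assign 15 (EAdd (arr 0 (EVar 14)) (EVar 13))) (ifle (EVar 15) (EVar 2) ?keep ?wrap)"
  have body: "runs ?body v' (mem (?T k) U C L S B) 60
      (\<lambda>v'' M''. v'' 14 = real k \<and> frame 13 v' v'' \<and> ?J (Suc k) v'' M'')" (is "runs _ _ ?M _ ?P")
    if b': "base v'" and k: "k < K" "v' 14 = real k" and c: "v' 13 = real (?c k)" for v' k
  proof -
    let ?s = "dig m k + ?c k"
    have upd: "(?T k)(k := real (dig (Suc m) k)) = ?T (Suc k)" by (auto simp: less_Suc_eq)
    have 1: "runs (assign 15 (EAdd (arr 0 (EVar 14)) (EVar 13))) v' ?M 20 (\<lambda>w N. w = v'(15 := real ?s) \<and> N = ?M)"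
    proof (rule runs_assign)
      show "safe (EAdd (arr 0 (EVar 14)) (EVar 13)) v' ?M" using safe_arr[OF b', of "EVar 14" _ k] k by simp
      have "ev (arr 0 (EVar 14)) v' ?M = real (dig m k)" using ev_arr(1)[OF b', of "EVar 14" "?T k" U C L S B k] k T by simp
      thus "v'(15 := ev (EAdd (arr 0 (EVar 14)) (EVar 13)) v' ?M) = v'(15 := real ?s) \<and> ?M = ?M" using c by simp
    qed auto
    let ?w = "v'(15 := real ?s)"
    have b'': "base ?w" using b' by simp
    have 2: "runs (ifle (EVar 15) (EVar 2) ?keep ?wrap) ?w ?M 35 ?P"
    proof (rule runs_ifle[where T = 25])
      have iff: "ev (EVar 15) ?w ?M \<le> ev (EVar 2) ?w ?M \<longleftrightarrow> ?s < Suc fmax"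
        using b' by (simp add: baseD less_Suc_eq_le flip: of_nat_add)
      {
        assume "ev (EVar 15) ?w ?M \<le> ev (EVar 2) ?w ?M"
        hence s: "?s < Suc fmax" using iff by blast
        from digit_Suc(1)[OF zero_less_Suc refl this]
        have d: "dig (Suc m) k = ?s" "?c (Suc k) = 0" by auto
        have 3: "runs (put (adr 0 (EVar 14)) (EVar 15)) ?w ?M 18 (\<lambda>w N. w = ?w \<and> N = mem (?T (Suc k)) U C L S B)"
          by (rule runs_put_T[where i = k, OF b'']) (use k upd d in auto)
        show "runs ?keep ?w ?M 25 ?P"
          by (rule runs_Seq[OF 3, where T' = 5]) (use k d in \<open>auto intro!: runs_assign simp del: power_Suc\<close>)
      }
      assume "\<not> ev (EVar 15) ?w ?M \<le> ev (EVar 2) ?w ?M"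
      hence s: "\<not> ?s < Suc fmax" using iff by blast
      from digit_Suc(2)[OF zero_less_Suc refl this]
      have d: "dig (Suc m) k = 0" "?c (Suc k) = 1" by auto
      have 3: "runs (put (adr 0 (EVar 14)) (ENum 0)) ?w ?M 18 (\<lambda>w N. w = ?w \<and> N = mem (?T (Suc k)) U C L S B)"
        by (rule runs_put_T[where i = k, OF b'']) (use k upd d in auto)
      show "runs ?wrap ?w ?M 25 ?P"
        by (rule runs_Seq[OF 3, where T' = 5]) (use k d in \<open>auto intro!: runs_assign simp del: power_Suc\<close>)
    qed auto
    show ?thesis
      by (rule runs_Seq[OF 1, where T' = 35]) (use 2 in auto)
  qed
  have 1: "runs (assign 13 (ENum 1)) v (mem T U C L S B) 5 (\<lambda>w N. w = v(13 := 1) \<and> N = mem T U C L S B)"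
    by (rule runs_assign) auto
  have 2: "runs (for_loop 14 1 ?body) (v(13 := 1)) (mem T U C L S B) (K * (60 + 13) + 10) ?Q"
  proof (rule runs_for[where d = 13 and N = K and T = 60 and J = ?J])
    fix i v' M'
    assume i: "i < K" "frame 13 (v(13 := 1)) v'" "v' 14 = real i" and J: "?J i v' M'"
    have "base v'" using base_frame[OF _ i(2)] b by simp
    thus "runs ?body v' M' 60 (\<lambda>v'' M''. v'' 14 = real i \<and> frame 13 v' v'' \<and> ?J (Suc i) v'' M'')"
      using body[of v' i] i J by blast
  next
    fix v' M' assume "frame 13 (v(13 := 1)) v'" "?J K v' M'"
    thus "?Q v' M'" by (intro conjI exI[of _ "?T K"]) (auto simp: frame_def)
  qed (use b in \<open>auto simp: baseD\<close>)
  show ?thesis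
    unfolding odometer_def
    by (rule runs_Seq[OF 1, where T' = "K * (60 + 13) + 10"]) (use 2 K_pos in auto)
qed

end

section \<open>Evaluating a threshold vector\<close>

definition min_code :: ram where
  "min_code = Seq (assign 14 (EVar 2)) (for_loop 16 1
     (ifle (arr 0 (EVar 16)) (EVar 14) (assign 14 (arr 0 (EVar 16))) Skip))"

definition cvar_code :: ram where
  "cvar_code = Seq min_code (Seq (assign 15 (ENum 0)) (Seq
     (for_loop 16 1 (assign 15 (EAdd (EVar 15) (EMul (vec 6 (EVar 16)) (arr 0 (EVar 16))))))
     (assign 13 (ESub (EVar 15) (EMul (EVar 9) (EVar 14))))))"

definition var_code :: ram where
  "var_code = Seq min_code (Seq (assign 15 (ENum 0)) (Seq
     (for_loop 16 1 (ifle (arr 0 (EVar 16)) (EVar 14) (assign 15 (EAdd (EVar 15) (vec 6 (EVar 16)))) Skip))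
     (ifle (EVar 9) (EVar 15) (assign 13 (EVar 14)) (assign 13 (EVar 2)))))"

context layout begin

text \<open>The running minimum starts at \<open>fmax\<close>, which no threshold exceeds, so this
  start does not change the result.\<close>

lemma runs_min_code:
  assumes b: "base v" and T: "\<And>i. i < K \<Longrightarrow> T i = real (t i)" and t: "\<And>i. i < K \<Longrightarrow> t i \<le> fmax"
  shows "runs min_code v (mem T U C L S B) (70 * K) (\<lambda>v' M'. frame 14 v v' \<and> M' = mem T U C L S B \<and>
    v' 14 = real (min_thr I t))"
    (is "runs _ _ ?M _ ?Q")
proof -
  let ?m = "\<lambda>k. Min (insert fmax (t ` {..<k}))"
  let ?J = "\<lambda>k v' M'. M' = ?M \<and> v' 14 = real (?m k)"
  let ?body = "ifle (arr 0 (EVar 16)) (EVar 14) (assign 14 (arr 0 (EVar 16))) Skip"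
  have step: "?m (Suc k) = min (t k) (?m k)" for k
  proof -
    have "insert fmax (t ` {..<Suc k}) = insert (t k) (insert fmax (t ` {..<k}))"
      by (auto simp: lessThan_Suc)
    thus ?thesis by simp
  qed
  have 1: "runs (assign 14 (EVar 2)) v ?M 5 (\<lambda>w N. w = v(14 := real fmax) \<and> N = ?M)"
    by (rule runs_assign) (use b in \<open>auto simp: baseD\<close>)
  have 2: "runs (for_loop 16 1 ?body) (v(14 := real fmax)) ?M (K * (35 + 13) + 10) ?Q"
  proof (rule runs_for[where d = 14 and N = K and T = 35 and J = ?J])
    fix i v' M'
    assume i: "i < K" "frame 14 (v(14 := real fmax)) v'" "v' 16 = real i" and J: "?J i v' M'"
    have b': "base v'" using base_frame[OF _ i(2)] b by simp
    have acc: "safe (arr 0 (EVar 16)) v' ?M" "ev (arr 0 (EVar 16)) v' ?M = real (t i)"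
      using safe_arr[OF b', of "EVar 16" _ i] ev_arr(1)[OF b', of "EVar 16" T U C L S B i] i T by auto
    obtain x where x: "v' 14 = real x" "?m (Suc i) = min (t i) x" using J step by blast
    have "runs ?body v' ?M 35 (\<lambda>v'' M''. v'' 16 = real i \<and> frame 14 v' v'' \<and> ?J (Suc i) v'' M'')"
    proof (rule runs_ifle[where T = 20])
      show "runs (assign 14 (arr 0 (EVar 16))) v' ?M 20 (\<lambda>v'' M''. v'' 16 = real i \<and> frame 14 v' v'' \<and> ?J (Suc i) v'' M'')"
        if "ev (arr 0 (EVar 16)) v' ?M \<le> ev (EVar 14) v' ?M"
        using that acc i x(1) unfolding x(2) by (intro runs_assign) auto
      show "runs Skip v' ?M 20 (\<lambda>v'' M''. v'' 16 = real i \<and> frame 14 v' v'' \<and> ?J (Suc i) v'' M'')"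
        if "\<not> ev (arr 0 (EVar 16)) v' ?M \<le> ev (EVar 14) v' ?M"
        using that acc i x(1) unfolding x(2) by (intro runs_Skip) auto
    qed (use acc in auto)
    thus "runs ?body v' M' 35 (\<lambda>v'' M''. v'' 16 = real i \<and> frame 14 v' v'' \<and> ?J (Suc i) v'' M'')"
      using J by blast
  next
    fix v' M' assume fr: "frame 14 (v(14 := real fmax)) v'" and J: "?J K v' M'"
    have "?m K = min fmax (min_thr I t)"
      unfolding min_thr_def using K_pos by (subst Min_insert) (auto simp: lessThan_empty_iff)
    also have "\<dots> = min_thr I t"
      using min_thr_le[of 0 t] t[of 0] K_pos by (simp add: min_def)
    finally show "?Q v' M'" using J fr by (simp add: frame_def)
  qed (use b in \<open>auto simp: baseD\<close>)
  show ?thesis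
    unfolding min_code_def
    by (rule runs_Seq[OF 1, where T' = "K * (35 + 13) + 10"]) (use 2 K_pos in auto)
qed

lemma runs_cvar_code:
  assumes b: "base v" and T: "\<And>i. i < K \<Longrightarrow> T i = real (t i)" and t: "\<And>i. i < K \<Longrightarrow> t i \<le> fmax"
  shows "runs cvar_code v (mem T U C L S B) (200 * K) (\<lambda>v' M'. frame 13 v v' \<and> M' = mem T U C L S B \<and>
    v' 13 = cvar_value al I t)"
    (is "runs _ _ ?M _ ?Q")
proof -
  let ?m = "real (min_thr I t)"
  let ?s = "\<lambda>k. \<Sum>i<k. q i * real (t i)"
  let ?J = "\<lambda>k v' M'. M' = ?M \<and> v' 15 = ?s k"
  let ?e = "EAdd (EVar 15) (EMul (vec 6 (EVar 16)) (arr 0 (EVar 16)))"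
  have 2: "runs (Seq (assign 15 (ENum 0)) (Seq (for_loop 16 1 (assign 15 ?e))
      (assign 13 (ESub (EVar 15) (EMul (EVar 9) (EVar 14)))))) v' ?M (5 + (K * (40 + 13) + 10 + 20)) ?Q"
    if fr: "frame 14 v v'" and m: "v' 14 = ?m" for v'
  proof (rule runs_Seq[where Q' = "\<lambda>w N. w = v'(15 := 0) \<and> N = ?M", OF _ _ order_refl])
    show "runs (assign 15 (ENum 0)) v' ?M 5 (\<lambda>w N. w = v'(15 := 0) \<and> N = ?M)"
      by (rule runs_assign) auto
    have b': "base v'" using base_frame[OF b fr] by simp
    have 3: "runs (for_loop 16 1 (assign 15 ?e)) (v'(15 := 0)) ?M (K * (40 + 13) + 10)
       (\<lambda>w N. frame 15 v' w \<and> N = ?M \<and> w 15 = ?s K)"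
    proof (rule runs_for[where d = 15 and N = K and T = 40 and J = ?J])
      fix i w N
      assume i: "i < K" "frame 15 (v'(15 := 0)) w" "w 16 = real i" and J: "?J i w N"
      have bw: "base w" using base_frame[OF _ i(2)] b' by simp
      have acc: "safe (arr 0 (EVar 16)) w ?M" "ev (arr 0 (EVar 16)) w ?M = real (t i)"
          "safe (vec 6 (EVar 16)) w ?M" "ev (vec 6 (EVar 16)) w ?M = q i"
        using safe_arr[OF bw, of "EVar 16" _ i] ev_arr(1)[OF bw, of "EVar 16" T U C L S B i] i T
          prob_access[OF bw, of "EVar 16" T U C L S B i] by auto
      show "runs (assign 15 ?e) w N 40 (\<lambda>v'' M''. v'' 16 = real i \<and> frame 15 w v'' \<and> ?J (Suc i) v'' M'')"
        using acc J i by (intro runs_assign) auto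
    qed (use b' in \<open>auto simp: baseD frame_def\<close>)
    have 4: "runs (assign 13 (ESub (EVar 15) (EMul (EVar 9) (EVar 14)))) w ?M 20 ?Q"
      if w: "frame 15 v' w" "w 15 = ?s K" for w
    proof (rule runs_assign)
      have "w 14 = ?m" "frame 13 v w" "w 9 = al"
        using w fr m baseD(10)[OF b] by (auto simp: frame_def)
      thus "?Q (w(13 := ev (ESub (EVar 15) (EMul (EVar 9) (EVar 14))) w ?M)) ?M"
        using w by (simp add: cvar_value_def)
    qed auto
    fix w N assume "w = v'(15 := 0) \<and> N = ?M"
    thus "runs (Seq (for_loop 16 1 (assign 15 ?e)) (assign 13 (ESub (EVar 15) (EMul (EVar 9) (EVar 14))))) w N
        (K * (40 + 13) + 10 + 20) ?Q"
      using runs_Seq[OF 3 _ order_refl, of _ 20 ?Q] 4 by auto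
  qed
  show ?thesis
    unfolding cvar_code_def
    by (rule runs_Seq[OF runs_min_code[OF b T t], where T' = "5 + (K * (40 + 13) + 10 + 20)"])
       (use 2 K_pos in auto)
qed

lemma runs_var_code:
  assumes b: "base v" and T: "\<And>i. i < K \<Longrightarrow> T i = real (t i)" and t: "\<And>i. i < K \<Longrightarrow> t i \<le> fmax"
  shows "runs var_code v (mem T U C L S B) (200 * K) (\<lambda>v' M'. frame 13 v v' \<and> M' = mem T U C L S B \<and>
    v' 13 = var_value al fmax I t)"
    (is "runs _ _ ?M _ ?Q")
proof -
  let ?m = "real (min_thr I t)"
  let ?s = "\<lambda>k. \<Sum>i<k. if t i \<le> min_thr I t then q i else 0"
  let ?J = "\<lambda>k v' M'. M' = ?M \<and> v' 15 = ?s k"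
  let ?body = "ifle (arr 0 (EVar 16)) (EVar 14) (assign 15 (EAdd (EVar 15) (vec 6 (EVar 16)))) Skip"
  let ?end = "ifle (EVar 9) (EVar 15) (assign 13 (EVar 14)) (assign 13 (EVar 2))"
  have 2: "runs (Seq (assign 15 (ENum 0)) (Seq (for_loop 16 1 ?body) ?end)) v' ?M (5 + (K * (40 + 13) + 10 + 20)) ?Q"
    if fr: "frame 14 v v'" and m: "v' 14 = ?m" for v'
  proof (rule runs_Seq[where Q' = "\<lambda>w N. w = v'(15 := 0) \<and> N = ?M", OF _ _ order_refl])
    show "runs (assign 15 (ENum 0)) v' ?M 5 (\<lambda>w N. w = v'(15 := 0) \<and> N = ?M)"
      by (rule runs_assign) auto
    have b': "base v'" using base_frame[OF b fr] by simp
    have 3: "runs (for_loop 16 1 ?body) (v'(15 := 0)) ?M (K * (40 + 13) + 10)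
       (\<lambda>w N. frame 15 v' w \<and> N = ?M \<and> w 15 = ?s K)"
    proof (rule runs_for[where d = 15 and N = K and T = 40 and J = ?J])
      fix i w N
      assume i: "i < K" "frame 15 (v'(15 := 0)) w" "w 16 = real i" and J: "?J i w N"
      have bw: "base w" using base_frame[OF _ i(2)] b' by simp
      have wm: "w 14 = ?m" using frameD[OF i(2), of 14] m by simp
      have acc: "safe (arr 0 (EVar 16)) w ?M" "ev (arr 0 (EVar 16)) w ?M = real (t i)"
          "safe (vec 6 (EVar 16)) w ?M" "ev (vec 6 (EVar 16)) w ?M = q i"
        using safe_arr[OF bw, of "EVar 16" _ i] ev_arr(1)[OF bw, of "EVar 16" T U C L S B i] i T
          prob_access[OF bw, of "EVar 16" T U C L S B i] by auto
      have "runs ?body w ?M 40 (\<lambda>v'' M''. v'' 16 = real i \<and> frame 15 w v'' \<and> ?J (Suc i) v'' M'')" (is "runs _ _ _ _ ?P")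
      proof (rule runs_ifle[where T = 20])
        show "runs (assign 15 (EAdd (EVar 15) (vec 6 (EVar 16)))) w ?M 20 ?P"
          if "ev (arr 0 (EVar 16)) w ?M \<le> ev (EVar 14) w ?M"
          using that acc J i wm by (intro runs_assign) auto
        show "runs Skip w ?M 20 ?P" if "\<not> ev (arr 0 (EVar 16)) w ?M \<le> ev (EVar 14) w ?M"
          using that acc J i wm by (intro runs_Skip) auto
      qed (use acc in auto)
      thus "runs ?body w N 40 ?P" using J by blast
    qed (use b' in \<open>auto simp: baseD frame_def\<close>)
    have 4: "runs ?end w ?M 20 ?Q" if w: "frame 15 v' w" "w 15 = ?s K" for w
    proof (rule runs_ifle[where T = 5])
      have w': "w 14 = ?m" "frame 13 v w" "w 9 = al" "w 2 = real fmax"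
        using w fr m baseD(10)[OF b] baseD(3)[OF b] by (auto simp: frame_def)
      show "runs (assign 13 (EVar 14)) w ?M 5 ?Q" if "ev (EVar 9) w ?M \<le> ev (EVar 15) w ?M"
        using that w w' by (intro runs_assign) (auto simp: var_value_def)
      show "runs (assign 13 (EVar 2)) w ?M 5 ?Q" if "\<not> ev (EVar 9) w ?M \<le> ev (EVar 15) w ?M"
        using that w w' by (intro runs_assign) (auto simp: var_value_def)
    qed auto
    fix w N assume "w = v'(15 := 0) \<and> N = ?M"
    thus "runs (Seq (for_loop 16 1 ?body) ?end) w N (K * (40 + 13) + 10 + 20) ?Q"
      using runs_Seq[OF 3 _ order_refl, of _ 20 ?Q] 4 by auto
  qed
  show ?thesis
    unfolding var_code_def
    by (rule runs_Seq[OF runs_min_code[OF b T t], where T' = "5 + (K * (40 + 13) + 10 + 20)"])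
       (use 2 K_pos in auto)
qed

end

section \<open>The solver\<close>

definition record_best :: ram where
  "record_best = ifle (ENum 1) (EVar 14) (ifle (EVar 13) (EVar 11)
     (Seq (for_loop 15 0 (put (adr 5 (EVar 15)) (arr 4 (EVar 15)))) (assign 11 (EVar 13))) Skip) Skip"

definition prologue :: "nat \<Rightarrow> expr \<Rightarrow> ram" where
  "prologue l e = Seq (assign 0 (EMem (ENum l))) (Seq (assign 1 (EMem (ENum (l + 1))))
     (Seq (assign 2 (EMem (ENum (l + 2)))) (Seq (assign 3 (ENum (l + 3)))
     (Seq (assign 4 (EAdd (EVar 3) (EVar 0))) (Seq (assign 5 (EAdd (EVar 4) (EMul (EVar 1) (EVar 0))))
     (Seq (assign 6 (EAdd (EVar 5) (EMul (EVar 1) (EVar 0)))) (Seq (assign 7 (EAdd (EVar 6) (EVar 1)))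
     (Seq (assign 8 (EAdd (EVar 7) (EMul (EVar 0) (EVar 0))))
       (assign 9 e)))))))))"

definition count_thresholds :: ram where
  "count_thresholds = Seq (assign 10 (ENum 1))
     (for_loop 12 1 (assign 10 (EMul (EVar 10) (EAdd (EVar 2) (ENum 1)))))"

definition try_threshold :: "ram \<Rightarrow> ram" where
  "try_threshold P = Seq P (Seq greedy (Seq record_best odometer))"

definition output_best :: ram where
  "output_best = for_loop 12 0 (put (EVar 12) (arr 5 (EVar 12)))"

text \<open>The program depends only on the number \<open>l\<close> of parameters and the evaluator,
  so one program serves all instances, as the quantifiers of \<open>solvable_in_O\<close> demand.
  The level is read from memory cell 0, since it cannot be a program constant.\<close>

definition solver :: "nat \<Rightarrow> ram \<Rightarrow> ram" where
  "solver l P = Seq (prologue l (if l = 0 then ENum 0 else EMem (ENum 0))) (Seq count_thresholds (Seq (assign 11 (EAdd (EVar 2) (ENum 1)))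
     (Seq (for_loop 12 10 (try_threshold P)) output_best)))"

lemma runs_assign_Seq:
  assumes "safe e v M" "x < 30" "esteps e \<le> 8" "ev e v M = c" "runs P (v(x := c)) M T Q"
  shows "runs (Seq (assign x e) P) v M (10 + T) Q"
  by (rule runs_Seq[where T = 10 and Q' = "\<lambda>w N. w = v(x := c) \<and> N = M", OF _ _ order_refl])
     (use assms in \<open>auto intro: runs_assign\<close>)

context layout begin

lemma runs_record_best:
  assumes b: "base v"
  shows "runs record_best v (mem T U C L S B) (100 * n) (\<lambda>v' M'. frame 11 v v' \<and> v' 12 = v 12 \<and>
    (\<exists>B'. M' = mem T U C L S B' \<and>
      (if 1 \<le> v 14 \<and> v 13 \<le> v 11 then v' 11 = v 13 \<and> (\<forall>k<n. B' k = S k) else v' 11 = v 11 \<and> B' = B)))"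
    (is "runs _ _ ?M _ ?Q")
  unfolding record_best_def
proof (rule runs_ifle[where T = "53 * n + 30"])
  have skip: "runs Skip v ?M Z ?Q" if "\<not> (1 \<le> v 14 \<and> v 13 \<le> v 11)" "1 \<le> Z" for Z
    using that by (intro runs_Skip) auto
  show "runs Skip v ?M (53 * n + 30) ?Q" if "\<not> ev (ENum 1) v ?M \<le> ev (EVar 14) v ?M"
    using that by (intro skip) auto
  assume ok: "ev (ENum 1) v ?M \<le> ev (EVar 14) v ?M"
  show "runs (ifle (EVar 13) (EVar 11)
     (Seq (for_loop 15 0 (put (adr 5 (EVar 15)) (arr 4 (EVar 15)))) (assign 11 (EVar 13))) Skip) v ?M (53 * n + 30) ?Q"
  proof (rule runs_ifle[where T = "53 * n + 20"])
    show "runs Skip v ?M (53 * n + 20) ?Q" if "\<not> ev (EVar 13) v ?M \<le> ev (EVar 11) v ?M"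
      using that by (intro skip) auto
    assume le: "ev (EVar 13) v ?M \<le> ev (EVar 11) v ?M"
    let ?B = "\<lambda>k i. if i < k then S i else B i"
    have 1: "runs (for_loop 15 0 (put (adr 5 (EVar 15)) (arr 4 (EVar 15)))) v ?M (n * (40 + 13) + 10)
       (\<lambda>w N. frame 15 v w \<and> N = mem T U C L S (?B n))"
    proof (rule runs_for[where d = 15 and N = n and T = 40 and J = "\<lambda>k w N. N = mem T U C L S (?B k)"])
      fix i w N assume i: "i < n" "frame 15 v w" "w 15 = real i" and N: "N = mem T U C L S (?B i)"
      have bw: "base w" using base_frame[OF b i(2)] by simp
      have upd: "(?B i)(i := S i) = ?B (Suc i)" by (auto simp: less_Suc_eq)
      show "runs (put (adr 5 (EVar 15)) (arr 4 (EVar 15))) w N 40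
         (\<lambda>w' N'. w' 15 = real i \<and> frame 15 w w' \<and> N' = mem T U C L S (?B (Suc i)))"
        unfolding N
        by (rule runs_put_B[where i = i, OF bw])
           (use i upd safe_arr[OF bw, of "EVar 15" _ i] ev_arr(5)[OF bw, of "EVar 15" T U C L S "?B i" i] in auto)
    qed (use b in \<open>auto simp: baseD\<close>)
    show "runs (Seq (for_loop 15 0 (put (adr 5 (EVar 15)) (arr 4 (EVar 15)))) (assign 11 (EVar 13))) v ?M (53 * n + 20) ?Q"
    proof (rule runs_Seq[OF 1, where T' = 5])
      fix w N assume w: "frame 15 v w \<and> N = mem T U C L S (?B n)"
      show "runs (assign 11 (EVar 13)) w N 5 ?Q"
      proof (rule runs_assign)
        have "w 13 = v 13" "w 12 = v 12" "frame 11 v w" using w by (auto simp: frame_def)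
        thus "?Q (w(11 := ev (EVar 13) w N)) N" using w ok le by (auto intro!: exI[of _ "?B n"])
      qed auto
    qed auto
  qed auto
qed (use n_pos in auto)

lemma runs_count_thresholds:
  assumes b: "base v"
  shows "runs count_thresholds v M (50 * K) (\<lambda>v' M'. M' = M \<and> base v' \<and> v' 10 = real (Suc fmax ^ K))"
    (is "runs _ _ _ _ ?Q")
proof -
  let ?body = "assign 10 (EMul (EVar 10) (EAdd (EVar 2) (ENum 1)))"
  have 1: "runs (assign 10 (ENum 1)) v M 3 (\<lambda>w N. w = v(10 := 1) \<and> N = M)"
    by (rule runs_assign) auto
  have 2: "runs (for_loop 12 1 ?body) (v(10 := 1)) M (K * (10 + 13) + 10) ?Q"
  proof (rule runs_for[where d = 10 and N = K and T = 10 and J = "\<lambda>k w N. N = M \<and> w 10 = real (Suc fmax ^ k)"])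
    fix i w N assume i: "frame 10 (v(10 := 1)) w" "w 12 = real i" and J: "N = M \<and> w 10 = real (Suc fmax ^ i)"
    have "base w" using base_frame[OF _ i(1)] b by simp
    hence "w 2 = real fmax" by (simp add: baseD)
    thus "runs ?body w N 10 (\<lambda>w' N'. w' 12 = real i \<and> frame 10 w w' \<and> N' = M \<and> w' 10 = real (Suc fmax ^ Suc i))"
      using i J by (intro runs_assign) (auto simp: algebra_simps)
  next
    fix w N assume "frame 10 (v(10 := 1)) w" "N = M \<and> w 10 = real (Suc fmax ^ K)"
    thus "?Q w N" using base_frame[of "v(10 := 1)" 10 w] b by simp
  qed (use b in \<open>auto simp: baseD\<close>)
  show ?thesis
    unfolding count_thresholds_def
    by (rule runs_Seq[OF 1, where T' = "K * (10 + 13) + 10"]) (use 2 K_pos in auto)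
qed

text \<open>The output cells lie inside the input region, as \<open>n \<le> aE\<close>. Copying thus
  destroys input only, never an entry of the best schedule that is still to be read.\<close>

lemma runs_output_best:
  assumes b: "base v"
  shows "runs output_best v (mem T U C L S B) (70 * n) (\<lambda>v' M'. \<forall>k<n. M' k = B k)"
    (is "runs _ _ ?M _ ?Q")
  unfolding output_best_def
proof (rule runs_for[where d = 12 and N = n and T = 40 and J = "\<lambda>k w N. N = (\<lambda>a. if a < k then B a else ?M a)"])
  fix i w N assume i: "i < n" "frame 12 v w" "w 12 = real i" and N: "N = (\<lambda>a. if a < i then B a else ?M a)"
  have bw: "base w" using base_frame[OF b i(2)] by simp
  have "i < aE" using i by (simp add: aE_def aA_def aQ_def aD_def aP_def)
  hence "N (aE + (6 * i + 5)) = B i" using mem_arr(6)[of T U C L S B i] N by simp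
  hence e: "ev (arr 5 (EVar 12)) w N = B i"
    unfolding arr_def ev.simps(6) using ev_adr[OF bw, of "EVar 12" N i 5] i by (simp only: ev.simps floor_of_nat nat_int)
  have "N(i := B i) = (\<lambda>a. if a < Suc i then B a else ?M a)" unfolding N by (auto simp: less_Suc_eq)
  thus "runs (put (EVar 12) (arr 5 (EVar 12))) w N 40
     (\<lambda>w' N'. w' 12 = real i \<and> frame 12 w w' \<and> N' = (\<lambda>a. if a < Suc i then B a else ?M a))"
    using i e safe_arr[OF bw, of "EVar 12" N i] by (intro runs_put) auto
qed (use b n_pos in \<open>auto simp: baseD\<close>)

lemma runs_prologue:
  assumes "M l = real n" "M (l + 1) = real K" "M (l + 2) = real fmax" "aW = l + 3"
    "\<And>v. safe e v M" "\<And>v. ev e v M = al" "esteps e \<le> 8"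
  shows "runs (prologue l e) v M 100 (\<lambda>v' M'. M' = M \<and> base v')"
    (is "runs _ _ _ _ ?Q")
proof -
  let ?v8 = "v(0 := real n, 1 := real K, 2 := real fmax, 3 := real aW, 4 := real aP, 5 := real aD,
    6 := real aQ, 7 := real aA, 8 := real aE)"
  have 9: "runs (assign 9 e) ?v8 M 10 ?Q"
    by (rule runs_assign) (use assms in \<open>auto simp: base_def\<close>)
  have num: "ev (EMem (ENum c)) v' M = M c" for c v' by simp
  note Seq = runs_assign_Seq
  have "runs (prologue l e) v M (10 + (10 + (10 + (10 + (10 + (10 + (10 + (10 + (10 + 10))))))))) ?Q"
    unfolding prologue_def
    by (rule Seq[OF _ _ _ _ Seq[OF _ _ _ _ Seq[OF _ _ _ _ Seq[OF _ _ _ _ Seq[OF _ _ _ _ Seq[OF _ _ _ _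
          Seq[OF _ _ _ _ Seq[OF _ _ _ _ Seq[OF _ _ _ _ 9]]]]]]]]])
       (unfold num, use assms(1-4) in \<open>simp_all add: aP_def aD_def aQ_def aA_def aE_def\<close>)
  thus ?thesis by simp
qed

lemma runs_prologue_init:
  assumes "par = [] \<and> al = 0 \<or> par = [al]"
  shows "runs (prologue (length par) (if length par = 0 then ENum 0 else EMem (ENum 0))) v (mem T U C L S B) 100
    (\<lambda>v' M'. M' = mem T U C L S B \<and> base v')"
proof (rule runs_prologue)
  have le: "length par + 2 < aE" using n_pos by (simp add: aE_def aA_def aQ_def aD_def aP_def aW_def)
  show "mem T U C L S B (length par) = real n" "mem T U C L S B (length par + 1) = real K"
    "mem T U C L S B (length par + 2) = real fmax"
    using mem_inp[of _ T U C L S B] inp_header le by simp_all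
  show "aW = length par + 3" by (rule aW_def)
  have "mem T U C L S B 0 = al" if "par = [al]"
  proof -
    have "encode par I fmax ! 0 = al" using that by (simp add: encode_def Let_def)
    hence "inp 0 = al" by (simp add: inp_def)
    thus ?thesis using mem_inp[of 0 T U C L S B] le by simp
  qed
  thus "ev (if length par = 0 then ENum 0 else EMem (ENum 0)) v (mem T U C L S B) = al" for v
    using assms by auto
qed auto

section \<open>Invariant of the search and optimality of its result\<close>

definition evaluates :: "ram \<Rightarrow> ((nat \<Rightarrow> nat) \<Rightarrow> real) \<Rightarrow> bool" where
  "evaluates P val \<longleftrightarrow> (\<forall>v T U C L S B t. base v \<longrightarrow> (\<forall>i<K. T i = real (t i)) \<longrightarrow> (\<forall>i<K. t i \<le> fmax) \<longrightarrow>
      runs P v (mem T U C L S B) (200 * K) (\<lambda>v' M'. frame 13 v v' \<and> M' = mem T U C L S B \<and> v' 13 = val t))"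

lemma cvar_code_evaluates: "evaluates cvar_code (cvar_value al I)"
  unfolding evaluates_def using runs_cvar_code by blast

lemma var_code_evaluates: "evaluates var_code (var_value al fmax I)"
  unfolding evaluates_def using runs_var_code by blast

text \<open>Before any schedule is found, \<open>fmax + 1\<close> stands for an infinite best value.\<close>

definition best_upto :: "((nat \<Rightarrow> nat) \<Rightarrow> real) \<Rightarrow> nat \<Rightarrow> real \<Rightarrow> (nat \<Rightarrow> real) \<Rightarrow> bool" where
  "best_upto val m x B \<longleftrightarrow> (\<forall>m'<m. \<forall>\<pi>. meets I (dig m') \<pi> \<longrightarrow> x \<le> val (dig m')) \<and>
     (x = real fmax + 1 \<or> (\<exists>t \<pi>. meets I t \<pi> \<and> x = val t \<and> (\<forall>k<n. B k = real (\<pi> ! k))))"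

lemma best_upto_record:
  assumes "best_upto val m x B" "meets I (dig m) \<pi>" "val (dig m) \<le> x" "\<forall>k<n. B' k = real (\<pi> ! k)"
  shows "best_upto val (Suc m) (val (dig m)) B'"
  unfolding best_upto_def
proof (intro conjI allI impI)
  fix m' \<pi>' assume "m' < Suc m" and m: "meets I (dig m') \<pi>'"
  then consider "m' < m" | "m' = m" by linarith
  thus "val (dig m) \<le> val (dig m')"
  proof cases
    case 1
    hence "x \<le> val (dig m')" using assms(1) m unfolding best_upto_def by blast
    thus ?thesis using assms(3) by linarith
  qed simp
qed (use assms in blast)

lemma best_upto_keep:
  assumes "best_upto val m x B" "(\<forall>\<pi>. \<not> meets I (dig m) \<pi>) \<or> \<not> val (dig m) \<le> x"
  shows "best_upto val (Suc m) x B"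
  using assms unfolding best_upto_def by (auto simp: less_Suc_eq)

lemma runs_try_threshold:
  assumes P: "evaluates P val"
    and b: "base v" and tr: "tracks V U C L" and T: "\<And>i. i < K \<Longrightarrow> T i = real (dig m i)"
    and best: "best_upto val m (v 11) B"
  shows "runs (try_threshold P) v (mem T U C L S B) (1600 * (n * n * K)) (\<lambda>v' M'. v' 12 = v 12 \<and> frame 11 v v' \<and>
    (\<exists>T V U C L S B. M' = mem T U C L S B \<and> tracks V U C L \<and> (\<forall>i<K. T i = real (dig (Suc m) i)) \<and>
      best_upto val (Suc m) (v' 11) B))"
    (is "runs _ _ _ _ ?Q")
proof -
  have dig_le: "dig m i \<le> fmax" for i using digit_less[of "Suc fmax" m i] by simp
  have 3: "runs odometer w N (100 * K) ?Q"
    if w: "w 12 = v 12" "frame 11 v w" and N: "N = mem T U C L S B" and "tracks V U C L" "best_upto val (Suc m) (w 11) B"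
    for w N V U C L S B
  proof -
    have "base w" using base_frame[OF b w(2)] by simp
    note od = runs_odometer[where m = m and U = U and C = C and L = L and S = S and B = B, OF this T]
    show ?thesis unfolding N
    proof (rule runs_conseq[OF od order_refl])
      fix w' N'
      assume "frame 13 w w' \<and> (\<exists>T. (\<forall>i<K. T i = real (dig (Suc m) i)) \<and> N' = mem T U C L S B)"
      moreover from this have "w' 12 = v 12" "frame 11 v w'" "w' 11 = w 11" using w by (auto simp: frame_def)
      ultimately show "?Q w' N'" using that by metis
    qed
  qed
  have 2: "runs (Seq record_best odometer) w N (100 * n + 100 * K) ?Q"
    if w: "frame 14 v' w" and v': "frame 13 v v'" "v' 13 = val (dig m)" and N: "N = mem T U C L S B" "tracks V U C L"
      and ok: "w 14 = 1 \<and> (\<exists>\<pi>. meets I (dig m) \<pi> \<and> (\<forall>k<n. S k = real (\<pi> ! k))) \<or> w 14 = 0 \<and> (\<forall>\<pi>. \<not> meets I (dig m) \<pi>)"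
    for v' w N V U C L S
  proof -
    have w': "frame 13 v w" "w 13 = val (dig m)" using w v' by (auto simp: frame_def)
    have bw: "base w" using base_frame[OF b w'(1)] by simp
    have w1: "w 11 = v 11" "w 12 = v 12" using w'(1) by (auto simp: frame_def)
    show ?thesis unfolding N(1)
    proof (rule runs_Seq[OF runs_record_best[OF bw] _ order_refl])
      fix u N'
      assume u: "frame 11 w u \<and> u 12 = w 12 \<and> (\<exists>B'. N' = mem T U C L S B' \<and>
        (if 1 \<le> w 14 \<and> w 13 \<le> w 11 then u 11 = w 13 \<and> (\<forall>k<n. B' k = S k) else u 11 = w 11 \<and> B' = B))"
      then obtain B' where B': "N' = mem T U C L S B'"
        "if 1 \<le> w 14 \<and> w 13 \<le> w 11 then u 11 = w 13 \<and> (\<forall>k<n. B' k = S k) else u 11 = w 11 \<and> B' = B" by blast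
      have "best_upto val (Suc m) (u 11) B'"
      proof (cases "1 \<le> w 14 \<and> w 13 \<le> w 11")
        case True
        then obtain \<pi> where "meets I (dig m) \<pi>" "\<forall>k<n. S k = real (\<pi> ! k)" using ok by auto
        thus ?thesis using True B'(2) w' w1 best_upto_record[OF best, of \<pi> B'] by simp
      next
        case False
        hence "(\<forall>\<pi>. \<not> meets I (dig m) \<pi>) \<or> \<not> val (dig m) \<le> v 11" using ok w' w1 by auto
        from best_upto_keep[OF best this] show ?thesis using False B'(2) w1 by simp
      qed
      moreover have "frame 11 v u" "u 12 = v 12" using u w' by (auto simp: frame_def)
      ultimately show "runs odometer u N' (100 * K) ?Q" using 3 B'(1) N(2) by blast
    qed
  qed
  have 1: "runs (Seq greedy (Seq record_best odometer)) v' (mem T U C L S B) (1200 * (n * n * K) + (100 * n + 100 * K)) ?Q"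
    if v': "frame 13 v v'" "v' 13 = val (dig m)" for v'
  proof -
    have "base v'" using base_frame[OF b v'(1)] by simp
    note gr = runs_greedy[where t = "dig m" and S = S and B = B, OF this tr T]
    show ?thesis
    proof (rule runs_Seq[OF gr _ order_refl])
      fix w N
      assume "frame 14 v' w \<and> (\<exists>V U C L S. tracks V U C L \<and> N = mem T U C L S B \<and>
        (w 14 = 1 \<and> (\<exists>\<pi>. meets I (dig m) \<pi> \<and> (\<forall>k<n. S k = real (\<pi> ! k))) \<or> w 14 = 0 \<and> (\<forall>\<pi>. \<not> meets I (dig m) \<pi>)))"
      then obtain V U C L S where "frame 14 v' w" "tracks V U C L" "N = mem T U C L S B"
        "w 14 = 1 \<and> (\<exists>\<pi>. meets I (dig m) \<pi> \<and> (\<forall>k<n. S k = real (\<pi> ! k))) \<or> w 14 = 0 \<and> (\<forall>\<pi>. \<not> meets I (dig m) \<pi>)"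
        by blast
      thus "runs (Seq record_best odometer) w N (100 * n + 100 * K) ?Q" using v' by (intro 2)
    qed
  qed
  have "n \<le> n * n * K" "K \<le> n * n * K" using n_pos K_pos by simp_all
  hence time: "200 * K + (1200 * (n * n * K) + (100 * n + 100 * K)) \<le> 1600 * (n * n * K)" by linarith
  show ?thesis
    unfolding try_threshold_def
    by (rule runs_Seq[OF P[unfolded evaluates_def, rule_format, OF b T dig_le] _ time]) (use 1 in auto)
qed

text \<open>Let the search end with a schedule \<open>\<pi>\<close> recorded for \<open>t\<close>,
  and let \<open>t'\<close> be the vector that \<open>lower\<close> yields for a competitor
  \<open>\<pi>'\<close>. Then \<open>\<kappa> * obj I \<pi> \<le> val t \<le> val t' \<le> \<kappa>
  * obj I \<pi>'\<close>; the middle step holds because \<open>t'\<close> agrees below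
  \<open>K\<close> with an enumerated vector. The factor \<open>\<kappa>\<close> accommodates the
  scaled value used for CVaR.\<close>

lemma solver_correct:
  assumes P: "evaluates P val"
    and par: "par = [] \<and> al = 0 \<or> par = [al]"
    and \<kappa>: "\<kappa> > 0"
    and upper: "\<And>t \<pi>. meets I t \<pi> \<Longrightarrow> \<kappa> * obj I \<pi> \<le> val t"
    and lower: "\<And>\<pi>. schedule I \<pi> \<Longrightarrow> \<exists>t. (\<forall>i<K. t i \<le> fmax) \<and> meets I t \<pi> \<and> val t \<le> \<kappa> * obj I \<pi>"
    and val_le: "\<And>t. (\<And>i. i < K \<Longrightarrow> t i \<le> fmax) \<Longrightarrow> val t \<le> real fmax"
    and val_cong: "\<And>t t'. (\<And>i. i < K \<Longrightarrow> t i = t' i) \<Longrightarrow> val t = val t'"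
  shows "solves_within obj par (solver (length par) P) I fmax
    (3000 * (real (fmax + 1) ^ K * (real K * real n ^ 2)))"
proof -
  let ?z = "\<lambda>_. 0 :: real"
  let ?M = "mem ?z ?z ?z ?z ?z ?z"
  let ?N = "Suc fmax ^ K"
  let ?Out = "\<lambda>v M. \<exists>\<pi>. is_arg_min (obj I) (schedule I) \<pi> \<and> (\<forall>k<n. M k = real (\<pi> ! k))"
  let ?J = "\<lambda>m v M. \<exists>T V U C L S B. M = mem T U C L S B \<and> tracks V U C L \<and>
      (\<forall>i<K. T i = real (dig m i)) \<and> best_upto val m (v 11) B"
  have init: "init_store (encode par I fmax) = (?z, ?M)"
  proof -
    have "?M = arrays (replicate 6 ?z)" by (simp add: mem_def numeral_eq_Suc)
    also have "\<dots> = (\<lambda>a. if a < aE then inp a else 0)" by (simp add: arrays_def fun_eq_iff)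
    finally show ?thesis by (auto simp: init_store_def length_encode inp_def fun_eq_iff)
  qed
  have optimal: "?Out v B" if best: "best_upto val ?N x B" for v x B
  proof -
    have le: "x \<le> val t" if t: "\<forall>i<K. t i \<le> fmax" and m: "meets I t \<pi>" for t \<pi>
    proof -
      obtain m' where m': "m' < ?N" "\<forall>i<K. dig m' i = t i"
        using ex_digits[of K t "Suc fmax"] t by (auto simp: less_Suc_eq_le)
      have "meets I (dig m') \<pi>" using m m'(2) by (simp add: meets_def)
      hence "x \<le> val (dig m')" using best m'(1) unfolding best_upto_def by blast
      also have "\<dots> = val t" using m'(2) by (intro val_cong) auto
      finally show ?thesis .
    qed
    obtain \<pi>0 where "schedule I \<pi>0" using ex_schedule by blast
    then obtain t0 where t0: "\<forall>i<K. t0 i \<le> fmax" "meets I t0 \<pi>0" using lower by blast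
    \<comment> \<open>Some schedule exists, and it meets a vector within the enumerated range, of
      value at most \<open>fmax\<close>; so the initial best value cannot have survived.\<close>
    have "x \<noteq> real fmax + 1" using le[OF t0] val_le[of t0] t0(1) by auto
    then obtain t \<pi> where \<pi>: "meets I t \<pi>" "x = val t" "\<forall>k<n. B k = real (\<pi> ! k)"
      using best unfolding best_upto_def by blast
    have "obj I \<pi> \<le> obj I \<pi>'" if sch: "schedule I \<pi>'" for \<pi>'
    proof -
      obtain t' where t': "\<forall>i<K. t' i \<le> fmax" "meets I t' \<pi>'" "val t' \<le> \<kappa> * obj I \<pi>'"
        using lower[OF sch] by blast
      have "\<kappa> * obj I \<pi> \<le> \<kappa> * obj I \<pi>'" using upper[OF \<pi>(1)] \<pi>(2) le[OF t'(1,2)] t'(3) by linarith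
      thus ?thesis using \<kappa> by simp
    qed
    hence "is_arg_min (obj I) (schedule I) \<pi>"
      using \<pi>(1) unfolding is_arg_min_def meets_def by (auto simp: not_less)
    thus ?thesis using \<pi>(3) by blast
  qed
  have 5: "runs output_best v M (70 * n) ?Out" if b: "base v" and J: "?J ?N v M" for v M
  proof -
    obtain T V U C L S B where M: "M = mem T U C L S B" and best: "best_upto val ?N (v 11) B"
      using J by blast
    from runs_output_best[OF b, of T U C L S B] show ?thesis
      unfolding M by (rule runs_conseq) (use optimal[OF best] in auto)
  qed
  let ?t = "1600 * (n * n * K)"
  have 4: "runs (for_loop 12 10 (try_threshold P)) v ?M (?N * (?t + 13) + 10) (\<lambda>v' M'. base v' \<and> ?J ?N v' M')"
    if b: "base v" and v: "v 10 = real ?N" "v 11 = real fmax + 1" for v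
  proof (rule runs_for[where d = 11 and N = ?N and T = ?t and J = ?J])
    \<comment> \<open>The memory behind the input is initially zero, which already represents the
      empty unscheduled set and the first threshold vector.\<close>
    have "tracks {} ?z ?z ?z" by (simp add: tracks_def load_def)
    moreover have "best_upto val 0 (v 11) ?z" using v by (simp add: best_upto_def)
    moreover have "\<forall>i<K. ?z i = real (dig 0 i)" by (simp add: digit_def)
    ultimately show "?J 0 v ?M" by blast
    fix m w M
    assume w: "frame 11 v w" "w 12 = real m" and "?J m w M"
    then obtain T V U C L S B where *: "M = mem T U C L S B" "tracks V U C L"
      "\<forall>i<K. T i = real (dig m i)" "best_upto val m (w 11) B" by blast
    have "base w" using base_frame[OF b w(1)] by simp
    from runs_try_threshold[OF P this *(2) *(3)[rule_format] *(4)]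
    show "runs (try_threshold P) w M ?t (\<lambda>v'' M''. v'' 12 = real m \<and> frame 11 w v'' \<and> ?J (Suc m) v'' M'')"
      unfolding *(1) w(2) .
  next
    fix w M assume w: "frame 11 v w" and "?J ?N w M"
    thus "base w \<and> ?J ?N w M" using base_frame[OF b w] by simp
  qed (use v in auto)
  let ?t4 = "?N * (?t + 13) + 10 + 70 * n"
  have 45: "runs (Seq (for_loop 12 10 (try_threshold P)) output_best) v ?M ?t4 ?Out"
    if "base v" "v 10 = real ?N" "v 11 = real fmax + 1" for v
    by (rule runs_Seq[OF 4[OF that] _ order_refl]) (use 5 in blast)
  have 345: "runs (Seq (assign 11 (EAdd (EVar 2) (ENum 1))) (Seq (for_loop 12 10 (try_threshold P)) output_best)) v ?M
      (10 + ?t4) ?Out" if "base v" "v 10 = real ?N" for v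
    by (rule runs_assign_Seq) (use that 45[of "v(11 := real fmax + 1)"] in \<open>auto simp: baseD\<close>)
  have 2345: "runs (Seq count_thresholds (Seq (assign 11 (EAdd (EVar 2) (ENum 1)))
      (Seq (for_loop 12 10 (try_threshold P)) output_best))) v ?M (50 * K + (10 + ?t4)) ?Out" if "base v" for v
    by (rule runs_Seq[OF runs_count_thresholds[OF that] _ order_refl]) (use 345 in blast)
  have "runs (solver (length par) P) ?z ?M (100 + (50 * K + (10 + ?t4))) ?Out"
    unfolding solver_def
    by (rule runs_Seq[OF runs_prologue_init[OF par] _ order_refl]) (use 2345 in blast)
  then obtain t R M v where ex: "exec (solver (length par) P) (?z, ?M) t (R, M)"
    "t \<le> 100 + (50 * K + (10 + ?t4))" "?Out v M"
    using frame_refl by (rule runsE)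
  \<comment> \<open>Every term of the running time is at most its coefficient times
    \<open>?N * (n * n * K)\<close>; the coefficients sum to 1853.\<close>
  have "t \<le> 3000 * (?N * (K * n\<^sup>2))"
  proof -
    let ?x = "?N * (n * n * K)"
    have "?N \<ge> 1" by simp
    hence "?N \<le> ?x" "1 \<le> ?x" "n \<le> ?x" "K \<le> ?x" using n_pos K_pos by simp_all
    moreover have "?N * (?t + 13) = 1600 * ?x + 13 * ?N" by (simp add: algebra_simps)
    ultimately have "t \<le> 3000 * ?x" using ex(2) by linarith
    thus ?thesis by (simp add: power2_eq_square algebra_simps)
  qed
  hence "real t \<le> real (3000 * (?N * (K * n\<^sup>2)))" by (rule of_nat_mono)
  hence "real t \<le> 3000 * (real (fmax + 1) ^ K * (real K * real n ^ 2))"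
    by (simp only: of_nat_mult of_nat_power of_nat_numeral Suc_eq_plus1)
  thus ?thesis unfolding solves_within_def init using ex by blast
qed

end

section \<open>Complexity bounds for the three objectives\<close>

lemma solvable_in_O_if_uniform:
  assumes "\<And>I fmax. valid_instance I \<Longrightarrow> cost_bound I fmax \<Longrightarrow>
    solves_within obj par P I fmax (c * (real (fmax + 1) ^ nscens I * (real (nscens I) * real (njobs I) ^ 2)))"
    and "0 \<le> c"
  shows "solvable_in_O obj par (\<lambda>n K fmax. real fmax ^ K * (real K * real n ^ 2))"
  unfolding solvable_in_O_def
proof (intro exI[of _ P] conjI allI)
  fix K
  have "solves_within obj par P I fmax (c * 2 ^ K * (real fmax ^ K * (real K * real (njobs I) ^ 2)))"
    if "valid_instance I" "nscens I = K" "cost_bound I fmax" "fmax \<ge> 1" for I fmax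
  proof -
    have "real (fmax + 1) ^ K \<le> (2 * real fmax) ^ K" using that(4) by (intro power_mono) auto
    hence "c * (real (fmax + 1) ^ K * (real K * real (njobs I) ^ 2)) \<le>
        c * ((2 * real fmax) ^ K * (real K * real (njobs I) ^ 2))"
      using assms(2) by (intro mult_left_mono mult_right_mono) auto
    also have "\<dots> = c * 2 ^ K * (real fmax ^ K * (real K * real (njobs I) ^ 2))"
      by (simp add: power_mult_distrib)
    finally show ?thesis
      using assms(1)[OF that(1,3)] that(2) unfolding solves_within_def by (meson order_trans)
  qed
  thus "\<exists>c. \<forall>I fmax. valid_instance I \<and> nscens I = K \<and> cost_bound I fmax \<and> fmax \<ge> 1 \<longrightarrow>
      solves_within obj par P I fmax (c * (real fmax ^ K * (real K * real (njobs I) ^ 2)))"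
    by blast
next
  show "\<exists>c. \<forall>I fmax. valid_instance I \<and> cost_bound I fmax \<longrightarrow> solves_within obj par P I fmax
      (c * (real (fmax + 1) ^ nscens I * (real (nscens I) * real (njobs I) ^ 2)))"
    using assms(1) by blast
qed

lemma solvable_Exp:
  shows "solvable_in_O Exp_cost [] (\<lambda>n K fmax. real fmax ^ K * (real K * real n ^ 2))"
proof (rule solvable_in_O_if_uniform)
  fix I fmax assume "valid_instance I" "cost_bound I fmax"
  then interpret layout I fmax "[]" 0 by unfold_locales
  show "solves_within Exp_cost [] (solver (length ([] :: real list)) cvar_code) I fmax
    (3000 * (real (fmax + 1) ^ nscens I * (real (nscens I) * real (njobs I) ^ 2)))"
  proof (rule solver_correct[where \<kappa> = "1" and val = "cvar_value 0 I", OF cvar_code_evaluates])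
    show "1 * Exp_cost I \<pi> \<le> cvar_value 0 I t" if "meets I t \<pi>" for t \<pi>
      using Exp_le_value[OF that] by simp
    show "\<exists>t. (\<forall>i<K. t i \<le> fmax) \<and> meets I t \<pi> \<and> cvar_value 0 I t \<le> 1 * Exp_cost I \<pi>"
      if "schedule I \<pi>" for \<pi>
      using value_le_Exp[OF that] by simp
    show "cvar_value 0 I t \<le> real fmax" if "\<And>i. i < K \<Longrightarrow> t i \<le> fmax" for t
      using that by (intro cvar_value_le order_refl)
    show "cvar_value 0 I t = cvar_value 0 I t'" if "\<And>i. i < K \<Longrightarrow> t i = t' i" for t t'
      using that by (rule cvar_value_cong)
  qed simp_all
qed simp

lemma solvable_CVaR:
  assumes "0 \<le> \<alpha>" "\<alpha> < 1"
  shows "solvable_in_O (CVaR_cost \<alpha>) [\<alpha>] (\<lambda>n K fmax. real fmax ^ K * (real K * real n ^ 2))"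
proof (rule solvable_in_O_if_uniform)
  fix I fmax assume "valid_instance I" "cost_bound I fmax"
  then interpret layout I fmax "[\<alpha>]" \<alpha> by unfold_locales
  show "solves_within (CVaR_cost \<alpha>) [\<alpha>] (solver (length [\<alpha>]) cvar_code) I fmax
    (3000 * (real (fmax + 1) ^ nscens I * (real (nscens I) * real (njobs I) ^ 2)))"
  proof (rule solver_correct[where \<kappa> = "(1 - \<alpha>)" and val = "cvar_value \<alpha> I", OF cvar_code_evaluates])
    show "(1 - \<alpha>) * (CVaR_cost \<alpha>) I \<pi> \<le> cvar_value \<alpha> I t" if "meets I t \<pi>" for t \<pi>
      using CVaR_le_value[OF that assms] by simp
    show "\<exists>t. (\<forall>i<K. t i \<le> fmax) \<and> meets I t \<pi> \<and> cvar_value \<alpha> I t \<le> (1 - \<alpha>) * (CVaR_cost \<alpha>) I \<pi>"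
      if "schedule I \<pi>" for \<pi>
      using value_le_CVaR[OF that assms] by simp
    show "cvar_value \<alpha> I t \<le> real fmax" if "\<And>i. i < K \<Longrightarrow> t i \<le> fmax" for t
      using that assms by (intro cvar_value_le)
    show "cvar_value \<alpha> I t = cvar_value \<alpha> I t'" if "\<And>i. i < K \<Longrightarrow> t i = t' i" for t t'
      using that by (rule cvar_value_cong)
  qed (use assms in simp_all)
qed simp

lemma solvable_VaR:
  assumes "0 < \<alpha>" "\<alpha> \<le> 1"
  shows "solvable_in_O (VaR_cost \<alpha>) [\<alpha>] (\<lambda>n K fmax. real fmax ^ K * (real K * real n ^ 2))"
proof (rule solvable_in_O_if_uniform)
  fix I fmax assume "valid_instance I" "cost_bound I fmax"
  then interpret layout I fmax "[\<alpha>]" \<alpha> by unfold_locales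
  show "solves_within (VaR_cost \<alpha>) [\<alpha>] (solver (length [\<alpha>]) var_code) I fmax
    (3000 * (real (fmax + 1) ^ nscens I * (real (nscens I) * real (njobs I) ^ 2)))"
  proof (rule solver_correct[where \<kappa> = "1" and val = "var_value \<alpha> fmax I", OF var_code_evaluates])
    show "1 * (VaR_cost \<alpha>) I \<pi> \<le> var_value \<alpha> fmax I t" if "meets I t \<pi>" for t \<pi>
      using VaR_le_value[OF that assms] by simp
    show "\<exists>t. (\<forall>i<K. t i \<le> fmax) \<and> meets I t \<pi> \<and> var_value \<alpha> fmax I t \<le> 1 * (VaR_cost \<alpha>) I \<pi>"
      if "schedule I \<pi>" for \<pi>
      using value_le_VaR[OF that assms] by simp
    show "var_value \<alpha> fmax I t \<le> real fmax" if "\<And>i. i < K \<Longrightarrow> t i \<le> fmax" for t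
      using that assms by (intro var_value_le)
    show "var_value \<alpha> fmax I t = var_value \<alpha> fmax I t'" if "\<And>i. i < K \<Longrightarrow> t i = t' i" for t t'
      using that by (rule var_value_cong)
  qed (use assms in simp_all)
qed simp

theorem theorem15:
  shows "solvable_in_O Exp_cost [] (\<lambda>n K fmax. real fmax ^ K * (real K * real n ^ 2)) \<and>
    (\<forall>\<alpha>\<in>{0<..1}. solvable_in_O (VaR_cost \<alpha>) [\<alpha>]
       (\<lambda>n K fmax. real fmax ^ K * (real K * real n ^ 2))) \<and>
    (\<forall>\<alpha>\<in>{0..<1}. solvable_in_O (CVaR_cost \<alpha>) [\<alpha>]
       (\<lambda>n K fmax. real fmax ^ K * (real K * real n ^ 2)))"
  using solvable_Exp solvable_VaR solvable_CVaR by auto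

end
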